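(* For every $d\ge2$ there exist a finite point set $\mathcal S\subset\mathbb R^d$ and two compact $(d-1)$-dimensional topological submanifolds $\mathcal C,\mathcal C'\subset\mathbb R^d$ without boundary, having different numbers of connected components, such that $\mathcal S\subset\mathcal C\cap\mathcal C'$ and $\mathcal S$ is a $0.72$-sample of both $\mathcal C$ and $\mathcal C'$.
   Context: For a closed set $\mathcal C\subset\mathbb R^d$, the medial axis $\mathcal M$ is the set of points of $\mathbb R^d$ that do not have a unique closest point in $\mathcal C$, $\mathrm{lfs}(p)=d(p,\mathcal M)$ for $p\in\mathcal C$ (Euclidean distance), and a finite set $\mathcal S\subset\mathcal C$ is an $\epsilon$-sample of $\mathcal C$ if $d(p,\mathcal S)<\epsilon\,\mathrm{lfs}(p)$ for all $p\in\mathcal C$. *)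

theory Defs
  imports "HOL-Analysis.Analysis"
begin

definition medial_axis :: "'a::euclidean_space set \<Rightarrow> 'a set" where
  "medial_axis C = {x. \<not> (\<exists>!q. q \<in> C \<and> (\<forall>c\<in>C. dist x q \<le> dist x c))}"

definition lfs :: "'a::euclidean_space set \<Rightarrow> 'a \<Rightarrow> real" where
  "lfs C p = infdist p (medial_axis C)"

text \<open>S is an eps-sample of C: S finite subset of C with d(p,S) < eps * lfs(p) for all p in C.
  Since S is finite, d(p,S) < r iff some s in S has dist p s < r; an empty medial axis
  means lfs = infinity, so the inequality only requires S to be nonempty.\<close>
definition eps_sample :: "real \<Rightarrow> 'a::euclidean_space set \<Rightarrow> 'a set \<Rightarrow> bool" where
  "eps_sample eps S C \<longleftrightarrow> finite S \<and> S \<subseteq> C \<and>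
     (\<forall>p\<in>C. \<exists>s\<in>S. medial_axis C = {} \<or> dist p s < eps * lfs C p)"

text \<open>C is a k-dimensional topological submanifold without boundary: every point has a
  neighbourhood in C homeomorphic to an open subset of R^k (realised as a k-dimensional
  linear subspace of the ambient space).\<close>
definition top_manifold_no_boundary :: "nat \<Rightarrow> 'a::euclidean_space set \<Rightarrow> bool" where
  "top_manifold_no_boundary k C \<longleftrightarrow>
     (\<forall>p\<in>C. \<exists>U T V. openin (top_of_set C) U \<and> p \<in> U \<and> subspace (T::'a set) \<and> dim T = k \<and>
        openin (top_of_set T) V \<and> U homeomorphic V)"

end

theory Submission
  imports Defs
begin

text \<open>Both hypersurfaces are obtained by unfolding and rotating an arc of circles in a wedge of angle
  \<open>\<pi>/4\<close>.  Put eight copies of the wedge around a point of the plane, reflecting from each copy to the next.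
  A strand enters the wedge from outside, close to its axis.  It may bend towards the upper or towards
  the lower bounding ray; reflections close the first choice up to a single curve and the second one to four
  separate loops.  The two versions are mirror images in the axis and cross it at the same two points
  \<open>a\<close> and \<open>e\<close> before they merge tangentially at \<open>f\<close>; all points after \<open>f\<close> may be used as samples.

  Away from the bounding ray from which the strand bends away, all medial axis points have distance at
  least 1 to the curve: the arcs have radius at least 1, and their normal tubes of width 1 are
  disjoint.  So it suffices that each point of the strand has a sample at distance less than
  0.72 times the minimum of 1 and its distance to that ray.

  The folding map and the passage to a surface of revolution are 1-Lipschitz and admit isometric lifts, hence
  distances to the medial axis can be estimated in the wedge.  In dimension \<open>d\<close> the unfolded curve, rotated about
  a distant line, is homeomorphic to the product of the curve with the sphere of dimension \<open>d - 2\<close>.  A finite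
  sample is extracted from all admissible sample points by compactness.\<close>

section \<open>Circular arcs\<close>

text \<open>The obstacle: before \<open>f\<close> the strand and its mirror image share only the two
  points on the axis, so these must serve the whole inner part. Meanwhile a bounding ray that the
  strand does not cross enters the medial axis itself, since a point of it has equally near points
  in two neighbouring copies. A ray crossed at a right angle, with the centre of the circle on it,
  creates no such points nearby; this is why the first and the last centre lie on the rays. After
  \<open>f\<close> each point is its own sample, and only a positive lower bound on the local
  feature size is needed.

  The medial axis is never determined. Off the axis of rotation its points fold to
  \<open>critical\<close> points, and only the distance to those is bounded from below.

  Dimension 2 needs no separate treatment. The component counts are c and 4c, where c is the number
  of components of the sphere of dimension d - 2, be it a pair of points or connected; all that
  matters is that c is finite and positive.\<close>

definition arc_point :: "real \<Rightarrow> real \<Rightarrow> real \<Rightarrow> real \<Rightarrow> real \<Rightarrow> complex" where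
  "arc_point e x y r t = Complex (x + r * sin t) (e * (y - r * cos t))"

lemma Re_arc_point [simp]: "Re (arc_point e x y r t) = x + r * sin t"
  and Im_arc_point [simp]: "Im (arc_point e x y r t) = e * (y - r * cos t)"
  by (simp_all add: arc_point_def)

lemma dist_complex_sq: "(dist a b)\<^sup>2 = (Re a - Re b)\<^sup>2 + (Im a - Im b)\<^sup>2"
  by (simp add: dist_norm cmod_power2)

lemma continuous_arc_point: "continuous_on T (arc_point e x y r)"
  unfolding arc_point_def
  by (intro continuous_intros)

text \<open>The component of \<open>z\<close>, taken from the centre of the circle, along the tangent at angle \<open>t\<close>.\<close>
definition tangential :: "real \<Rightarrow> real \<Rightarrow> real \<Rightarrow> real \<Rightarrow> complex \<Rightarrow> real" where
  "tangential e x y t z = (Re z - x) * cos t + (e * Im z - y) * sin t"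

lemma tangential_arc_point:
  assumes "e * e = 1"
  shows "tangential e x y t (arc_point e x y r s) = r * sin (s - t)"
proof -
  have "e * (e * (y - r * cos s)) = y - r * cos s"
    using assms by (simp only: mult.assoc [symmetric]) simp
  then have "tangential e x y t (arc_point e x y r s) = (x + r * sin s - x) * cos t + (y - r * cos s - y) * sin t"
    by (simp only: tangential_def Re_arc_point Im_arc_point)
  then show ?thesis
    by (simp add: sin_diff algebra_simps)
qed

text \<open>A vanishing tangential component puts \<open>z\<close> on the normal line through the
  arc point, that is, on a concentric circle at the same angle. The signed radius \<open>r'\<close>
  is the coordinate along this normal.\<close>

lemma arc_point_of_tangential_zero:
  assumes e: "e * e = 1" and "tangential e x y t z = 0"
  shows "\<exists>r'. z = arc_point e x y r' t \<and> dist z (arc_point e x y r t) = \<bar>r' - r\<bar>"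
proof -
  define u where "u = Re z - x"
  define v where "v = e * Im z - y"
  define r' where "r' = u * sin t - v * cos t"
  have 0: "u * cos t + v * sin t = 0"
    using assms(2) by (simp add: tangential_def u_def v_def)
  have sc: "sin t * sin t + cos t * cos t = 1"
    by (metis power2_eq_square sin_cos_squared_add)
  have "r' * sin t = u * (sin t * sin t + cos t * cos t) - cos t * (u * cos t + v * sin t)"
    unfolding r'_def by algebra
  then have U: "u = r' * sin t" using 0 sc by simp
  have "r' * cos t = - v * (sin t * sin t + cos t * cos t) + sin t * (u * cos t + v * sin t)"
    unfolding r'_def by algebra
  then have V: "v = - r' * cos t" using 0 sc by simp
  have "Im z = e * (e * Im z)" using e by (simp add: mult.assoc [symmetric])
  then have im: "Im z = e * (y - r' * cos t)" using V v_def by (metis add.commute add_uminus_conv_diff diff_eq_eq mult_minus_left)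
  have z: "z = arc_point e x y r' t"
    using U im by (simp add: complex_eq_iff u_def)
  have "(dist z (arc_point e x y r t))\<^sup>2 = ((r' - r) * sin t)\<^sup>2 + (e * e) * ((r' - r) * cos t)\<^sup>2"
    unfolding dist_complex_sq z by (simp add: power2_eq_square algebra_simps)
  also have "\<dots> = (r' - r)\<^sup>2 * (sin t * sin t + cos t * cos t)"
    using e by algebra
  finally have "(dist z (arc_point e x y r t))\<^sup>2 = \<bar>r' - r\<bar>\<^sup>2"
    using sc by simp
  then have "dist z (arc_point e x y r t) = \<bar>r' - r\<bar>"
    by (metis abs_ge_zero power2_eq_imp_eq zero_le_dist)
  with z show ?thesis by blast
qed

text \<open>For a fixed point, the squared distance to a point moving on the circle is a constant
  plus a sinusoid in the angle. The first-order condition below and the sampling estimates rest on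
  this form.\<close>

lemma dist_arc_point_sq:
  assumes "e * e = 1"
  shows "(dist z (arc_point e x y r t))\<^sup>2 =
         (Re z - x)\<^sup>2 + (e * Im z - y)\<^sup>2 + r\<^sup>2 - 2 * r * ((Re z - x) * sin t - (e * Im z - y) * cos t)"
proof -
  have "(Im z - e * (y - r * cos t))\<^sup>2 = (e * e) * (Im z - e * (y - r * cos t))\<^sup>2"
    using assms by simp
  also have "\<dots> = (e * Im z - (e * e) * (y - r * cos t))\<^sup>2"
    by (simp add: power2_eq_square algebra_simps)
  finally have 1: "(Im z - e * (y - r * cos t))\<^sup>2 = (e * Im z - (y - r * cos t))\<^sup>2"
    using assms by simp
  have "(sin t)\<^sup>2 + (cos t)\<^sup>2 = 1" by simp
  then have "(r * sin t)\<^sup>2 + (r * cos t)\<^sup>2 = r\<^sup>2"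
    by (metis distrib_left mult.right_neutral power_mult_distrib)
  then show ?thesis
    unfolding dist_complex_sq Re_arc_point Im_arc_point 1
    by (simp add: power2_eq_square algebra_simps)
qed

text \<open>First-order condition on an interval, kept one-sided so that at a joint each of the two
  adjacent arcs contributes one inequality. The factor \<open>r\<close> takes care of right turns,
  where the radius is negative.\<close>

lemma nearest_arc_point_tangential:
  assumes e: "e * e = 1"
    and near: "\<And>t'. l \<le> t' \<Longrightarrow> t' \<le> u \<Longrightarrow> dist z (arc_point e x y r t) \<le> dist z (arc_point e x y r t')"
    and t: "l \<le> t" "t \<le> u"
  shows "l < t \<Longrightarrow> 0 \<le> r * tangential e x y t z"
    and "t < u \<Longrightarrow> r * tangential e x y t z \<le> 0"
proof -
  \<comment> \<open>Up to a constant, \<open>f\<close> is minus half the squared distance, so the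
    nearest point maximizes it.\<close>
  define f where "f s = r * ((Re z - x) * sin s - (e * Im z - y) * cos s)" for s
  have fd: "(f has_real_derivative r * tangential e x y t z) (at t)"
    unfolding f_def tangential_def by (auto intro!: derivative_eq_intros simp: algebra_simps)
  have le: "f t' \<le> f t" if "l \<le> t'" "t' \<le> u" for t'
  proof -
    have "(dist z (arc_point e x y r t))\<^sup>2 \<le> (dist z (arc_point e x y r t'))\<^sup>2"
      using near[OF that] by (simp add: power_mono)
    then show ?thesis
      unfolding dist_arc_point_sq[OF e] f_def by (simp add: algebra_simps)
  qed
  show "0 \<le> r * tangential e x y t z" if "l < t"
  proof (rule ccontr)
    assume "\<not> ?thesis"
    then obtain d where "d > 0" and d: "\<And>h. 0 < h \<Longrightarrow> h < d \<Longrightarrow> f t < f (t - h)"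
      using DERIV_neg_dec_left[OF fd] by (auto simp: not_le)
    define h where "h = min (d/2) (t - l)"
    have "0 < h" "h < d" "l \<le> t - h" "t - h \<le> u"
      using \<open>d > 0\<close> that t by (auto simp: h_def min_def)
    then show False using d[of h] le[of "t - h"] by linarith
  qed
  show "r * tangential e x y t z \<le> 0" if "t < u"
  proof (rule ccontr)
    assume "\<not> ?thesis"
    then obtain d where "d > 0" and d: "\<And>h. 0 < h \<Longrightarrow> h < d \<Longrightarrow> f t < f (t + h)"
      using DERIV_pos_inc_right[OF fd] by (auto simp: not_le)
    define h where "h = min (d/2) (u - t)"
    have "0 < h" "h < d" "l \<le> t + h" "t + h \<le> u"
      using \<open>d > 0\<close> that t by (auto simp: h_def min_def)
    then show False using d[of h] le[of "t + h"] by linarith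
  qed
qed

lemma arc_point_angle_unique:
  assumes e: "e * e = 1" and eq: "arc_point e x y r t = arc_point e x y r' t'"
    and r: "r * r' > 0" and t: "\<bar>t - t'\<bar> < pi"
  shows "t = t'"
proof -
  have "tangential e x y t' (arc_point e x y r t) = tangential e x y t' (arc_point e x y r' t')"
    using eq by simp
  then have "r * sin (t - t') = 0" by (simp add: tangential_arc_point[OF e])
  then have "sin (t - t') = 0" using r by auto
  then show "t = t'"
    using t sin_zero_iff_int2[of "t - t'"] sin_gt_zero[of "t - t'"] sin_gt_zero[of "t' - t"]
    by (metis abs_less_iff diff_gt_0_iff_gt linorder_neqE_linordered_idom minus_diff_eq neg_0_equal_iff_equal sin_minus
        less_irrefl)
qed

section \<open>The curve and its tubes\<close>

definition arc_set :: "real \<Rightarrow> real \<Rightarrow> real \<Rightarrow> real \<Rightarrow> real \<Rightarrow> real \<Rightarrow> complex set" where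
  "arc_set e x y r l u = arc_point e x y r ` {l..u}"

text \<open>A relation between a point and its foot on the arc rather than a set of points, because
  uniqueness of the foot across all arcs is what is needed later. Only normal segments over the arc
  count; there are no caps around its ends.\<close>

definition in_tube :: "real \<Rightarrow> real \<Rightarrow> real \<Rightarrow> real \<Rightarrow> real \<Rightarrow> real \<Rightarrow> complex \<Rightarrow> complex \<Rightarrow> bool" where
  "in_tube e x y r l u z q \<longleftrightarrow>
     (\<exists>t r'. l \<le> t \<and> t \<le> u \<and> \<bar>r' - r\<bar> < 1 \<and> z = arc_point e x y r' t \<and> q = arc_point e x y r t)"

lemma in_tubeE:
  assumes "in_tube e x y r l u z q"
  obtains t r' where "l \<le> t" "t \<le> u" "\<bar>r' - r\<bar> < 1"
    "z = arc_point e x y r' t" "q = arc_point e x y r t"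
  using assms unfolding in_tube_def by blast

lemma in_tube_self:
  assumes "q \<in> arc_set e x y r l u"
  shows "in_tube e x y r l u q q"
  using assms unfolding arc_set_def in_tube_def by force

text \<open>Centres of the five circles, in coordinates whose first axis bisects the wedge.  Consecutive circles
  are tangent; the first centre lies on the upper ray, the last one on the lower ray, and the fourth and fifth
  circle touch the axis.  The first radius 3/2 and the tangent directions \<open>-\<pi>/3\<close> and \<open>\<pi>/6\<close> were found
  numerically; they leave a margin of about 0.01 in the two tight sampling conditions, at the start of the curve
  and at its lowest point.\<close>

definition c1x :: real where "c1x = (sqrt 3 / 2 + 1 / 4) * (1 + sqrt 2)"
definition c1y :: real where "c1y = sqrt 3 / 2 + 1 / 4"
definition c2x :: real where "c2x = c1x - sqrt 3 / 4"
definition c2y :: real where "c2y = sqrt 3 / 2"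
definition c3x :: real where "c3x = c2x + 1"
definition c3y :: real where "c3y = - (sqrt 3 / 2)"
definition dip :: real where "dip = arccos ((2 + sqrt 3) / 4)"
definition c4x :: real where "c4x = c3x + 2 * sin dip"
definition c5r :: real where "c5r = c4x * (sqrt 2 - 1)"

section \<open>Numerical bounds for the constants\<close>

lemma sqrt_bounds: "17320/10000 < sqrt 3" "sqrt 3 < 17321/10000" "14142/10000 < sqrt 2" "sqrt 2 < 14143/10000"
  by (rule real_less_rsqrt real_less_lsqrt; simp add: power2_eq_square)+

abbreviation "sa \<equiv> sin (pi / 8)"
abbreviation "ca \<equiv> cos (pi / 8)"

lemma sa_pos: "0 < sa" and ca_pos: "0 < ca"
  by (auto intro!: sin_gt_zero cos_gt_zero)

lemma double_eighth: "2 * sa * ca = sqrt 2 / 2" "2 * ca\<^sup>2 = 1 + sqrt 2 / 2" "sa\<^sup>2 + ca\<^sup>2 = 1"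
proof -
  have "pi / 4 = 2 * (pi / 8)" by simp
  then show "2 * sa * ca = sqrt 2 / 2" "2 * ca\<^sup>2 = 1 + sqrt 2 / 2"
    using sin_double[of "pi/8"] cos_double_cos[of "pi/8"] sin_45 cos_45 by (simp_all only:)
qed simp

text \<open>The cotangent of \<open>pi / 8\<close>. It and its inverse are the factors in
  \<open>c1x\<close> and \<open>c5r\<close> that place two centres on the bounding rays.\<close>

lemma ca_eq: "ca = (1 + sqrt 2) * sa"
proof -
  have "(2 * ca) * ca = (2 * ca) * ((1 + sqrt 2) * sa)"
  proof -
    have "(2 * ca) * ((1 + sqrt 2) * sa) = (1 + sqrt 2) * (2 * sa * ca)" by simp
    also have "\<dots> = 1 + sqrt 2 / 2" unfolding double_eighth by (simp add: algebra_simps)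
    finally show ?thesis using double_eighth(2) by (simp add: power2_eq_square)
  qed
  then show ?thesis using ca_pos by simp
qed

lemma sa_eq: "sa = (sqrt 2 - 1) * ca"
  by (simp add: ca_eq algebra_simps)

lemma eighth_bounds: "3826/10000 < sa" "sa < 3828/10000" "9238/10000 < ca" "ca < 9240/10000"
proof -
  have s: "sa\<^sup>2 = 1/2 - sqrt 2 / 4" and c: "ca\<^sup>2 = 1/2 + sqrt 2 / 4" using double_eighth(2,3) by linarith+
  have "(3826/10000)\<^sup>2 < sa\<^sup>2" "sa\<^sup>2 < (3828/10000)\<^sup>2" "(9238/10000)\<^sup>2 < ca\<^sup>2" "ca\<^sup>2 < (9240/10000)\<^sup>2"
    unfolding s c using sqrt_bounds by (simp_all add: power2_eq_square)
  then show "3826/10000 < sa" "sa < 3828/10000" "9238/10000 < ca" "ca < 9240/10000"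
    using sa_pos ca_pos by (meson power2_less_imp_less less_imp_le divide_nonneg_nonneg zero_le_numeral)+
qed

lemma three_eighths: "sin (3 * pi / 8) = ca" "cos (3 * pi / 8) = sa" "sin (pi * 3 / 8) = ca" "cos (pi * 3 / 8) = sa"
  using sin_cos_eq[of "3 * pi/8"] cos_sin_eq[of "3 * pi/8"] by (simp_all add: field_simps)

lemma dip: "cos dip = (2 + sqrt 3) / 4" "0 < dip" "dip < pi / 6" "359/1000 < sin dip" "sin dip < 361/1000"
proof -
  have b: "sqrt 3 / 2 < (2 + sqrt 3) / 4" "(2 + sqrt 3) / 4 < 1" "0 < (2 + sqrt 3) / 4" using sqrt_bounds by auto
  show c: "cos dip = (2 + sqrt 3) / 4" unfolding dip_def using b by (intro cos_arccos) auto
  show "0 < dip" unfolding dip_def using arccos_lt_bounded[of "(2 + sqrt 3) / 4"] b by auto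
  then have "sin dip \<ge> 0" using arccos_le_pi2[of "(2 + sqrt 3) / 4"] b unfolding dip_def
    by (intro sin_ge_zero) auto
  have "arccos ((2 + sqrt 3) / 4) < arccos (cos (pi/6))"
    using b by (intro arccos_less_arccos) (auto simp: cos_30)
  also have "\<dots> = pi/6" by (rule arccos_cos) auto
  finally show "dip < pi / 6" unfolding dip_def .
  have "(sin dip)\<^sup>2 = 1 - ((2 + sqrt 3) / 4)\<^sup>2" unfolding c[symmetric] by (rule sin_squared_eq)
  also have "\<dots> = (9 - 4 * sqrt 3) / 16" by (simp add: power2_eq_square field_simps)
  finally have s: "(sin dip)\<^sup>2 = (9 - 4 * sqrt 3) / 16" .
  have "(359/1000)\<^sup>2 < (sin dip)\<^sup>2" "(sin dip)\<^sup>2 < (361/1000)\<^sup>2"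
    unfolding s using sqrt_bounds by (simp_all add: power2_eq_square)
  then show "359/1000 < sin dip" "sin dip < 361/1000"
    using \<open>sin dip \<ge> 0\<close> by (meson power2_less_imp_less divide_nonneg_nonneg zero_le_numeral zero_le_one)+
qed

lemma c_bounds: "226/100 < c2x" "c2x < 2262/1000" "395/100 < c4x" "c4x < 399/100"  "16/10 < c5r" "c5r < 166/100"
proof -
  have "c1x = sqrt 3 / 2 + sqrt 3 * sqrt 2 / 2 + 1 / 4 + sqrt 2 / 4" by (simp add: c1x_def field_simps)
  moreover have "244948/100000 < sqrt 3 * sqrt 2" "sqrt 3 * sqrt 2 < 244950/100000"
    unfolding real_sqrt_mult[symmetric]
    by (rule real_less_rsqrt real_less_lsqrt; simp add: power2_eq_square)+
  ultimately show c2: "226/100 < c2x" "c2x < 2262/1000" using sqrt_bounds by (auto simp: c2x_def)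
  then show c4: "395/100 < c4x" "c4x < 399/100" using dip by (auto simp: c4x_def c3x_def)
  have "395/100 * (4142/10000) < c4x * (sqrt 2 - 1)" "c4x * (sqrt 2 - 1) < 399/100 * (4143/10000)"
    by (rule mult_strict_mono; use c4 sqrt_bounds in simp)+
  then show "16/10 < c5r" "c5r < 166/100" by (auto simp: c5r_def)
qed

text \<open>For \<open>e = 1\<close> these are the arcs of the connected curve, for \<open>e = -1\<close> their mirror images.
  On each arc the angle is the direction of the tangent; a negative radius encodes a right turn.\<close>

abbreviation "piece1 e \<equiv> arc_set e c1x c1y (3/2) (- (3 * pi / 8)) (- (pi / 3))"
abbreviation "piece2 e \<equiv> arc_set e c2x c2y 1 (- (pi / 3)) (pi / 6)"
abbreviation "piece3 e \<equiv> arc_set e c3x c3y (- 1) (- dip) (pi / 6)"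
abbreviation "piece4 e \<equiv> arc_set e c4x 1 1 (- dip) 0"
abbreviation "piece5 \<equiv> arc_set 1 c4x (- c5r) (- c5r) (- (5 * pi / 8)) 0"

definition inner_part :: "real \<Rightarrow> complex set" where
  "inner_part e = piece1 e \<union> piece2 e \<union> piece3 e \<union> piece4 e"

definition curve :: "real \<Rightarrow> complex set" where
  "curve e = inner_part e \<union> piece5"

section \<open>Normal tubes of the arcs and their separation\<close>

abbreviation "tube1 e \<equiv> in_tube e c1x c1y (3/2) (- (3 * pi / 8)) (- (pi / 3))"
abbreviation "tube2 e \<equiv> in_tube e c2x c2y 1 (- (pi / 3)) (pi / 6)"
abbreviation "tube3 e \<equiv> in_tube e c3x c3y (- 1) (- dip) (pi / 6)"
abbreviation "tube4 e \<equiv> in_tube e c4x 1 1 (- dip) 0"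
abbreviation "tube5 \<equiv> in_tube 1 c4x (- c5r) (- c5r) (- (5 * pi / 8)) 0"

definition tube :: "real \<Rightarrow> complex \<Rightarrow> complex \<Rightarrow> bool" where
  "tube e z q \<longleftrightarrow> tube1 e z q \<or> tube2 e z q \<or> tube3 e z q \<or> tube4 e z q \<or> tube5 z q"

text \<open>Angles are tangent directions, so at a joint both circles carry the same angle, and both
  centres lie on the common normal. The component along the tangent is therefore the same from
  either centre, and its zero line separates the two tubes.\<close>

lemma junction12: "tangential e c1x c1y (- (pi / 3)) z = tangential e c2x c2y (- (pi / 3)) z"
  by (simp add: tangential_def c2x_def c1y_def c2y_def cos_60 sin_60 field_simps)

lemma junction23: "tangential e c3x c3y (pi / 6) z = tangential e c2x c2y (pi / 6) z"
  by (simp add: tangential_def c3x_def c3y_def c2y_def cos_30 sin_30 field_simps)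

lemma junction34: "tangential e c4x 1 (- dip) z = tangential e c3x c3y (- dip) z"
  by (simp add: tangential_def c4x_def c3y_def dip field_simps)

text \<open>Here the constants are forced. In particular \<open>cos dip = (2 + sqrt 3) / 4\<close>
  says that the fourth centre has height \<open>c3y + 2 * cos dip = 1\<close>, so that its unit
  circle touches the axis. The mirror sign drops out of the last equation because the contact point
  lies on the axis.\<close>

lemma junction_points:
  "arc_point e c1x c1y (3/2) (- (pi / 3)) = arc_point e c2x c2y 1 (- (pi / 3))"
  "arc_point e c2x c2y 1 (pi / 6) = arc_point e c3x c3y (-1) (pi / 6)"
  "arc_point e c3x c3y (-1) (- dip) = arc_point e c4x 1 1 (- dip)"
  "arc_point e c4x 1 1 0 = arc_point 1 c4x (- c5r) (- c5r) 0"
  by (simp_all add: complex_eq_iff c2x_def c1y_def c2y_def c3x_def c3y_def c4x_def dip cos_60 sin_60 cos_30 sin_30 field_simps)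

lemma sin_diff_neg:
  assumes "t \<le> s" "s - t < pi" shows "sin (t - s) \<le> (0::real)" "sin (t - s) = 0 \<Longrightarrow> t = s"
proof -
  show "sin (t - s) \<le> 0" using assms sin_ge_zero[of "s - t"] sin_minus[of "s - t"] by simp
  show "t = s" if "sin (t - s) = 0"
    using that assms sin_gt_zero[of "s - t"] sin_minus[of "s - t"] by (cases "t = s") auto
qed

lemma sin_diff_pos:
  assumes "s \<le> t" "t - s < pi" shows "sin (t - s) \<ge> (0::real)" "sin (t - s) = 0 \<Longrightarrow> t = s"
  using sin_diff_neg[of s t] assms sin_minus[of "s - t"] by auto

text \<open>Neighbouring tubes lie on opposite closed sides of the common normal and can share
  points only on it, where both feet are the joint. The bounds on \<open>Re z\<close> are for tubes
  that are not neighbours. The next four lemmas follow the same pattern.\<close>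

lemma tube1_sep:
  assumes e: "e * e = 1" and "tube1 e z q"
  shows "Re z < c2x" "tangential e c2x c2y (- (pi / 3)) z \<le> 0"
    "tangential e c2x c2y (- (pi / 3)) z = 0 \<Longrightarrow> q = arc_point e c2x c2y 1 (- (pi / 3))"
proof -
  from assms(2) obtain t r' where t: "- (3 * pi / 8) \<le> t" "t \<le> - (pi / 3)" and r: "\<bar>r' - 3/2\<bar> < 1"
    and z: "z = arc_point e c1x c1y r' t" and q: "q = arc_point e c1x c1y (3/2) t" by (rule in_tubeE)
  have r': "r' > 1/2" using r by (auto simp: abs_if split: if_splits)
  have T: "tangential e c2x c2y (- (pi / 3)) z = r' * sin (t - - (pi / 3))"
    unfolding junction12[symmetric] z by (rule tangential_arc_point[OF e])
  have s: "sin (t - - (pi / 3)) \<le> 0" "sin (t - - (pi / 3)) = 0 \<Longrightarrow> t = - (pi/3)"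
    using sin_diff_neg[of t "- (pi/3)"] t pi_gt_zero by (auto simp: field_simps)
  show "tangential e c2x c2y (- (pi / 3)) z \<le> 0" unfolding T using s r' by (auto simp: mult_le_0_iff)
  show "q = arc_point e c2x c2y 1 (- (pi / 3))" if "tangential e c2x c2y (- (pi / 3)) z = 0"
    using that s r' unfolding T q junction_points(1)[symmetric] by auto
  have "sin t \<le> sin (- (pi/3))" using t by (intro sin_monotone_2pi_le) auto
  then have st: "sin t \<le> - (sqrt 3 / 2)" by (simp add: sin_60)
  have "r' * sin t \<le> r' * - (sqrt 3 / 2)" using st r' by (intro mult_left_mono) auto
  \<comment> \<open>The tube is bounded inside by the circle of radius \<open>3/2 - 1\<close>, which
    at angle \<open>- (pi / 3)\<close> has exactly the abscissa \<open>c2x\<close>.\<close>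
  also have "\<dots> < 1/2 * - (sqrt 3 / 2)" using r' sqrt_bounds by auto
  finally show "Re z < c2x" unfolding z by (simp add: c2x_def)
qed

lemma tube2_sep:
  assumes e: "e * e = 1" and "tube2 e z q"
  shows "Re z < c3x" "tangential e c2x c2y (- (pi / 3)) z \<ge> 0"
    "tangential e c2x c2y (- (pi / 3)) z = 0 \<Longrightarrow> q = arc_point e c2x c2y 1 (- (pi / 3))"
    "tangential e c2x c2y (pi / 6) z \<le> 0"
    "tangential e c2x c2y (pi / 6) z = 0 \<Longrightarrow> q = arc_point e c2x c2y 1 (pi / 6)"
proof -
  from assms(2) obtain t r' where t: "- (pi / 3) \<le> t" "t \<le> pi / 6" and r: "\<bar>r' - 1\<bar> < 1"
    and z: "z = arc_point e c2x c2y r' t" and q: "q = arc_point e c2x c2y 1 t" by (rule in_tubeE)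
  have r': "0 < r'" "r' < 2" using r by (auto simp: abs_if split: if_splits)
  have s: "sin (t - - (pi / 3)) \<ge> 0" "sin (t - - (pi / 3)) = 0 \<Longrightarrow> t = - (pi/3)"
    using sin_diff_pos[of "- (pi/3)" t] t pi_gt_zero by (auto simp: field_simps)
  have s': "sin (t - pi / 6) \<le> 0" "sin (t - pi / 6) = 0 \<Longrightarrow> t = pi/6"
    using sin_diff_neg[of t "pi/6"] t pi_gt_zero by (auto simp: field_simps)
  show "tangential e c2x c2y (- (pi / 3)) z \<ge> 0" "tangential e c2x c2y (pi / 6) z \<le> 0"
    unfolding z tangential_arc_point[OF e] using s s' r' by (auto simp: mult_le_0_iff)
  show "q = arc_point e c2x c2y 1 (- (pi / 3))" if "tangential e c2x c2y (- (pi / 3)) z = 0"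
    using that s r' unfolding z tangential_arc_point[OF e] q by auto
  show "q = arc_point e c2x c2y 1 (pi / 6)" if "tangential e c2x c2y (pi / 6) z = 0"
  proof -
    have "t = pi / 6" using that s' r' unfolding z tangential_arc_point[OF e] by simp
    then show ?thesis unfolding q by (simp only:)
  qed
  have "sin t \<le> sin (pi/6)" using t by (intro sin_monotone_2pi_le) auto
  then have st: "sin t \<le> 1/2" by (simp add: sin_30)
  have "r' * sin t \<le> r' * (1/2)" using st r' by (intro mult_left_mono) auto
  then show "Re z < c3x" unfolding z Re_arc_point c3x_def using r' by linarith
qed

lemma tube3_sep:
  assumes e: "e * e = 1" and "tube3 e z q"
  shows "c2x < Re z" "Re z < c4x" "tangential e c2x c2y (pi / 6) z \<ge> 0"
    "tangential e c2x c2y (pi / 6) z = 0 \<Longrightarrow> q = arc_point e c2x c2y 1 (pi / 6)"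
    "tangential e c3x c3y (- dip) z \<le> 0"
    "tangential e c3x c3y (- dip) z = 0 \<Longrightarrow> q = arc_point e c3x c3y (-1) (- dip)"
proof -
  from assms(2) obtain t r' where t: "- dip \<le> t" "t \<le> pi / 6" and r: "\<bar>r' - - 1\<bar> < 1"
    and z: "z = arc_point e c3x c3y r' t" and q: "q = arc_point e c3x c3y (- 1) t" by (rule in_tubeE)
  have r': "r' < 0" "-2 < r'" using r by (auto simp: abs_if split: if_splits)
  have s: "sin (t - - dip) \<ge> 0" "sin (t - - dip) = 0 \<Longrightarrow> t = - dip"
    using sin_diff_pos[of "- dip" t] t dip by auto
  have s': "sin (t - pi / 6) \<le> 0" "sin (t - pi / 6) = 0 \<Longrightarrow> t = pi/6"
    using sin_diff_neg[of t "pi/6"] t dip by auto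
  show "tangential e c2x c2y (pi / 6) z \<ge> 0" "tangential e c3x c3y (- dip) z \<le> 0"
    unfolding junction23[symmetric] z tangential_arc_point[OF e] using s s' r' by (auto simp: mult_le_0_iff zero_le_mult_iff)
  show "q = arc_point e c2x c2y 1 (pi / 6)" if "tangential e c2x c2y (pi / 6) z = 0"
  proof -
    have "t = pi / 6"
      using that s' r' unfolding junction23[symmetric] z tangential_arc_point[OF e] by simp
    then show ?thesis unfolding q junction_points(2) by (simp only:)
  qed
  show "q = arc_point e c3x c3y (-1) (- dip)" if "tangential e c3x c3y (- dip) z = 0"
    using that s r' unfolding z tangential_arc_point[OF e] q by auto
  have "sin t \<le> sin (pi/6)" "sin (- dip) \<le> sin t" using t dip by (auto intro!: sin_monotone_2pi_le simp del: sin_minus)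
  then have st: "sin t \<le> 1/2" "- sin dip \<le> sin t" by (auto simp: sin_30)
  have "(- r') * sin t \<le> (- r') * (1/2)" using st r' by (intro mult_left_mono) auto
  then show "c2x < Re z" unfolding z Re_arc_point c3x_def using r' by linarith
  have "(- r') * - sin dip \<le> (- r') * sin t" using st r' by (intro mult_left_mono) auto
  moreover have "- r' * sin dip < 2 * sin dip" using r' dip by (intro mult_strict_right_mono) auto
  ultimately show "Re z < c4x" unfolding z by (simp add: c4x_def)
qed

lemma tube4_sep:
  assumes e: "e * e = 1" and "tube4 e z q"
  shows "c3x < Re z" "Re z \<le> c4x" "tangential e c3x c3y (- dip) z \<ge> 0"
    "tangential e c3x c3y (- dip) z = 0 \<Longrightarrow> q = arc_point e c3x c3y (-1) (- dip)"
    "Re z = c4x \<Longrightarrow> q = arc_point 1 c4x (- c5r) (- c5r) 0"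
proof -
  from assms(2) obtain t r' where t: "- dip \<le> t" "t \<le> 0" and r: "\<bar>r' - 1\<bar> < 1"
    and z: "z = arc_point e c4x 1 r' t" and q: "q = arc_point e c4x 1 1 t" by (rule in_tubeE)
  have r': "0 < r'" "r' < 2" using r by (auto simp: abs_if split: if_splits)
  have s: "sin (t - - dip) \<ge> 0" "sin (t - - dip) = 0 \<Longrightarrow> t = - dip"
    using sin_diff_pos[of "- dip" t] t dip by auto
  have s': "sin (t - 0) \<le> 0" "sin (t - 0) = 0 \<Longrightarrow> t = 0"
    using sin_diff_neg[of t 0] t dip by auto
  show "tangential e c3x c3y (- dip) z \<ge> 0"
    unfolding junction34[symmetric] z tangential_arc_point[OF e] using s r' by auto
  show "q = arc_point e c3x c3y (-1) (- dip)" if "tangential e c3x c3y (- dip) z = 0"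
    using that s r' unfolding junction34[symmetric] z tangential_arc_point[OF e] q junction_points(3) by auto
  show "Re z \<le> c4x" using s' r' by (simp add: z mult_le_0_iff)
  show "q = arc_point 1 c4x (- c5r) (- c5r) 0" if "Re z = c4x"
    using that s' r' unfolding junction_points(4)[of e, symmetric] by (simp add: z q)
  have "sin (- dip) \<le> sin t" using t dip by (auto intro!: sin_monotone_2pi_le simp del: sin_minus)
  then have st: "- sin dip \<le> sin t" by simp
  have "r' * - sin dip \<le> r' * sin t" using st r' by (intro mult_left_mono) auto
  moreover have "r' * sin dip < 2 * sin dip" using r' dip by (intro mult_strict_right_mono) auto
  ultimately show "c3x < Re z" unfolding z by (simp add: c4x_def)
qed

lemma tube5_sep:
  assumes "tube5 z q"
  shows "c4x \<le> Re z" "Re z = c4x \<Longrightarrow> q = arc_point 1 c4x (- c5r) (- c5r) 0"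
proof -
  from assms obtain t r' where t: "- (5 * pi / 8) \<le> t" "t \<le> 0" and r: "\<bar>r' - - c5r\<bar> < 1"
    and z: "z = arc_point 1 c4x (- c5r) r' t" and q: "q = arc_point 1 c4x (- c5r) (- c5r) t" by (rule in_tubeE)
  have r': "r' < 0" using r c_bounds by (auto simp: abs_if split: if_splits)
  have s': "sin (t - 0) \<le> 0" "sin (t - 0) = 0 \<Longrightarrow> t = 0"
    using sin_diff_neg[of t 0] t pi_gt_zero by (auto simp: field_simps)
  show "c4x \<le> Re z" using s' r' by (simp add: z zero_le_mult_iff)
  show "q = arc_point 1 c4x (- c5r) (- c5r) 0" if "Re z = c4x"
    using that s' r' by (simp add: z q)
qed

text \<open>The radius is at least 1 in absolute value and the tube is narrower than 1, so the
  signed radius keeps its sign and the tube avoids the centre, where feet would become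
  ambiguous.\<close>

lemma in_tube_unique:
  assumes e: "e * e = 1" and "1 \<le> \<bar>r\<bar>" "u - l < pi"
    and "in_tube e x y r l u z q" "in_tube e x y r l u z q'"
  shows "q = q'"
proof -
  obtain t s where t: "l \<le> t" "t \<le> u" "\<bar>s - r\<bar> < 1" "z = arc_point e x y s t" "q = arc_point e x y r t"
    using assms(4) by (rule in_tubeE)
  obtain t' s' where t': "l \<le> t'" "t' \<le> u" "\<bar>s' - r\<bar> < 1" "z = arc_point e x y s' t'" "q' = arc_point e x y r t'"
    using assms(5) by (rule in_tubeE)
  have "(0 < s \<and> 0 < s') \<or> (s < 0 \<and> s' < 0)" using assms(2) t(3) t'(3) by (auto simp: abs_if split: if_splits)
  then have "s * s' > 0" by (auto simp: zero_less_mult_iff)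
  then have "t = t'" using arc_point_angle_unique[OF e, of x y s t s' t'] t t' assms(3) by auto
  then show ?thesis using t t' by simp
qed

text \<open>Neighbouring tubes are separated by their common normal. Tubes 1, 3 and 5 are kept apart
  by the abscissas \<open>c2x\<close> and \<open>c4x\<close>, tubes 2 and 4 by \<open>c3x\<close>;
  the order \<open>c2x < c3x < c4x\<close> settles the remaining pairs.\<close>

lemma tube_unique:
  assumes e: "e * e = 1" and "tube e z q" "tube e z q'"
  shows "q = q'"
proof -
  have o: "c2x < c3x" "c3x < c4x" using dip by (auto simp: c3x_def c4x_def)
  note S = tube1_sep[OF e] tube2_sep[OF e] tube3_sep[OF e] tube4_sep[OF e] tube5_sep
  have 12: "q = q'" if "tube1 e z q" "tube2 e z q'" for q q'
    using S(2,3)[OF that(1)] S(5,6)[OF that(2)] by force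
  have 23: "q = q'" if "tube2 e z q" "tube3 e z q'" for q q'
    using S(7,8)[OF that(1)] S(11,12)[OF that(2)] by force
  have 34: "q = q'" if "tube3 e z q" "tube4 e z q'" for q q'
    using S(13,14)[OF that(1)] S(17,18)[OF that(2)] by force
  have 45: "q = q'" if "tube4 e z q" "tube5 z q'" for q q'
    using S(16,19)[OF that(1)] S(20,21)[OF that(2)] by force
  have 1: "Re z < c2x" if "tube1 e z q" for q using S(1)[OF that] .
  have 2: "Re z < c3x" if "tube2 e z q" for q using S(4)[OF that] .
  have 3: "c2x < Re z" "Re z < c4x" if "tube3 e z q" for q using S(9,10)[OF that] .
  have 4: "c3x < Re z" if "tube4 e z q" for q using S(15)[OF that] .
  have 5: "c4x \<le> Re z" if "tube5 z q" for q using S(20)[OF that] .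
  have same: "q = q'" if "tube1 e z q \<and> tube1 e z q' \<or> tube2 e z q \<and> tube2 e z q' \<or> tube3 e z q \<and> tube3 e z q' \<or>
       tube4 e z q \<and> tube4 e z q' \<or> tube5 z q \<and> tube5 z q'" for q q'
    using that
  proof (elim disjE conjE)
  qed (erule (1) in_tube_unique[rotated 3]; use dip c_bounds pi_gt_zero in \<open>simp add: e field_simps\<close>)+
  show ?thesis
    using assms(2,3) unfolding tube_def
    by (elim disjE; smt (verit, best) 1 2 3 4 5 12 23 34 45 same o)
qed

section \<open>The wedge\<close>

text \<open>Signed distance from the upper (\<open>e = 1\<close>) or lower (\<open>e = -1\<close>) bounding line of the wedge.\<close>

definition ray :: "real \<Rightarrow> complex \<Rightarrow> real" where
  "ray e z = sa * Re z - e * ca * Im z"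

lemma ray_arc_point:
  assumes "e * e = 1"
  shows "ray e (arc_point e x y r t) = (sa * x - ca * y) + r * (sa * sin t + ca * cos t)"
    and "ray (- e) (arc_point e x y r t) = (sa * x + ca * y) + r * (sa * sin t - ca * cos t)"
proof -
  have "e * ca * (e * (y - r * cos t)) = (e * e) * (ca * (y - r * cos t))" by simp
  then have *: "e * ca * (e * (y - r * cos t)) = ca * (y - r * cos t)" using assms by simp
  have "ray e (arc_point e x y r t) = sa * (x + r * sin t) - ca * (y - r * cos t)"
    using * by (simp only: ray_def Re_arc_point Im_arc_point)
  then show "ray e (arc_point e x y r t) = (sa * x - ca * y) + r * (sa * sin t + ca * cos t)"
    by (simp add: algebra_simps)
  have "ray (- e) (arc_point e x y r t) = sa * (x + r * sin t) + ca * (y - r * cos t)"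
    using * by (simp add: ray_def)
  then show "ray (- e) (arc_point e x y r t) = (sa * x + ca * y) + r * (sa * sin t - ca * cos t)"
    by (simp add: algebra_simps)
qed

lemma ray_le_dist:
  assumes "e * e = 1"
  shows "ray e p - ray e z \<le> dist p z"
proof -
  have "ray e p - ray e z = inner (Complex sa (- (e * ca))) (p - z)"
    by (simp add: ray_def inner_complex_def algebra_simps)
  also have "\<dots> \<le> norm (Complex sa (- (e * ca))) * norm (p - z)"
    by (rule norm_cauchy_schwarz)
  also have "norm (Complex sa (- (e * ca))) = 1"
  proof -
    have "sa\<^sup>2 + (e * ca)\<^sup>2 = sa\<^sup>2 + (e * e) * ca\<^sup>2" by (simp add: power2_eq_square)
    then show ?thesis using assms by (simp add: cmod_def)
  qed
  finally show ?thesis by (simp add: dist_norm)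
qed

lemma ray_sinusoids:
  "sa * sin t + ca * cos t = cos (t - pi / 8)" "sa * sin t + ca * cos t = sin (t + 3 * pi / 8)"
  "sa * sin t - ca * cos t = - cos (t + pi / 8)"
  by (simp_all add: cos_diff cos_add sin_add three_eighths)

text \<open>A circle centred on a ray crosses it at a right angle. At such an end of the strand the
  tangential component is, up to sign, the distance from the ray.\<close>

lemma centres_on_rays: "sa * c1x = ca * c1y" "sa * c4x = ca * c5r"
proof -
  have "c1x = c1y * (1 + sqrt 2)" by (simp add: c1x_def c1y_def)
  then show "sa * c1x = ca * c1y" by (simp add: ca_eq mult.commute)
  show "sa * c4x = ca * c5r" unfolding c5r_def by (subst sa_eq) simp
qed

text \<open>Inside an arc the derivative vanishes. At a joint the two arcs give opposite
  inequalities for the same tangential component. At either end of the strand one inequality is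
  missing; it is supplied by \<open>z\<close> lying in the wedge, because there the tangential
  component is the distance from the bounding line or its negative. So \<open>z\<close> always lies
  on the normal through its nearest point.\<close>

lemma nearest_in_tube:
  assumes e: "e = 1 \<or> e = -1" and W: "0 \<le> ray 1 z" "0 \<le> ray (-1) z"
    and q: "q \<in> curve e" and near: "\<And>q'. q' \<in> curve e \<Longrightarrow> dist z q \<le> dist z q'"
    and s: "dist z q < 1"
  shows "tube e z q"
proof -
  have ee: "e * e = 1" using e by auto
  have W': "0 \<le> ray e z" using W e by auto
  have sub: "piece1 e \<subseteq> curve e" "piece2 e \<subseteq> curve e" "piece3 e \<subseteq> curve e" "piece4 e \<subseteq> curve e" "piece5 \<subseteq> curve e"
    by (auto simp: curve_def inner_part_def)
  have N: "(l < t \<longrightarrow> 0 \<le> r * tangential e' x y t z) \<and> (t < u \<longrightarrow> r * tangential e' x y t z \<le> 0)"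
    if "arc_set e' x y r l u \<subseteq> curve e" "q = arc_point e' x y r t" "l \<le> t" "t \<le> u" "e' * e' = 1" for e' x y r l u t
    using nearest_arc_point_tangential[of e' l u z x y r t] that near by (force simp: arc_set_def)
  have fin: "in_tube e' x y r l u z q"
    if T: "q = arc_point e' x y r t" "l \<le> t" "t \<le> u" "e' * e' = 1" "tangential e' x y t z = 0" for e' x y r l u t
  proof -
    obtain r' where "z = arc_point e' x y r' t" "dist z (arc_point e' x y r t) = \<bar>r' - r\<bar>"
      using arc_point_of_tangential_zero[OF T(4,5)] by blast
    then show ?thesis using s T unfolding in_tube_def by metis
  qed
  have bounds: "- (3 * pi / 8) < - (pi / 3)" "- (pi / 3) < pi / 6" "- dip < pi / 6" "- dip < 0" "- (5 * pi / 8) < 0"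
    using dip pi_gt_zero by (auto simp: field_simps)
  consider "q \<in> piece1 e" | "q \<in> piece2 e" | "q \<in> piece3 e" | "q \<in> piece4 e" | "q \<in> piece5"
    using q by (auto simp: curve_def inner_part_def)
  then show ?thesis
  proof cases
    case 1
    then obtain t where t: "- (3 * pi / 8) \<le> t" "t \<le> - (pi / 3)" and q: "q = arc_point e c1x c1y (3/2) t"
      by (auto simp: arc_set_def)
    have "tangential e c1x c1y t z = 0"
    proof (rule antisym)
      show "tangential e c1x c1y t z \<le> 0"
      proof (cases "t < - (pi/3)")
        case False
        then have "t = - (pi/3)" using t by simp
        then show ?thesis
          using N[OF sub(2), of "- (pi/3)"] bounds q ee by (simp add: junction12 junction_points)
      qed (use N[OF sub(1) q t] ee in simp)
      show "0 \<le> tangential e c1x c1y t z"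
      proof (cases "- (3 * pi / 8) < t")
        case False
        then have "t = - (3 * pi / 8)" using t by simp
        then have "tangential e c1x c1y t z = ray e z - (sa * c1x - ca * c1y)"
          by (simp add: tangential_def ray_def three_eighths algebra_simps)
        then show ?thesis using W' centres_on_rays by simp
      qed (use N[OF sub(1) q t] ee in simp)
    qed
    from fin[OF q t ee this] show ?thesis by (simp add: tube_def)
  next
    case 2
    then obtain t where t: "- (pi / 3) \<le> t" "t \<le> pi / 6" and q: "q = arc_point e c2x c2y 1 t"
      by (auto simp: arc_set_def)
    have "tangential e c2x c2y t z = 0"
    proof (rule antisym)
      show "tangential e c2x c2y t z \<le> 0"
      proof (cases "t < pi/6")
        case False
        then have t6: "t = pi/6" using t by simp
        then show ?thesis
          using N[OF sub(3), of "pi/6"] bounds q ee unfolding t6 by (simp add: junction23 junction_points)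
      qed (use N[OF sub(2) q t] ee in simp)
      show "0 \<le> tangential e c2x c2y t z"
      proof (cases "- (pi / 3) < t")
        case False
        then have "t = - (pi / 3)" using t by simp
        then show ?thesis
          using N[OF sub(1), of "- (pi/3)"] bounds q ee by (simp add: junction12 junction_points)
      qed (use N[OF sub(2) q t] ee in simp)
    qed
    from fin[OF q t ee this] show ?thesis by (simp add: tube_def)
  next
    case 3
    then obtain t where t: "- dip \<le> t" "t \<le> pi / 6" and q: "q = arc_point e c3x c3y (-1) t"
      by (auto simp: arc_set_def)
    have "tangential e c3x c3y t z = 0"
    proof (rule antisym)
      show "0 \<le> tangential e c3x c3y t z"
      proof (cases "t < pi/6")
        case False
        then have t6: "t = pi/6" using t by simp
        then show ?thesis
          using N[OF sub(2), of "pi/6"] bounds q ee unfolding t6 by (simp add: junction23 junction_points)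
      qed (use N[OF sub(3) q t] ee in simp)
      show "tangential e c3x c3y t z \<le> 0"
      proof (cases "- dip < t")
        case False
        then have "t = - dip" using t by simp
        then show ?thesis
          using N[OF sub(4), of "- dip"] bounds q ee by (simp add: junction34 junction_points)
      qed (use N[OF sub(3) q t] ee in simp)
    qed
    from fin[OF q t ee this] show ?thesis by (simp add: tube_def)
  next
    case 4
    then obtain t where t: "- dip \<le> t" "t \<le> 0" and q: "q = arc_point e c4x 1 1 t"
      by (auto simp: arc_set_def)
    have "tangential e c4x 1 t z = 0"
    proof (rule antisym)
      show "tangential e c4x 1 t z \<le> 0"
      proof (cases "t < 0")
        case False
        then have t6: "t = 0" using t by simp
        \<comment> \<open>At angle 0 the tangential component is \<open>Re z - c4x\<close> for
          either mirror sign, so the mirrored fourth arc can be compared with the fifth arc, which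
          is not mirrored.\<close>
        have "0 \<le> tangential 1 c4x (- c5r) 0 z \<longrightarrow> 0 \<le> c5r * tangential 1 c4x (- c5r) 0 z"
          using c_bounds by auto
        then show ?thesis
          using N[OF sub(5), of 0] bounds q c_bounds unfolding t6 junction_points
          by (simp add: tangential_def mult_le_0_iff zero_le_mult_iff)
      qed (use N[OF sub(4) q t] ee in simp)
      show "0 \<le> tangential e c4x 1 t z"
      proof (cases "- dip < t")
        case False
        then have "t = - dip" using t by simp
        then show ?thesis
          using N[OF sub(3), of "- dip"] bounds q ee by (simp add: junction34 junction_points)
      qed (use N[OF sub(4) q t] ee in simp)
    qed
    from fin[OF q t ee this] show ?thesis by (simp add: tube_def)
  next
    case 5
    then obtain t where t: "- (5 * pi / 8) \<le> t" "t \<le> 0" and q: "q = arc_point 1 c4x (- c5r) (- c5r) t"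
      by (auto simp: arc_set_def)
    have "tangential 1 c4x (- c5r) t z = 0"
    proof (rule antisym)
      show "0 \<le> tangential 1 c4x (- c5r) t z"
      proof (cases "t < 0")
        case False
        then have t6: "t = 0" using t by simp
        then show ?thesis
          using N[OF sub(4), of 0] bounds q ee unfolding t6 junction_points(4)[of e, symmetric]
          by (simp add: tangential_def)
      qed (use N[OF sub(5) q t] c_bounds in \<open>simp add: zero_le_mult_iff\<close>)
      show "tangential 1 c4x (- c5r) t z \<le> 0"
      proof (cases "- (5 * pi / 8) < t")
        case False
        then have t5: "t = - (5 * pi / 8)" using t by simp
        have "sin (5 * pi / 8) = ca" "cos (5 * pi / 8) = - sa" "sin (pi * 5 / 8) = ca" "cos (pi * 5 / 8) = - sa"
          using sin_add[of "pi/2" "pi/8"] cos_add[of "pi/2" "pi/8"] by (simp_all add: mult.commute)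
        then have "tangential 1 c4x (- c5r) t z = - ray (-1) z + (sa * c4x - ca * c5r)"
          by (simp add: t5 tangential_def ray_def algebra_simps)
        then show ?thesis using W centres_on_rays by simp
      qed (use N[OF sub(5) q t] c_bounds in \<open>simp add: mult_le_0_iff\<close>)
    qed
    from fin[OF q t _ this] show ?thesis by (simp add: tube_def)
  qed
qed

section \<open>Position of the tubes relative to the bounding rays\<close>

lemma ray_centres:
  "sa * c1x - ca * c1y = 0" "65/1000 < sa * c2x - ca * c2y" "2 < sa * c3x - ca * c3y"
  "0 < sa * c4x - ca" "sa * c4x - ca * c5r = 0"
  "205/100 < sa * c1x + ca * c1y" "16646/10000 < sa * c2x + ca * c2y"
proof -
  show 1: "sa * c1x - ca * c1y = 0" using centres_on_rays by simp
  have cs: "9238/10000 * (1732/1000) < ca * sqrt 3" "sa * sqrt 3 < 3828/10000 * (17321/10000)"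
    by (rule mult_strict_mono; use eighth_bounds sqrt_bounds sa_pos in simp)+
  have "sa * c2x - ca * c2y = (sa * c1x - ca * c1y) + (ca - sa * sqrt 3) / 4"
    by (simp add: c2x_def c2y_def c1y_def field_simps)
  then have 2: "sa * c2x - ca * c2y = (ca - sa * sqrt 3) / 4" using 1 by simp
  show 3: "65/1000 < sa * c2x - ca * c2y" unfolding 2 using cs eighth_bounds by simp
  have "sa * c3x - ca * c3y = (sa * c2x - ca * c2y) + sa + ca * sqrt 3"
    by (simp add: c3x_def c2y_def c3y_def algebra_simps)
  then show "2 < sa * c3x - ca * c3y" using 3 cs eighth_bounds by simp
  have "3826/10000 * (395/100) < sa * c4x" by (rule mult_strict_mono; use eighth_bounds c_bounds in simp)
  then show "0 < sa * c4x - ca" using eighth_bounds by simp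
  show "sa * c4x - ca * c5r = 0" using centres_on_rays by simp
  have "9238/10000 * (1116/1000) < ca * c1y"
    by (rule mult_strict_mono; use eighth_bounds sqrt_bounds in \<open>simp add: c1y_def\<close>)
  then show "205/100 < sa * c1x + ca * c1y" using 1 by linarith
  have "3826/10000 * (226/100) < sa * c2x" "9238/10000 * (866/1000) < ca * c2y"
    by (rule mult_strict_mono; use eighth_bounds c_bounds sqrt_bounds in \<open>simp add: c2y_def\<close>)+
  then show "16646/10000 < sa * c2x + ca * c2y" by simp
qed

text \<open>If a point of ray \<open>e\<close> has its foot in the inner part, then that foot is the
  start of the strand, which lies on the same ray. Hence crossing this ray produces no critical
  point in these tubes.\<close>

lemma tube_ray_inner:
  assumes e: "e * e = 1"
  shows "tube1 e z q \<Longrightarrow> 0 \<le> ray e z \<and> (ray e z = 0 \<longrightarrow> q = arc_point e c1x c1y (3/2) (- (3 * pi / 8)))"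
    and "tube2 e z q \<Longrightarrow> 0 < ray e z" and "tube3 e z q \<Longrightarrow> 0 < ray e z" and "tube4 e z q \<Longrightarrow> 0 < ray e z"
proof -
  show "0 \<le> ray e z \<and> (ray e z = 0 \<longrightarrow> q = arc_point e c1x c1y (3/2) (- (3 * pi / 8)))" if T: "tube1 e z q"
  proof -
    from T obtain t r' where t: "- (3 * pi / 8) \<le> t" "t \<le> - (pi / 3)" and r: "\<bar>r' - 3/2\<bar> < 1"
      and z: "z = arc_point e c1x c1y r' t" and q: "q = arc_point e c1x c1y (3/2) t" by (rule in_tubeE)
    have r': "r' > 0" using r by (auto simp: abs_if split: if_splits)
    have R: "ray e z = r' * sin (t - - (3 * pi / 8))"
      unfolding z ray_arc_point[OF e] ray_centres(1) ray_sinusoids(2) by simp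
    have "sin (t - - (3 * pi / 8)) \<ge> 0" "sin (t - - (3 * pi / 8)) = 0 \<Longrightarrow> t = - (3 * pi / 8)"
      using sin_diff_pos[of "- (3 * pi / 8)" t] t pi_gt_zero by (auto simp: field_simps)
    then show ?thesis unfolding R q using r' by auto
  qed
  show "0 < ray e z" if T: "tube2 e z q"
  proof -
    from T obtain t r' where t: "- (pi / 3) \<le> t" "t \<le> pi / 6" and r: "\<bar>r' - 1\<bar> < 1"
      and z: "z = arc_point e c2x c2y r' t" by (rule in_tubeE)
    have r': "r' > 0" using r by (auto simp: abs_if split: if_splits)
    have "cos (t - pi/8) \<ge> 0" using t pi_gt_zero by (intro cos_ge_zero) (auto simp: field_simps)
    then have "0 \<le> r' * cos (t - pi/8)" using r' by simp
    then show ?thesis unfolding z ray_arc_point[OF e] ray_sinusoids(1) using ray_centres(2) by linarith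
  qed
  show "0 < ray e z" if T: "tube3 e z q"
  proof -
    from T obtain t r' where r: "\<bar>r' - - 1\<bar> < 1" and z: "z = arc_point e c3x c3y r' t" by (rule in_tubeE)
    have "\<bar>r' * cos (t - pi/8)\<bar> \<le> \<bar>r'\<bar> * 1" unfolding abs_mult by (intro mult_left_mono) auto
    moreover have "\<bar>r'\<bar> < 2" using r by (auto simp: abs_if split: if_splits)
    ultimately show ?thesis unfolding z ray_arc_point[OF e] ray_sinusoids(1) using ray_centres(3) by linarith
  qed
  show "0 < ray e z" if T: "tube4 e z q"
  proof -
    from T obtain t r' where t: "- dip \<le> t" "t \<le> 0" and r: "\<bar>r' - 1\<bar> < 1"
      and z: "z = arc_point e c4x 1 r' t" by (rule in_tubeE)
    have r': "r' > 0" using r by (auto simp: abs_if split: if_splits)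
    have "cos (t - pi/8) \<ge> 0" using t dip pi_gt_zero by (intro cos_ge_zero) (auto simp: field_simps)
    then have "0 \<le> r' * cos (t - pi/8)" using r' by simp
    then show ?thesis unfolding z ray_arc_point[OF e] ray_sinusoids(1) using ray_centres(4) by linarith
  qed
qed

text \<open>The end of the strand behaves like its start. The tube stays off the upper ray because
  its centre has distance \<open>2 * sa * c4x\<close> from the upper line, which exceeds
  \<open>c5r + 1\<close>.\<close>

lemma tube_ray_outer:
  assumes "tube5 z q"
  shows "0 < ray 1 z" "0 \<le> ray (-1) z" "ray (-1) z = 0 \<Longrightarrow> q = arc_point 1 c4x (- c5r) (- c5r) (- (5 * pi / 8))"
proof -
  obtain t r' where t: "- (5 * pi / 8) \<le> t" "t \<le> 0" and r: "\<bar>r' - - c5r\<bar> < 1"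
    and z: "z = arc_point 1 c4x (- c5r) r' t" and q: "q = arc_point 1 c4x (- c5r) (- c5r) t"
    using assms by (rule in_tubeE)
  have e: "(1::real) * 1 = 1" by simp
  have r': "r' < 0" "- c5r - 1 < r'" using r c_bounds by (auto simp: abs_if split: if_splits)
  have "\<bar>r' * cos (t - pi/8)\<bar> \<le> \<bar>r'\<bar> * 1" unfolding abs_mult by (intro mult_left_mono) auto
  then have "- (r' * cos (t - pi/8)) < c5r + 1" using r' by linarith
  moreover have "3826/10000 * (395/100) < sa * c4x" by (rule mult_strict_mono; use eighth_bounds c_bounds in simp)
  moreover have "sa * c4x - ca * (- c5r) = 2 * (sa * c4x)" using ray_centres(5) by simp
  ultimately show "0 < ray 1 z"
    unfolding z ray_arc_point(1)[OF e] ray_sinusoids(1) using c_bounds by linarith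
  have R: "ray (-1) z = - r' * cos (t + pi/8)"
    unfolding z ray_arc_point(2)[OF e] ray_sinusoids(3) using ray_centres(5) by simp
  have c: "cos (t + pi/8) = sin (t - - (5 * pi / 8))"
    using sin_add[of "pi/2" "t + pi/8"] by (simp add: add.commute algebra_simps)
  have "sin (t - - (5 * pi / 8)) \<ge> 0" "sin (t - - (5 * pi / 8)) = 0 \<Longrightarrow> t = - (5 * pi / 8)"
    using sin_diff_pos[of "- (5 * pi / 8)" t] t pi_gt_zero by (auto simp: field_simps)
  then show "0 \<le> ray (-1) z" "ray (-1) z = 0 \<Longrightarrow> q = arc_point 1 c4x (- c5r) (- c5r) (- (5 * pi / 8))"
    unfolding R c q using r' by (auto simp: mult_le_0_iff)
qed

section \<open>Sampling inequalities on the inner arcs\<close>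

lemma sinusoid_ge:
  fixes A B k :: real
  assumes "k \<le> A * sin l + B * cos l" "k \<le> A * sin u + B * cos u" "0 \<le> k" "l \<le> t" "t \<le> u" "u - l < pi"
  shows "k \<le> A * sin t + B * cos t"
proof (cases "l = u")
  case False
  have s: "0 \<le> sin (u - t)" "0 \<le> sin (t - l)" "0 < sin (u - l)" using assms False by (auto intro!: sin_ge_zero sin_gt_zero)
  \<comment> \<open>A sinusoid is this combination of its end values; on an interval shorter than
    \<open>pi\<close> the weights are nonnegative and add up to at least \<open>sin (u - l)\<close>.
    So a nonnegative lower bound at the two ends holds in between.\<close>
  have *: "sin (u - l) * (A * sin t + B * cos t) = sin (u - t) * (A * sin l + B * cos l) + sin (t - l) * (A * sin u + B * cos u)"
  proof -
    have 1: "sin (u - t) * sin l + sin (t - l) * sin u = sin (u - l) * sin t"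
      by (simp add: sin_diff algebra_simps)
    have 2: "sin (u - t) * cos l + sin (t - l) * cos u = sin (u - l) * cos t"
      by (simp add: sin_diff algebra_simps)
    show ?thesis using 1 2 by algebra
  qed
  have "sin (u - l) = sin ((u - t) + (t - l))" by simp
  also have "\<dots> = sin (u - t) * cos (t - l) + sin (t - l) * cos (u - t)" unfolding sin_add by simp
  also have "\<dots> \<le> sin (u - t) * 1 + sin (t - l) * 1"
    using s by (intro add_mono mult_left_mono) auto
  finally have "sin (u - l) * k \<le> sin (u - t) * k + sin (t - l) * k"
    using assms(3) by (metis distrib_right mult.right_neutral mult_right_mono)
  also have "\<dots> \<le> sin (u - l) * (A * sin t + B * cos t)"
    unfolding * using s assms by (intro add_mono mult_left_mono) auto
  finally show ?thesis using s by simp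
qed (use assms in auto)

text \<open>The second circle has radius 1 and centre height \<open>sqrt 3 / 2\<close>, so in both
  mirror versions it cuts the axis half a unit to either side of \<open>c2x\<close>.\<close>

definition sample_a :: complex where "sample_a = Complex (c2x - 1/2) 0"
definition sample_e :: complex where "sample_e = Complex (c2x + 1/2) 0"
definition sample_f :: complex where "sample_f = Complex c4x 0"

lemma samples_in_curve:
  "sample_a \<in> curve e" "sample_e \<in> curve e" "sample_f \<in> curve e" "piece5 \<subseteq> curve e"
proof -
  have "sample_a = arc_point e c2x c2y 1 (- (pi/6))" "sample_e = arc_point e c2x c2y 1 (pi/6)"
    "sample_f = arc_point e c4x 1 1 0"
    by (simp_all add: sample_a_def sample_e_def sample_f_def complex_eq_iff c2y_def sin_30 cos_30)
  moreover have "- (pi/3) \<le> - (pi/6)" "- (pi/6) \<le> pi/6" "- (pi/3) \<le> pi/6" "- dip \<le> 0" using dip pi_gt_zero by auto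
  ultimately show "sample_a \<in> curve e" "sample_e \<in> curve e" "sample_f \<in> curve e"
    unfolding curve_def inner_part_def arc_set_def by auto
qed (simp add: curve_def)

text \<open>The constants are 0.72 and its square. Replacing the square of \<open>R\<close> by its
  tangent at \<open>m\<close> makes the condition linear in \<open>R\<close>. As squared distance
  and ray distance are both sinusoids in the angle, \<open>sinusoid_ge\<close> becomes applicable. A
  good \<open>m\<close> is close to \<open>R\<close> where the condition is tight.\<close>

lemma sample_dist:
  assumes "(dist s q)\<^sup>2 < 324/625" "(dist s q)\<^sup>2 < 324/625 * (2 * m * R - m\<^sup>2)" "0 < R"
  shows "dist q s < 18/25 \<and> dist q s < 18/25 * R"
proof -
  have "0 \<le> (R - m)\<^sup>2" by simp
  then have "2 * m * R - m\<^sup>2 \<le> R\<^sup>2" by (simp add: power2_diff algebra_simps)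
  then have "324/625 * (2 * m * R - m\<^sup>2) \<le> 324/625 * R\<^sup>2" by (rule mult_left_mono) simp
  then have "(dist s q)\<^sup>2 < 324/625 * R\<^sup>2" using assms(2) by (rule less_le_trans[rotated])
  then have "(dist s q)\<^sup>2 < (18/25 * R)\<^sup>2" by (simp add: power_mult_distrib power2_eq_square)
  moreover have "(dist s q)\<^sup>2 < (18/25)\<^sup>2" using assms(1) by (simp add: power2_eq_square)
  ultimately have "dist s q < 18/25 * R" "dist s q < 18/25"
    using assms(3) power2_less_imp_less[of "dist s q" "18/25 * R"] power2_less_imp_less[of "dist s q" "18/25"] by simp_all
  then show ?thesis by (simp add: dist_commute)
qed

lemma piece1_sample:
  assumes e: "e * e = 1" and "q \<in> piece1 e"
  shows "1/2 \<le> ray (- e) q" "dist q sample_a < 18/25 \<and> dist q sample_a < 18/25 * ray (- e) q"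
proof -
  from assms obtain t where t: "- (3 * pi / 8) \<le> t" "t \<le> - (pi / 3)" and q: "q = arc_point e c1x c1y (3/2) t"
    by (auto simp: arc_set_def)
  have tl: "- (pi/3) - - (3 * pi / 8) < pi" using pi_gt_zero by (simp add: field_simps)
  define K where "K = sa * c1x + ca * c1y"
  have K: "205/100 < K" unfolding K_def by (rule ray_centres)
  have R: "ray (- e) q = K + 3/2 * (sa * sin t - ca * cos t)"
    unfolding q K_def by (rule ray_arc_point(2)[OF e])
  then have "ray (- e) q \<ge> K - 3/2" unfolding ray_sinusoids(3) by simp
  then show Rp: "1/2 \<le> ray (- e) q" using K by simp
  define D where "D = (sqrt 3 / 4 + 1/2)\<^sup>2 + c1y\<^sup>2 + 9/4"
  have D: "(dist sample_a q)\<^sup>2 = D - 3 * (- (sqrt 3 / 4 + 1/2) * sin t + c1y * cos t)"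
    unfolding q dist_arc_point_sq[OF e] sample_a_def D_def
    by (simp add: c2x_def power2_eq_square algebra_simps)
  have D': "D = 7/2 + sqrt 3 / 2"
    unfolding D_def c1y_def by (simp add: power2_eq_square field_simps)
  have Db: "D < 4367/1000" "D > 4" unfolding D' using sqrt_bounds by simp_all
  have p: "9238/10000 * (933/1000) < ca * (sqrt 3 / 4 + 1/2)" "3826/10000 * (1116/1000) < sa * c1y"
    by (rule mult_strict_mono; use eighth_bounds sqrt_bounds in \<open>simp add: c1y_def\<close>)+
  have k1: "1287/1000 \<le> - (sqrt 3 / 4 + 1/2) * sin t + c1y * cos t"
    by (rule sinusoid_ge[OF _ _ _ t tl])
       (use p sqrt_bounds in \<open>simp_all add: three_eighths sin_60 cos_60 c1y_def algebra_simps\<close>)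
  have k2: "D - 324/625 * (2 * K - 1) < 2765/1000"
    using Db K by (simp add: field_simps)
  have k3: "2765/1000 \<le> (- 3 * (sqrt 3 / 4 + 1/2) + 972/625 * sa) * sin t + (3 * c1y - 972/625 * ca) * cos t"
  proof (rule sinusoid_ge[OF _ _ _ t tl])
    show "2765/1000 \<le> (- 3 * (sqrt 3 / 4 + 1/2) + 972/625 * sa) * sin (- (3 * pi / 8)) + (3 * c1y - 972/625 * ca) * cos (- (3 * pi / 8))"
    proof -
      have "(- 3 * (sqrt 3 / 4 + 1/2) + 972/625 * sa) * sin (- (3 * pi / 8)) + (3 * c1y - 972/625 * ca) * cos (- (3 * pi / 8))
        = 3 * (ca * (sqrt 3 / 4 + 1/2)) + 3 * (sa * c1y) - 972/625 * (2 * sa * ca)"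
        by (simp add: three_eighths algebra_simps)
      also have "\<dots> \<ge> 2765/1000" unfolding double_eighth(1) using p sqrt_bounds by simp
      finally show ?thesis .
    qed
    have "sqrt 3 * sa < 17321/10000 * (3828/10000)" by (rule mult_strict_mono; use eighth_bounds sqrt_bounds sa_pos in simp)
    moreover have "sqrt 3 * sa > 1732/1000 * (3826/10000)" by (rule mult_strict_mono; use eighth_bounds sqrt_bounds sa_pos in simp)
    ultimately show "2765/1000 \<le> (- 3 * (sqrt 3 / 4 + 1/2) + 972/625 * sa) * sin (- (pi/3)) + (3 * c1y - 972/625 * ca) * cos (- (pi/3))"
      using eighth_bounds sqrt_bounds by (simp add: sin_60 cos_60 c1y_def algebra_simps)
  qed simp
  show "dist q sample_a < 18/25 \<and> dist q sample_a < 18/25 * ray (- e) q"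
  \<comment> \<open>At the start of the strand the ray distance is very close to 1, so linearizing
    at 1 loses almost nothing there.\<close>
  proof (rule sample_dist[where m = 1])
    show "(dist sample_a q)\<^sup>2 < 324/625" unfolding D using k1 Db by simp
    show "(dist sample_a q)\<^sup>2 < 324/625 * (2 * 1 * ray (- e) q - 1\<^sup>2)"
    proof -
      have "324/625 * (2 * 1 * ray (- e) q - 1\<^sup>2) - (dist sample_a q)\<^sup>2 =
          ((- 3 * (sqrt 3 / 4 + 1/2) + 972/625 * sa) * sin t + (3 * c1y - 972/625 * ca) * cos t) - (D - 324/625 * (2 * K - 1))"
        unfolding D R by (simp add: field_simps)
      then show ?thesis using k2 k3 by linarith
    qed
  qed (use Rp in simp)
qed

lemma piece2_sample:
  assumes e: "e * e = 1" and "q \<in> piece2 e"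
  shows "1/2 \<le> ray (- e) q"
    "\<exists>s\<in>{sample_a, sample_e}. dist q s < 18/25 \<and> dist q s < 18/25 * ray (- e) q"
proof -
  from assms obtain t where t: "- (pi / 3) \<le> t" "t \<le> pi / 6" and q: "q = arc_point e c2x c2y 1 t"
    by (auto simp: arc_set_def)
  define K where "K = sa * c2x + ca * c2y"
  have K: "16646/10000 < K" unfolding K_def by (rule ray_centres)
  have R: "ray (- e) q = K + (sa * sin t - ca * cos t)"
    unfolding q K_def using ray_arc_point(2)[OF e, of c2x c2y 1 t] by simp
  then have "ray (- e) q \<ge> K - 1" unfolding ray_sinusoids(3) by simp
  then show Rp: "1/2 \<le> ray (- e) q" using K by simp
  have prods: "sqrt 3 * sa < 17321/10000 * (3828/10000)" "sqrt 3 * ca < 17321/10000 * (9240/10000)"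
      "0 < sqrt 3 * sa"
    by (rule mult_strict_mono | use eighth_bounds sqrt_bounds sa_pos ca_pos in simp)+
  show "\<exists>s\<in>{sample_a, sample_e}. dist q s < 18/25 \<and> dist q s < 18/25 * ray (- e) q"
  \<comment> \<open>Angle 0 is the extreme point midway between the two crossings;
    \<open>sample_a\<close> serves the half before it, \<open>sample_e\<close> the half after
    it.\<close>
  proof (cases "t \<le> 0")
    case True
    have tl: "0 - - (pi/3) < pi" using pi_gt_zero by (simp add: field_simps)
    have D: "(dist sample_a q)\<^sup>2 = 2 - (- 1 * sin t + sqrt 3 * cos t)"
      unfolding q dist_arc_point_sq[OF e] sample_a_def
      by (simp add: c2y_def power2_eq_square field_simps)
    have k1: "1732/1000 \<le> - 1 * sin t + sqrt 3 * cos t"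
      by (rule sinusoid_ge[OF _ _ _ t(1) True tl])
        (use sqrt_bounds in \<open>simp_all add: sin_60 cos_60\<close>)
    have k2: "1 \<le> (- 1 + 486/625 * sa) * sin t + (sqrt 3 - 486/625 * ca) * cos t"
      by (rule sinusoid_ge[OF _ _ _ t(1) True tl])
        (use sqrt_bounds eighth_bounds prods in \<open>simp_all add: sin_60 cos_60 algebra_simps\<close>)
    have "dist q sample_a < 18/25 \<and> dist q sample_a < 18/25 * ray (- e) q"
    \<comment> \<open>At angle 0, the tight spot, the ray distance is about 0.74.\<close>
    proof (rule sample_dist[where m = "3/4"])
      show "(dist sample_a q)\<^sup>2 < 324/625" unfolding D using k1 by simp
      show "(dist sample_a q)\<^sup>2 < 324/625 * (2 * (3/4) * ray (- e) q - (3/4)\<^sup>2)"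
        unfolding D R using k2 K by (simp add: power2_eq_square algebra_simps)
    qed (use Rp in simp)
    then show ?thesis by blast
  next
    case False
    then have t0: "0 \<le> t" by simp
    have tl: "pi/6 - 0 < pi" using pi_gt_zero by (simp add: field_simps)
    have D: "(dist sample_e q)\<^sup>2 = 2 - (1 * sin t + sqrt 3 * cos t)"
      unfolding q dist_arc_point_sq[OF e] sample_e_def
      by (simp add: c2y_def power2_eq_square field_simps)
    have k1: "1732/1000 \<le> 1 * sin t + sqrt 3 * cos t"
      by (rule sinusoid_ge[OF _ _ _ t0 t(2) tl])
        (use sqrt_bounds in \<open>simp_all add: sin_30 cos_30\<close>)
    have k2: "1 \<le> (1 + 486/625 * sa) * sin t + (sqrt 3 - 486/625 * ca) * cos t"
      by (rule sinusoid_ge[OF _ _ _ t0 t(2) tl])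
        (use sqrt_bounds eighth_bounds prods in \<open>simp_all add: sin_30 cos_30 algebra_simps\<close>)
    have "dist q sample_e < 18/25 \<and> dist q sample_e < 18/25 * ray (- e) q"
    proof (rule sample_dist[where m = "3/4"])
      show "(dist sample_e q)\<^sup>2 < 324/625" unfolding D using k1 by simp
      show "(dist sample_e q)\<^sup>2 < 324/625 * (2 * (3/4) * ray (- e) q - (3/4)\<^sup>2)"
        unfolding D R using k2 K by (simp add: power2_eq_square algebra_simps)
    qed (use Rp in simp)
    then show ?thesis by blast
  qed
qed

lemma sample_dist_far:
  assumes "(dist s q)\<^sup>2 < 324/625" "1 \<le> R"
  shows "dist q s < 18/25 \<and> dist q s < 18/25 * R"
  using assms by (intro sample_dist[where m = 1]) auto

lemma piece3_sample:
  assumes e: "e * e = 1" and "q \<in> piece3 e"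
  shows "1 \<le> ray (- e) q"
    "\<exists>s\<in>{sample_e, sample_f}. dist q s < 18/25 \<and> dist q s < 18/25 * ray (- e) q"
proof -
  from assms obtain t where t: "- dip \<le> t" "t \<le> pi / 6" and q: "q = arc_point e c3x c3y (-1) t"
    by (auto simp: arc_set_def)
  have "sin t \<le> sin (pi/6)" "sin (- dip) \<le> sin t"
    using t dip by (auto intro!: sin_monotone_2pi_le simp del: sin_minus)
  then have s: "sin t \<le> 1/2" "- sin dip \<le> sin t" by (auto simp: sin_30)
  have c: "sqrt 3 / 2 \<le> cos t"
  proof -
    have "cos (pi/6) \<le> cos \<bar>t\<bar>" using t dip by (intro cos_monotone_0_pi_le) auto
    then show ?thesis by (simp add: cos_30)
  qed
  have "ray (- e) q = sa * (c3x - sin t) + ca * (c3y + cos t)"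
    unfolding q ray_arc_point(2)[OF e] by (simp add: algebra_simps)
  moreover have "3826/10000 * (276/100) \<le> sa * (c3x - sin t)"
    by (rule mult_mono) (use eighth_bounds c_bounds s in \<open>auto simp: c3x_def\<close>)
  moreover have "0 \<le> ca * (c3y + cos t)" using c ca_pos by (simp add: c3y_def)
  ultimately show Rp: "1 \<le> ray (- e) q" by simp
  have D: "(dist sample_e q)\<^sup>2 = 2 - (1 * sin t + sqrt 3 * cos t)"
    unfolding q dist_arc_point_sq[OF e] sample_e_def
    by (simp add: c3x_def c3y_def power2_eq_square field_simps)
  have D': "(dist sample_f q)\<^sup>2 = 7/4 + 4 * (sin dip)\<^sup>2 + 4 * (sin dip * sin t) - sqrt 3 * cos t"
    unfolding q dist_arc_point_sq[OF e] sample_f_def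
    by (simp add: c4x_def c3y_def power2_eq_square field_simps)
  \<comment> \<open>\<open>sample_e\<close> and \<open>sample_f\<close> both reach the point where
    the sine is -0.15, with room to spare; any nearby value could mark the change of sample.\<close>
  consider "0 \<le> t" | "t \<le> 0" "-15/100 \<le> sin t" | "t \<le> 0" "sin t < -15/100" by linarith
  then show "\<exists>s\<in>{sample_e, sample_f}. dist q s < 18/25 \<and> dist q s < 18/25 * ray (- e) q"
  proof cases
    case 1
    have tl: "pi/6 - 0 < pi" using pi_gt_zero by (simp add: field_simps)
    have "1732/1000 \<le> 1 * sin t + sqrt 3 * cos t"
      by (rule sinusoid_ge[OF _ _ _ 1 t(2) tl])
        (use sqrt_bounds in \<open>simp_all add: sin_30 cos_30\<close>)
    then show ?thesis using sample_dist_far[of sample_e q] D Rp by force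
  next
    case 2
    have "sin t \<le> 0" using sin_diff_neg(1)[of t 0] 2 t dip by simp
    then have "(sin t)\<^sup>2 \<le> (15/100)\<^sup>2" using 2 by (simp add: abs_le_square_iff [symmetric])
    moreover have "(cos t)\<^sup>2 \<le> cos t" using c sqrt_bounds by (simp add: power2_eq_square mult_left_le)
    ultimately have "97/100 \<le> cos t" using sin_cos_squared_add[of t] by (simp add: power2_eq_square)
    then have "1732/1000 * (97/100) \<le> sqrt 3 * cos t" using sqrt_bounds by (intro mult_mono) auto
    then show ?thesis using sample_dist_far[of sample_e q] D Rp 2 by force
  next
    case 3
    have "cos dip \<le> cos (- t)" using 3 t dip by (intro cos_monotone_0_pi_le) auto
    then have "933/1000 \<le> cos t" using dip sqrt_bounds by simp
    then have "1732/1000 * (933/1000) \<le> sqrt 3 * cos t" using sqrt_bounds by (intro mult_mono) auto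
    moreover have "359/1000 * (15/100) \<le> sin dip * (- sin t)" using dip 3 by (intro mult_mono) auto
    moreover have "(sin dip)\<^sup>2 \<le> (361/1000)\<^sup>2" using dip by (intro power_mono) auto
    ultimately have "(dist sample_f q)\<^sup>2 < 324/625" unfolding D' by (simp add: power2_eq_square)
    then show ?thesis using sample_dist_far[of sample_f q] Rp by force
  qed
qed

lemma piece4_sample:
  assumes e: "e * e = 1" and "q \<in> piece4 e"
  shows "1 \<le> ray (- e) q" "dist q sample_f < 18/25 \<and> dist q sample_f < 18/25 * ray (- e) q"
proof -
  from assms obtain t where t: "- dip \<le> t" "t \<le> 0" and q: "q = arc_point e c4x 1 1 t"
    by (auto simp: arc_set_def)
  have "sin (- dip) \<le> sin t" using t dip by (auto intro!: sin_monotone_2pi_le simp del: sin_minus)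
  then have s: "- sin dip \<le> sin t" by simp
  have c: "cos dip \<le> cos (- t)" using t dip by (intro cos_monotone_0_pi_le) auto
  have "ray (- e) q = sa * (c4x + sin t) + ca * (1 - cos t)"
    unfolding q ray_arc_point(2)[OF e] by (simp add: algebra_simps)
  moreover have "3826/10000 * (358/100) \<le> sa * (c4x + sin t)"
    by (rule mult_mono) (use eighth_bounds c_bounds s dip in auto)
  moreover have "0 \<le> ca * (1 - cos t)" using ca_pos by simp
  ultimately show Rp: "1 \<le> ray (- e) q" by simp
  have "(dist sample_f q)\<^sup>2 = 2 - 2 * cos t"
    unfolding q dist_arc_point_sq[OF e] sample_f_def by (simp add: power2_eq_square field_simps)
  then show "dist q sample_f < 18/25 \<and> dist q sample_f < 18/25 * ray (- e) q"
    using sample_dist_far[of sample_f q, OF _ Rp] c dip sqrt_bounds by simp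
qed

text \<open>Besides making the sampling condition meaningful, the bound 1/2 keeps the inner part off
  the ray it turns away from; this later yields a positive feature size at the end of the fifth
  arc.\<close>

lemma inner_sample:
  assumes e: "e * e = 1" and q: "q \<in> inner_part e"
  shows "1/2 \<le> ray (- e) q"
    "\<exists>s \<in> {sample_a, sample_e, sample_f}. dist q s < 18/25 \<and> dist q s < 18/25 * ray (- e) q"
proof -
  have "1/2 \<le> ray (- e) q \<and> (\<exists>s \<in> {sample_a, sample_e, sample_f}. dist q s < 18/25 \<and> dist q s < 18/25 * ray (- e) q)"
    using q unfolding inner_part_def
  proof (elim UnE)
    assume "q \<in> piece1 e" from piece1_sample[OF e this] show ?thesis by blast
  next
    assume "q \<in> piece2 e" from piece2_sample[OF e this] show ?thesis by blast
  next
    assume "q \<in> piece3 e" from piece3_sample[OF e this] show ?thesis by force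
  next
    assume "q \<in> piece4 e" from piece4_sample[OF e this] show ?thesis by force
  qed
  then show "1/2 \<le> ray (- e) q"
    "\<exists>s \<in> {sample_a, sample_e, sample_f}. dist q s < 18/25 \<and> dist q s < 18/25 * ray (- e) q" by blast+
qed

section \<open>Critical points of the wedge\<close>

definition nearest :: "'a::metric_space set \<Rightarrow> 'a \<Rightarrow> 'a \<Rightarrow> bool" where
  "nearest C x q \<longleftrightarrow> q \<in> C \<and> (\<forall>c\<in>C. dist x q \<le> dist x c)"

text \<open>A point of the wedge is critical if it can be the folded image of a medial axis point:
  besides two nearest points in the wedge, this happens for a point on a bounding ray with a nearest
  point off that ray, because unfolding duplicates the latter.\<close>

definition critical :: "real \<Rightarrow> complex \<Rightarrow> bool" where
  "critical e z \<longleftrightarrow> 0 \<le> ray 1 z \<and> 0 \<le> ray (-1) z \<and>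
     (\<exists>q. nearest (curve e) z q \<and>
        ((\<exists>q'. nearest (curve e) z q' \<and> q' \<noteq> q) \<or> (ray 1 z = 0 \<and> ray 1 q \<noteq> 0) \<or> (ray (-1) z = 0 \<and> ray (-1) q \<noteq> 0)))"

lemma curve_rays:
  assumes e: "e = 1 \<or> e = -1" and q: "q \<in> curve e"
  shows "0 \<le> ray 1 q" "0 \<le> ray (-1) q" "0 < ray 1 q \<or> 0 < ray (-1) q"
proof -
  have ee: "e * e = 1" using e by auto
  have "0 \<le> ray e q \<and> 0 < ray (- e) q" if "q \<in> inner_part e"
    using inner_sample(1)[OF ee that] that tube_ray_inner[OF ee, of q q]
    unfolding inner_part_def by (auto dest!: in_tube_self)
  moreover have "0 < ray 1 q \<and> 0 \<le> ray (-1) q" if "q \<in> piece5"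
    using tube_ray_outer[OF in_tube_self[OF that]] by simp
  ultimately show "0 \<le> ray 1 q" "0 \<le> ray (-1) q" "0 < ray 1 q \<or> 0 < ray (-1) q"
    using q e unfolding curve_def by auto
qed

text \<open>Within distance 1 the foot is unique, and if \<open>z\<close> lies on a ray that the
  strand crosses at the foot's end, the foot lies on that ray too. There remain points of ray
  \<open>- e\<close> with a foot in the inner part. The foot is recorded for \<open>e = 1\<close>
  because then the fifth arc ends on this very ray, and the distance from \<open>p\<close> to the
  ray gives no positive bound.\<close>

lemma critical_far:
  assumes e: "e = 1 \<or> e = -1" and z: "critical e z" and p: "p \<in> curve e"
  shows "1 \<le> dist p z \<or> (ray (- e) z = 0 \<and> (e = 1 \<longrightarrow> (\<exists>q\<in>inner_part e. dist z q \<le> dist p z)))"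
proof (rule ccontr)
  assume neg: "\<not> ?thesis"
  have ee: "e * e = 1" using e by auto
  obtain q where q: "nearest (curve e) z q"
    and alt: "(\<exists>q'. nearest (curve e) z q' \<and> q' \<noteq> q) \<or> (ray 1 z = 0 \<and> ray 1 q \<noteq> 0) \<or> (ray (-1) z = 0 \<and> ray (-1) q \<noteq> 0)"
    and W: "0 \<le> ray 1 z" "0 \<le> ray (-1) z"
    using z unfolding critical_def by blast
  have lt: "dist z q' < 1" if "nearest (curve e) z q'" for q'
    using that p neg unfolding nearest_def by (metis dist_commute less_le_trans not_less order.strict_trans2)
  have T: "tube e z q'" if "nearest (curve e) z q'" for q'
    using nearest_in_tube[OF e W, of q'] that lt[OF that] unfolding nearest_def by blast
  have "q' = q" if "nearest (curve e) z q'" for q' using tube_unique[OF ee T[OF that] T[OF q]] .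
  then have alt': "(ray 1 z = 0 \<and> ray 1 q \<noteq> 0) \<or> (ray (-1) z = 0 \<and> ray (-1) q \<noteq> 0)" using alt by blast
  have qd: "dist z q \<le> dist p z" using q p unfolding nearest_def by (metis dist_commute)
  have A: "ray e z = 0 \<longrightarrow> ray e q = 0" if "\<not> tube5 z q"
  proof
    assume "ray e z = 0"
    then have "tube1 e z q" "q = arc_point e c1x c1y (3/2) (- (3 * pi / 8))"
      using T[OF q] that tube_ray_inner[OF ee, of z q] unfolding tube_def by auto
    then show "ray e q = 0"
      unfolding ray_arc_point[OF ee] by (simp add: ray_arc_point[OF ee] ray_centres three_eighths)
  qed
  have B: "ray (-1) z = 0 \<longrightarrow> ray (-1) q = 0" "ray 1 z \<noteq> 0" if "tube5 z q"
  proof -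
    show "ray 1 z \<noteq> 0" using tube_ray_outer(1)[OF that] by simp
    have f: "sin (5 * pi / 8) = ca" "cos (5 * pi / 8) = - sa"
      using sin_add[of "pi/2" "pi/8"] cos_add[of "pi/2" "pi/8"] by simp_all
    show "ray (-1) z = 0 \<longrightarrow> ray (-1) q = 0"
      using tube_ray_outer(3)[OF that] ray_arc_point(2)[of 1 c4x "- c5r" "- c5r" "- (5 * pi / 8)"] centres_on_rays(2)
      by (simp add: f)
  qed
  have C: "\<not> tube5 z q \<Longrightarrow> q \<in> inner_part e"
    using T[OF q] unfolding tube_def inner_part_def arc_set_def in_tube_def by auto
  show False
  proof (cases "tube5 z q")
    case True
    then show False using B alt' by blast
  next
    case False
    then have "ray (- e) z = 0" using A alt' e by auto
    then show False using neg C[OF False] qd by blast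
  qed
qed

text \<open>The bound 2 accounts for the axis of rotation, which stays at distance more than 2.\<close>

lemma curve_sampled:
  assumes e: "e = 1 \<or> e = -1" and p: "p \<in> curve e"
  shows "\<exists>s \<in> curve 1 \<inter> curve (-1). \<exists>l\<le>2. dist p s < 18/25 * l \<and> (\<forall>z. critical e z \<longrightarrow> l \<le> dist p z)"
proof -
  have ee: "e * e = 1" "(- e) * (- e) = 1" using e by auto
  have far: "1 \<le> dist p z \<or> ray (- e) p \<le> dist p z" if "critical e z" for z
    using critical_far[OF e that p] ray_le_dist[OF ee(2), of p z] by auto
  show ?thesis
  proof (cases "p \<in> inner_part e")
    case True
    obtain s where s: "s \<in> {sample_a, sample_e, sample_f}" "dist p s < 18/25" "dist p s < 18/25 * ray (- e) p"
      using inner_sample[OF ee(1) True] by blast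
    have "s \<in> curve 1 \<inter> curve (-1)" using s(1) samples_in_curve by auto
    moreover have "dist p s < 18/25 * min 1 (ray (- e) p)" using s by (auto simp: min_def)
    ultimately show ?thesis
      using far by (intro bexI[of _ s] exI[of _ "min 1 (ray (- e) p)"]) (auto simp: min_le_iff_disj)
  next
    case False
    then have p5: "p \<in> piece5" using p unfolding curve_def by simp
    then have "p \<in> curve 1 \<inter> curve (-1)" by (simp add: curve_def)
    \<comment> \<open>As \<open>p\<close> is its own sample, any positive \<open>l\<close> will do.
      If \<open>p\<close> lies on ray \<open>- e\<close>, which forces \<open>e = 1\<close>, the
      bound comes from the foot of \<open>z\<close> in the inner part.\<close>
    moreover have "\<exists>l\<le>2. 0 < l \<and> (\<forall>z. critical e z \<longrightarrow> l \<le> dist p z)"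
    proof (cases "0 < ray (- e) p")
      case True
      then show ?thesis using far by (intro exI[of _ "min 1 (ray (- e) p)"]) (auto simp: min_le_iff_disj)
    next
      case False
      then have e1: "e = 1" using e tube_ray_outer(1)[OF in_tube_self[OF p5]] by auto
      have "1/2 \<le> dist p z" if crit: "critical e z" for z
      proof -
        consider "1 \<le> dist p z" | q where "ray (- e) z = 0" "q \<in> inner_part e" "dist z q \<le> dist p z"
          using critical_far[OF e crit p] e1 by blast
        then show ?thesis
        proof cases
          case 2
          have "1/2 \<le> ray (- e) q - ray (- e) z" using inner_sample(1)[OF ee(1) 2(2)] 2(1) by simp
          also have "\<dots> \<le> dist q z" using ray_le_dist[OF ee(2)] .
          finally show ?thesis using 2(3) by (simp add: dist_commute)
        qed simp
      qed
      then show ?thesis by (intro exI[of _ "1/2"]) auto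
    qed
    ultimately show ?thesis by (intro bexI[of _ p]) auto
  qed
qed

section \<open>Size, compactness and parametrization of the curve\<close>

lemma curve_norm:
  assumes "e = 1 \<or> e = -1" "q \<in> curve e"
  shows "norm q < 8"
proof -
  have "norm (arc_point e' x y r t) \<le> \<bar>x\<bar> + \<bar>y\<bar> + 2 * \<bar>r\<bar>" if "e' = 1 \<or> e' = -1" for e' x y r t
  proof -
    have "norm (arc_point e' x y r t) \<le> \<bar>x + r * sin t\<bar> + \<bar>y - r * cos t\<bar>"
      using cmod_le[of "arc_point e' x y r t"] that by auto
    also have "\<dots> \<le> \<bar>x\<bar> + \<bar>r * sin t\<bar> + (\<bar>y\<bar> + \<bar>r * cos t\<bar>)" by linarith
    finally have "norm (arc_point e' x y r t) \<le> \<bar>x\<bar> + \<bar>r * sin t\<bar> + (\<bar>y\<bar> + \<bar>r * cos t\<bar>)" .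
    moreover have "\<bar>r * sin t\<bar> \<le> \<bar>r\<bar>" "\<bar>r * cos t\<bar> \<le> \<bar>r\<bar>" by (auto simp: abs_mult mult_left_le)
    ultimately show ?thesis by linarith
  qed
  note N = this
  have cb: "\<bar>c1x\<bar> \<le> 3" "\<bar>c1y\<bar> \<le> 12/10" "\<bar>c2x\<bar> \<le> 3" "\<bar>c2y\<bar> \<le> 1" "\<bar>c3x\<bar> \<le> 4" "\<bar>c3y\<bar> \<le> 1"
    using c_bounds sqrt_bounds by (auto simp: c2x_def c1y_def c2y_def c3x_def c3y_def)
  show ?thesis
    using assms(2) unfolding curve_def inner_part_def
  proof (elim UnE)
    assume "q \<in> piece5"
    then obtain t where q: "q = arc_point 1 c4x (- c5r) (- c5r) t" by (auto simp: arc_set_def)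
    \<comment> \<open>The general bound \<open>N\<close> would exceed 8 here, so the radius vector
      is measured by its exact length.\<close>
    have "norm q = norm (Complex c4x (- c5r) + Complex (- c5r * sin t) (c5r * cos t))"
      by (simp add: q arc_point_def complex_add algebra_simps)
    also have "\<dots> \<le> norm (Complex c4x (- c5r)) + norm (Complex (- c5r * sin t) (c5r * cos t))" by (rule norm_triangle_ineq)
    also have "norm (Complex c4x (- c5r)) \<le> \<bar>c4x\<bar> + \<bar>c5r\<bar>" using cmod_le[of "Complex c4x (- c5r)"] by simp
    also have "norm (Complex (- c5r * sin t) (c5r * cos t)) = \<bar>c5r\<bar>"
    proof -
      have "(c5r * sin t)\<^sup>2 + (c5r * cos t)\<^sup>2 = c5r\<^sup>2 * ((sin t)\<^sup>2 + (cos t)\<^sup>2)" by (simp only: power_mult_distrib distrib_left)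
      then show ?thesis by (simp add: cmod_def)
    qed
    finally show ?thesis using c_bounds by simp
  next
    assume "q \<in> piece1 e"
    then obtain t where "q = arc_point e c1x c1y (3/2) t" by (auto simp: arc_set_def)
    then show ?thesis using N[OF assms(1), of c1x c1y "3/2" t] cb c_bounds by simp
  next
    assume "q \<in> piece2 e"
    then obtain t where "q = arc_point e c2x c2y 1 t" by (auto simp: arc_set_def)
    then show ?thesis using N[OF assms(1), of c2x c2y 1 t] cb c_bounds by simp
  next
    assume "q \<in> piece3 e"
    then obtain t where "q = arc_point e c3x c3y (-1) t" by (auto simp: arc_set_def)
    then show ?thesis using N[OF assms(1), of c3x c3y "-1" t] cb c_bounds by simp
  next
    assume "q \<in> piece4 e"
    then obtain t where "q = arc_point e c4x 1 1 t" by (auto simp: arc_set_def)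
    then show ?thesis using N[OF assms(1), of c4x 1 1 t] cb c_bounds by simp
  qed
qed

lemma compact_curve: "compact (curve e)"
  unfolding curve_def inner_part_def arc_set_def
  by (intro compact_Un compact_continuous_image continuous_arc_point compact_Icc)

lemma arc_reparam:
  fixes e x y r l u :: real
  assumes e: "e * e = 1" and "r \<noteq> 0" "l < u" "u - l < pi"
  defines "g \<equiv> (\<lambda>s. arc_point e x y r (l + s * (u - l)))"
  shows "arc g" "path_image g = arc_set e x y r l u" "pathstart g = arc_point e x y r l" "pathfinish g = arc_point e x y r u"
proof -
  have im: "(\<lambda>s. l + s * (u - l)) ` {0..1} = {l..u}"
    using image_affinity_atLeastAtMost[of "u - l" l 0 "1::real"] \<open>l < u\<close> by (auto simp: mult.commute add.commute)
  have g: "g = arc_point e x y r \<circ> (\<lambda>s. l + s * (u - l))" by (auto simp: g_def)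
  show "path_image g = arc_set e x y r l u"
    unfolding path_image_def arc_set_def g image_comp[symmetric] im by simp
  show "pathstart g = arc_point e x y r l" "pathfinish g = arc_point e x y r u"
    by (simp_all add: pathstart_def pathfinish_def g_def)
  have "path g" unfolding path_def g
    by (intro continuous_on_compose continuous_arc_point continuous_intros)
  moreover have "inj_on g {0..1}"
  proof (rule inj_onI)
    fix s s' :: real assume s: "s \<in> {0..1}" "s' \<in> {0..1}" and eq: "g s = g s'"
    have "l + s * (u - l) \<in> {l..u}" "l + s' * (u - l) \<in> {l..u}" using s im by blast+
    then have "\<bar>(l + s * (u - l)) - (l + s' * (u - l))\<bar> < pi" using assms(4) by auto
    moreover have "r * r > 0" using assms(2) by (metis not_square_less_zero linorder_neqE_linordered_idom mult_eq_0_iff)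
    ultimately have "l + s * (u - l) = l + s' * (u - l)"
      using arc_point_angle_unique[OF e, of x y r "l + s * (u - l)" r "l + s' * (u - l)"] eq by (simp add: g_def)
    then show "s = s'" using \<open>l < u\<close> by simp
  qed
  ultimately show "arc g" by (simp add: arc_def)
qed

text \<open>For \<open>e = 1\<close> the strand joins the two rays; for \<open>e = -1\<close> it
  begins and ends on the lower one, which is why \<open>ray e q = 0\<close> must allow both ends.
  This difference alone decides how the reflected copies close up.\<close>

lemma curve_arc:
  assumes e: "e = 1 \<or> e = -1"
  obtains g where "arc g" "path_image g = curve e"
    "\<And>q. q \<in> curve e \<Longrightarrow> ray e q = 0 \<Longrightarrow> q = pathstart g \<or> q = pathfinish g"
    "\<And>q. q \<in> curve e \<Longrightarrow> ray (- e) q = 0 \<Longrightarrow> q = pathfinish g"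
    "ray e (pathstart g) = 0" "ray (-1) (pathfinish g) = 0"
proof -
  have ee: "e * e = 1" using e by auto
  have P: "- (3 * pi / 8) < - (pi / 3)" "- (pi / 3) < pi / 6" "- dip < pi / 6" "- dip < 0" "- (5 * pi / 8) < 0"
    "- (pi / 3) - - (3 * pi / 8) < pi" "pi / 6 - - (pi / 3) < pi" "pi / 6 - - dip < pi" "0 - - dip < pi" "0 - - (5 * pi / 8) < pi"
    using dip pi_gt_zero by (auto simp: field_simps)
  obtain g1 where g1: "arc g1" "path_image g1 = piece1 e" "pathstart g1 = arc_point e c1x c1y (3/2) (- (3 * pi / 8))"
    "pathfinish g1 = arc_point e c1x c1y (3/2) (- (pi / 3))"
    using arc_reparam[OF ee _ P(1,6), of "3/2" c1x c1y] by auto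
  obtain g2 where g2: "arc g2" "path_image g2 = piece2 e" "pathstart g2 = arc_point e c2x c2y 1 (- (pi / 3))"
    "pathfinish g2 = arc_point e c2x c2y 1 (pi / 6)"
    using arc_reparam[OF ee _ P(2,7), of 1 c2x c2y] by auto
  \<comment> \<open>A right turn is traversed with decreasing angle, hence the reversed
    path.\<close>
  obtain g3 where g3: "arc g3" "path_image g3 = piece3 e" "pathfinish g3 = arc_point e c3x c3y (-1) (- dip)"
    "pathstart g3 = arc_point e c3x c3y (-1) (pi / 6)"
  proof -
    define g where "g = (\<lambda>s. arc_point e c3x c3y (-1) (- dip + s * (pi / 6 - - dip)))"
    note g = arc_reparam[OF ee _ P(3,8), of "-1" c3x c3y, folded g_def]
    show thesis by (rule that[of "reversepath g"]) (simp_all add: g arc_reversepath)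
  qed
  obtain g4 where g4: "arc g4" "path_image g4 = piece4 e" "pathstart g4 = arc_point e c4x 1 1 (- dip)"
    "pathfinish g4 = arc_point e c4x 1 1 0"
    using arc_reparam[OF ee _ P(4,9), of 1 c4x 1] by auto
  have c5: "(1::real) * 1 = 1" "- c5r \<noteq> 0" using c_bounds by auto
  obtain g5 where g5: "arc g5" "path_image g5 = piece5" "pathfinish g5 = arc_point 1 c4x (- c5r) (- c5r) (- (5 * pi / 8))"
    "pathstart g5 = arc_point 1 c4x (- c5r) (- c5r) 0"
  proof -
    define g where "g = (\<lambda>s. arc_point 1 c4x (- c5r) (- c5r) (- (5 * pi / 8) + s * (0 - - (5 * pi / 8))))"
    note g = arc_reparam[OF c5 P(5,10), of c4x "- c5r", folded g_def]
    show thesis by (rule that[of "reversepath g"]) (simp_all add: g arc_reversepath)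
  qed
  have o: "c2x < c3x" "c3x < c4x" using dip by (auto simp: c3x_def c4x_def)
  \<comment> \<open>Each arc lies in its own tube, so the separation of the tubes also shows that
    the arcs meet only at the joints.\<close>
  have self: "q \<in> piece1 e \<Longrightarrow> tube1 e q q" "q \<in> piece2 e \<Longrightarrow> tube2 e q q" "q \<in> piece3 e \<Longrightarrow> tube3 e q q"
    "q \<in> piece4 e \<Longrightarrow> tube4 e q q" "q \<in> piece5 \<Longrightarrow> tube5 q q" for q
    by (rule in_tube_self, assumption)+
  have I45: "piece4 e \<inter> piece5 \<subseteq> {pathstart g5}"
  proof
    fix q assume "q \<in> piece4 e \<inter> piece5"
    then have "tube4 e q q" "tube5 q q" using self by auto
    then show "q \<in> {pathstart g5}" using tube4_sep(2)[OF ee, of q q] tube5_sep[of q q] g5(4) by simp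
  qed
  have I34: "piece3 e \<inter> piece4 e \<subseteq> {pathstart g4}"
  proof
    fix q assume "q \<in> piece3 e \<inter> piece4 e"
    then have "tube3 e q q" "tube4 e q q" using self by auto
    then show "q \<in> {pathstart g4}"
      using tube3_sep(5)[OF ee, of q q] tube4_sep(3,4)[OF ee, of q q] g4(3) junction_points(3)[of e] by simp
  qed
  have I23: "piece2 e \<inter> piece3 e \<subseteq> {pathstart g3}"
  proof
    fix q assume "q \<in> piece2 e \<inter> piece3 e"
    then have "tube2 e q q" "tube3 e q q" using self by auto
    then show "q \<in> {pathstart g3}"
      using tube2_sep(4)[OF ee, of q q] tube3_sep(3,4)[OF ee, of q q] g3(4) junction_points(2)[of e] by simp
  qed
  have I12: "piece1 e \<inter> piece2 e \<subseteq> {pathstart g2}"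
  proof
    fix q assume "q \<in> piece1 e \<inter> piece2 e"
    then have "tube1 e q q" "tube2 e q q" using self by auto
    then show "q \<in> {pathstart g2}"
      using tube1_sep(2)[OF ee, of q q] tube2_sep(2,3)[OF ee, of q q] g2(3) by simp
  qed
  have R1: "Re q < c2x" if "q \<in> piece1 e" for q using tube1_sep(1)[OF ee self(1)[OF that]] .
  have R2: "Re q < c3x" if "q \<in> piece2 e" for q using tube2_sep(1)[OF ee self(2)[OF that]] .
  have R3: "c2x < Re q" "Re q < c4x" if "q \<in> piece3 e" for q using tube3_sep(1,2)[OF ee self(3)[OF that]] .
  have R4: "c3x < Re q" if "q \<in> piece4 e" for q using tube4_sep(1)[OF ee self(4)[OF that]] .
  have R5: "c4x \<le> Re q" if "q \<in> piece5" for q using tube5_sep(1)[OF self(5)[OF that]] .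
  have I35: "piece3 e \<inter> piece5 = {}"
    using R3 R5 by (fastforce simp: disjoint_iff)
  have I24: "piece2 e \<inter> (piece4 e \<union> piece5) = {}"
    using R2 R4 R5 o by (fastforce simp: disjoint_iff)
  have I13: "piece1 e \<inter> (piece3 e \<union> (piece4 e \<union> piece5)) = {}"
    using R1 R3 R4 R5 o by (fastforce simp: disjoint_iff)
  have I3: "piece3 e \<inter> (piece4 e \<union> piece5) \<subseteq> {pathstart g4}" using I34 I35 by blast
  have I2: "piece2 e \<inter> (piece3 e \<union> (piece4 e \<union> piece5)) \<subseteq> {pathstart g3}" using I23 I24 by blast
  have I1: "piece1 e \<inter> (piece2 e \<union> (piece3 e \<union> (piece4 e \<union> piece5))) \<subseteq> {pathstart g2}" using I12 I13 by blast
  define h4 where "h4 = g4 +++ g5"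
  define h3 where "h3 = g3 +++ h4"
  define h2 where "h2 = g2 +++ h3"
  define h1 where "h1 = g1 +++ h2"
  have h4: "arc h4" "path_image h4 = piece4 e \<union> piece5" "pathstart h4 = pathstart g4" "pathfinish h4 = pathfinish g5"
    using arc_join[OF g4(1) g5(1)] g4 g5 I45 junction_points(4)[of e] by (auto simp: h4_def path_image_join)
  have h3: "arc h3" "path_image h3 = piece3 e \<union> (piece4 e \<union> piece5)" "pathstart h3 = pathstart g3" "pathfinish h3 = pathfinish g5"
    using arc_join[OF g3(1) h4(1)] g3 g4 h4 I3 junction_points(3)[of e] by (auto simp: h3_def path_image_join)
  have h2: "arc h2" "path_image h2 = piece2 e \<union> (piece3 e \<union> (piece4 e \<union> piece5))" "pathstart h2 = pathstart g2" "pathfinish h2 = pathfinish g5"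
    using arc_join[OF g2(1) h3(1)] g2 g3 h3 I2 junction_points(2)[of e] by (auto simp: h2_def path_image_join)
  have h1: "arc h1" "path_image h1 = piece1 e \<union> (piece2 e \<union> (piece3 e \<union> (piece4 e \<union> piece5)))" "pathstart h1 = pathstart g1" "pathfinish h1 = pathfinish g5"
    using arc_join[OF g1(1) h2(1)] g1 g2 h2 I1 junction_points(1)[of e] by (auto simp: h1_def path_image_join)
  have f: "sin (5 * pi / 8) = ca" "cos (5 * pi / 8) = - sa"
    using sin_add[of "pi/2" "pi/8"] cos_add[of "pi/2" "pi/8"] by simp_all
  show thesis
  proof
    show "arc h1" "path_image h1 = curve e" using h1 by (auto simp: curve_def inner_part_def)
    show "ray e (pathstart h1) = 0"
      unfolding h1 g1 ray_arc_point(1)[OF ee] by (simp add: ray_centres three_eighths)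
    show "ray (-1) (pathfinish h1) = 0"
      using ray_arc_point(2)[of 1 c4x "- c5r" "- c5r" "- (5 * pi / 8)"] centres_on_rays(2) unfolding h1 g5
      by (simp add: f)
    fix q assume q: "q \<in> curve e"
    have i: "q = pathstart h1" if "q \<in> inner_part e" "ray e q = 0"
      using that tube_ray_inner[OF ee, of q q] h1 g1 unfolding inner_part_def by (auto dest!: in_tube_self)
    have o: "q = pathfinish h1" if "q \<in> piece5" "ray (-1) q = 0"
      using tube_ray_outer[OF in_tube_self[OF that(1)]] that h1 g5 by simp
    have o': "ray 1 q \<noteq> 0" if "q \<in> piece5" using tube_ray_outer(1)[OF in_tube_self[OF that(1)]] by simp
    have i': "ray (- e) q \<noteq> 0" if "q \<in> inner_part e" using inner_sample(1)[OF ee that] by simp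
    show "q = pathstart h1 \<or> q = pathfinish h1" if "ray e q = 0"
      using q i o o' that e unfolding curve_def by auto
    show "q = pathfinish h1" if "ray (- e) q = 0"
      using q i' o o' that e unfolding curve_def by auto
  qed
qed

section \<open>Unfolding the wedge\<close>

text \<open>Sorting the absolute values of the coordinates is the quotient map of the dihedral group
  generated by the reflections in the coordinate axes and the diagonals, with values in an octant.
  The rotation moves the bisector of that octant to the real axis, the frame in which
  \<open>curve\<close> is given.\<close>

definition wedge_fold :: "complex \<Rightarrow> complex" where
  "wedge_fold z = cis (- (pi / 8)) * Complex (max (abs (Re z)) (abs (Im z))) (min (abs (Re z)) (abs (Im z)))"

lemma ray_rotated:
  "ray (-1) (cis (- (pi / 8)) * w) = Im w" "ray 1 (cis (- (pi / 8)) * w) = sqrt 2 / 2 * (Re w - Im w)"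
proof -
  have "ray (-1) (cis (- (pi / 8)) * w) = (sa\<^sup>2 + ca\<^sup>2) * Im w"
    unfolding ray_def times_complex.sel cis.sel cos_minus sin_minus by algebra
  then show "ray (-1) (cis (- (pi / 8)) * w) = Im w" by simp
  have "ca\<^sup>2 - sa\<^sup>2 = sqrt 2 / 2" using double_eighth by linarith
  moreover have "ray 1 (cis (- (pi / 8)) * w) = (2 * sa * ca) * Re w - (ca\<^sup>2 - sa\<^sup>2) * Im w"
    unfolding ray_def times_complex.sel cis.sel cos_minus sin_minus by algebra
  ultimately have "ray 1 (cis (- (pi / 8)) * w) = sqrt 2 / 2 * Re w - sqrt 2 / 2 * Im w"
    by (simp only: double_eighth(1))
  then show "ray 1 (cis (- (pi / 8)) * w) = sqrt 2 / 2 * (Re w - Im w)"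
    by (simp only: right_diff_distrib)
qed

lemma unrotate:
  obtains w' where "w = cis (- (pi / 8)) * w'"
proof
  show "w = cis (- (pi / 8)) * (cis (pi / 8) * w)" by (simp add: cis_mult mult.assoc [symmetric])
qed

lemma ray_wedge_fold:
  "ray (-1) (wedge_fold z) = min (abs (Re z)) (abs (Im z))"
  "ray 1 (wedge_fold z) = sqrt 2 / 2 * (max (abs (Re z)) (abs (Im z)) - min (abs (Re z)) (abs (Im z)))"
  unfolding wedge_fold_def ray_rotated by simp_all

lemma ray_wedge_fold_nonneg: "0 \<le> ray (-1) (wedge_fold z)" "0 \<le> ray 1 (wedge_fold z)"
  unfolding ray_wedge_fold by auto

lemma norm_wedge_fold: "norm (wedge_fold z) = norm z"
proof -
  have "(max (abs (Re z)) (abs (Im z)))\<^sup>2 + (min (abs (Re z)) (abs (Im z)))\<^sup>2 = (Re z)\<^sup>2 + (Im z)\<^sup>2"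
    by (simp add: max_def min_def)
  then have "norm (Complex (max (abs (Re z)) (abs (Im z))) (min (abs (Re z)) (abs (Im z)))) = norm z"
    by (simp only: cmod_def complex.sel)
  then show ?thesis by (simp only: wedge_fold_def norm_mult norm_cis mult_1)
qed

lemma continuous_wedge_fold: "continuous_on T wedge_fold"
  unfolding wedge_fold_def by (intro continuous_intros)

lemma dist_sq_inner: "(dist z y)\<^sup>2 = (norm z)\<^sup>2 + (norm y)\<^sup>2 - 2 * (Re z * Re y + Im z * Im y)"
  unfolding dist_complex_sq cmod_power2 by (simp add: power2_eq_square algebra_simps)

text \<open>The rearrangement inequality with signs. In the equality case \<open>c\<close> and
  \<open>d\<close> are determined by their sorted absolute values and the signs of \<open>a\<close>
  and \<open>b\<close>; the two side conditions cover ties, where \<open>(a, b)\<close> lies on a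
  mirror line.\<close>

lemma rearrange:
  fixes a b c d :: real
  assumes "(abs b) \<le> (abs a)"
  shows "a * c + b * d \<le> (abs a) * max (abs c) (abs d) + (abs b) * min (abs c) (abs d)" (is ?le)
    and "a * c + b * d = (abs a) * max (abs c) (abs d) + (abs b) * min (abs c) (abs d) \<Longrightarrow>
      ((abs a) = (abs b) \<Longrightarrow> (abs c) = (abs d)) \<Longrightarrow> (b = 0 \<Longrightarrow> min (abs c) (abs d) = 0) \<Longrightarrow>
      c = sgn a * max (abs c) (abs d) \<and> d = sgn b * min (abs c) (abs d)"
proof -
  define u where "u = max (abs c) (abs d)"
  define v where "v = min (abs c) (abs d)"
  have uv: "v \<le> u" "0 \<le> v" by (auto simp: u_def v_def)
  have 1: "a * c \<le> (abs a) * (abs c)" "b * d \<le> (abs b) * (abs d)" unfolding abs_mult[symmetric] by (rule abs_ge_self)+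
  have cd: "(abs c) = u \<and> (abs d) = v \<or> (abs c) = v \<and> (abs d) = u" by (auto simp: u_def v_def)
  have eq: "(abs a) * u + (abs b) * v - ((abs a) * v + (abs b) * u) = ((abs a) - (abs b)) * (u - v)" by (simp add: algebra_simps)
  have 2: "(abs a) * (abs c) + (abs b) * (abs d) \<le> (abs a) * u + (abs b) * v"
  proof -
    have "0 \<le> ((abs a) - (abs b)) * (u - v)" using assms uv by simp
    then show ?thesis using cd eq by auto
  qed
  then show ?le using 1 unfolding u_def v_def by linarith
  assume E: "a * c + b * d = (abs a) * max (abs c) (abs d) + (abs b) * min (abs c) (abs d)"
    and ab: "(abs a) = (abs b) \<Longrightarrow> (abs c) = (abs d)" and b0: "b = 0 \<Longrightarrow> min (abs c) (abs d) = 0"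
  have ac: "a * c = (abs a) * (abs c)" and bd: "b * d = (abs b) * (abs d)" and 3: "(abs a) * (abs c) + (abs b) * (abs d) = (abs a) * u + (abs b) * v"
    using E 1 2 unfolding u_def v_def by linarith+
  have cu: "(abs c) = u \<and> (abs d) = v"
  proof (cases "(abs c) = u \<and> (abs d) = v")
    case False
    then have c: "(abs c) = v" "(abs d) = u" using cd by auto
    then have "((abs a) - (abs b)) * (u - v) = 0" using 3 eq by simp
    then have "u = v" using ab c by auto
    then show ?thesis using c by simp
  qed
  have "c = sgn a * u"
  proof (cases "a = 0")
    case True
    then have "u = 0" using assms ab b0 cu unfolding v_def by auto
    then show ?thesis using cu by simp
  next
    case False
    have "a * c = abs a * u" using ac cu by simp
    then have "a * (c - sgn a * u) = 0" by (simp add: sgn_if abs_if algebra_simps split: if_splits)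
    then show ?thesis using False by simp
  qed
  moreover have "d = sgn b * v"
  proof (cases "b = 0")
    case True
    then show ?thesis using b0 cu unfolding v_def by auto
  next
    case False
    have "b * d = abs b * v" using bd cu by simp
    then have "b * (d - sgn b * v) = 0" by (simp add: sgn_if abs_if algebra_simps split: if_splits)
    then show ?thesis using False by simp
  qed
  ultimately show "c = sgn a * max (abs c) (abs d) \<and> d = sgn b * min (abs c) (abs d)" unfolding u_def v_def by (rule conjI)
qed

lemma sqrt2_half_cancel: "sqrt 2 / 2 * (x - y) = 0 \<longleftrightarrow> x = y"
  by simp

lemma max_eq_min_imp_eq: "max x y = min x y \<Longrightarrow> x = y" for x y :: real
  by linarith

lemma diff_double_cancel:
  fixes n A B :: real
  assumes "n - 2 * A = n - 2 * B" shows "A = B"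
  using assms by simp

lemma fold_inner:
  "Re (wedge_fold z) * Re (wedge_fold y) + Im (wedge_fold z) * Im (wedge_fold y) =
   max (abs (Re z)) (abs (Im z)) * max (abs (Re y)) (abs (Im y)) + min (abs (Re z)) (abs (Im z)) * min (abs (Re y)) (abs (Im y))"
proof -
  define z' where "z' = Complex (max (abs (Re z)) (abs (Im z))) (min (abs (Re z)) (abs (Im z)))"
  define y' where "y' = Complex (max (abs (Re y)) (abs (Im y))) (min (abs (Re y)) (abs (Im y)))"
  have "Re (cis t * z') * Re (cis t * y') + Im (cis t * z') * Im (cis t * y') = ((sin t)\<^sup>2 + (cos t)\<^sup>2) * (Re z' * Re y' + Im z' * Im y')" for t
    unfolding cis.sel times_complex.sel by algebra
  then have "Re (cis t * z') * Re (cis t * y') + Im (cis t * z') * Im (cis t * y') = Re z' * Re y' + Im z' * Im y'" for t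
    by (simp only: sin_cos_squared_add mult_1)
  from this[of "- (pi / 8)"] show ?thesis unfolding wedge_fold_def z'_def y'_def complex.sel .
qed

text \<open>Folding preserves norms, so only inner products have to be compared, and folding can
  only increase them.\<close>

lemma wedge_fold_lipschitz: "dist (wedge_fold z) (wedge_fold y) \<le> dist z y"
proof -
  have "Re z * Re y + Im z * Im y \<le> max (abs (Re z)) (abs (Im z)) * max (abs (Re y)) (abs (Im y)) + min (abs (Re z)) (abs (Im z)) * min (abs (Re y)) (abs (Im y))"
  proof (cases "(abs (Im z)) \<le> (abs (Re z))")
    case True
    then have "max (abs (Re z)) (abs (Im z)) = (abs (Re z))" "min (abs (Re z)) (abs (Im z)) = (abs (Im z))" by auto
    then show ?thesis using rearrange(1)[OF True, of "Re y" "Im y"] by simp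
  next
    case False
    then have "(abs (Re z)) \<le> (abs (Im z))" by simp
    moreover have "max (abs (Re z)) (abs (Im z)) = (abs (Im z))" "min (abs (Re z)) (abs (Im z)) = (abs (Re z))" using False by auto
    ultimately show ?thesis using rearrange(1)[of "Re z" "Im z" "Im y" "Re y"]
      by (simp add: max.commute min.commute add.commute)
  qed
  then have "(dist (wedge_fold z) (wedge_fold y))\<^sup>2 \<le> (dist z y)\<^sup>2"
    unfolding dist_sq_inner norm_wedge_fold fold_inner by simp
  then show ?thesis by (rule power2_le_imp_le) simp
qed

text \<open>The lift is taken in a copy of the wedge that contains \<open>z\<close>; on such a copy
  folding is an isometry.\<close>

lemma wedge_fold_lift:
  assumes "0 \<le> ray 1 w" "0 \<le> ray (-1) w"
  obtains y where "wedge_fold y = w" "dist z y = dist (wedge_fold z) w"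
proof -
  obtain w' where w: "w = cis (- (pi / 8)) * w'" by (rule unrotate)
  define u where "u = Re w'"
  define v where "v = Im w'"
  have uv: "0 \<le> v" "v \<le> u"
    using assms unfolding w ray_rotated u_def v_def by (auto simp: zero_le_mult_iff)
  have w': "w' = Complex u v" by (simp add: u_def v_def)
  \<comment> \<open>Unlike \<open>sgn\<close>, \<open>s\<close> never vanishes, so \<open>y\<close>
    still folds to \<open>w\<close> when \<open>z\<close> lies on a coordinate axis.\<close>
  define s :: "real \<Rightarrow> real" where "s x = (if 0 \<le> x then 1 else -1)" for x
  have s: "(abs (s x * r)) = (abs r)" for x r by (auto simp: s_def)
  define y where "y = (if (abs (Im z)) \<le> (abs (Re z)) then Complex (s (Re z) * u) (s (Im z) * v) else Complex (s (Re z) * v) (s (Im z) * u))"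
  have f: "wedge_fold y = w"
  proof -
    have "max (abs (Re y)) (abs (Im y)) = u" "min (abs (Re y)) (abs (Im y)) = v"
      using uv by (auto simp: y_def s)
    then show ?thesis unfolding wedge_fold_def w using w' by simp
  qed
  have m: "x * (s x * r) = (abs x) * r" for x r by (auto simp: s_def)
  have "Re z * Re y + Im z * Im y = max (abs (Re z)) (abs (Im z)) * max (abs (Re y)) (abs (Im y)) + min (abs (Re z)) (abs (Im z)) * min (abs (Re y)) (abs (Im y))"
    using uv by (cases "(abs (Im z)) \<le> (abs (Re z))") (simp_all add: y_def s m max_absorb1 max_absorb2 min_absorb1 min_absorb2)
  then have "(dist z y)\<^sup>2 = (dist (wedge_fold z) (wedge_fold y))\<^sup>2"
    unfolding dist_sq_inner norm_wedge_fold fold_inner by (simp only:)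
  then have "dist z y = dist (wedge_fold z) w" unfolding f by simp
  with f show thesis by (rule that)
qed

text \<open>Preserving the distance means equality in the rearrangement inequality, which fixes the
  signs and the order of the coordinates. The ray hypotheses exclude the ambiguity of a point on a
  mirror with a target off it, the same case that appears in \<open>critical\<close>.\<close>

lemma wedge_fold_lift_unique:
  assumes y: "wedge_fold y = q" "dist z y = dist (wedge_fold z) q"
    and y': "wedge_fold y' = q" "dist z y' = dist (wedge_fold z) q"
    and r1: "ray 1 (wedge_fold z) = 0 \<Longrightarrow> ray 1 q = 0" and r2: "ray (-1) (wedge_fold z) = 0 \<Longrightarrow> ray (-1) q = 0"
  shows "y = y'"
proof -
  define M where "M = max (abs (Re z)) (abs (Im z))"
  define m where "m = min (abs (Re z)) (abs (Im z))"
  have det: "y = (if (abs (Im z)) \<le> (abs (Re z)) then Complex (sgn (Re z) * max (abs (Re y)) (abs (Im y))) (sgn (Im z) * min (abs (Re y)) (abs (Im y)))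
     else Complex (sgn (Re z) * min (abs (Re y)) (abs (Im y))) (sgn (Im z) * max (abs (Re y)) (abs (Im y))))"
    if y: "wedge_fold y = q" "dist z y = dist (wedge_fold z) q" for y
  proof -
    have "(dist z y)\<^sup>2 = (dist (wedge_fold z) (wedge_fold y))\<^sup>2" using y by simp
    then have E: "Re z * Re y + Im z * Im y = M * max (abs (Re y)) (abs (Im y)) + m * min (abs (Re y)) (abs (Im y))"
      unfolding dist_sq_inner norm_wedge_fold fold_inner M_def m_def
      by (rule diff_double_cancel)
    have a: "abs (Re y) = abs (Im y)" if "M = m"
    proof -
      have "ray 1 (wedge_fold z) = 0" using that unfolding ray_wedge_fold M_def m_def by (rule sqrt2_half_cancel[THEN iffD2])
      then have "ray 1 (wedge_fold y) = 0" using r1 y(1) by metis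
      then show ?thesis unfolding ray_wedge_fold by (rule max_eq_min_imp_eq[OF sqrt2_half_cancel[THEN iffD1]])
    qed
    have b: "min (abs (Re y)) (abs (Im y)) = 0" if "m = 0"
      using that r2 y(1) unfolding m_def ray_wedge_fold[symmetric] by metis
    show ?thesis
    proof (cases "(abs (Im z)) \<le> (abs (Re z))")
      case True
      then have Mm: "M = (abs (Re z))" "m = (abs (Im z))" by (auto simp: M_def m_def)
      have b': "Im z = 0 \<Longrightarrow> min (abs (Re y)) (abs (Im y)) = 0" using b Mm by simp
      note * = rearrange(2)[OF True E[unfolded Mm] a[unfolded Mm] b']
      have "Re y = sgn (Re z) * max (abs (Re y)) (abs (Im y))" "Im y = sgn (Im z) * min (abs (Re y)) (abs (Im y))"
        by (rule conjunct1[OF *], assumption+, rule conjunct2[OF *], assumption+)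
      then have "y = Complex (sgn (Re z) * max (abs (Re y)) (abs (Im y))) (sgn (Im z) * min (abs (Re y)) (abs (Im y)))"
        by (metis complex.exhaust_sel)
      then show ?thesis unfolding if_P[OF True] .
    next
      case False
      then have Mm: "M = (abs (Im z))" "m = (abs (Re z))" by (auto simp: M_def m_def)
      have le: "(abs (Re z)) \<le> (abs (Im z))" using False by simp
      have E': "Im z * Im y + Re z * Re y = abs (Im z) * max (abs (Im y)) (abs (Re y)) + abs (Re z) * min (abs (Im y)) (abs (Re y))"
        using E unfolding Mm by (simp only: max.commute min.commute add.commute)
      have a': "abs (Im z) = abs (Re z) \<Longrightarrow> abs (Im y) = abs (Re y)" using a unfolding Mm by simp
      have b': "Re z = 0 \<Longrightarrow> min (abs (Im y)) (abs (Re y)) = 0" using b Mm by (simp add: min.commute)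
      note * = rearrange(2)[OF le E' a' b']
      have "Im y = sgn (Im z) * max (abs (Im y)) (abs (Re y))" "Re y = sgn (Re z) * min (abs (Im y)) (abs (Re y))"
        by (rule conjunct1[OF *], assumption+, rule conjunct2[OF *], assumption+)
      then have "y = Complex (sgn (Re z) * min (abs (Re y)) (abs (Im y))) (sgn (Im z) * max (abs (Re y)) (abs (Im y)))"
        by (metis complex.exhaust_sel max.commute min.commute)
      then show ?thesis unfolding if_not_P[OF False] .
    qed
  qed
  have "Complex (max (abs (Re y)) (abs (Im y))) (min (abs (Re y)) (abs (Im y))) = Complex (max (abs (Re y')) (abs (Im y'))) (min (abs (Re y')) (abs (Im y')))"
    using y(1) y'(1) unfolding wedge_fold_def by (metis cis_neq_zero mult_left_cancel)
  then have eq: "max (abs (Re y)) (abs (Im y)) = max (abs (Re y')) (abs (Im y'))" "min (abs (Re y)) (abs (Im y)) = min (abs (Re y')) (abs (Im y'))" by auto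
  show ?thesis by (rule trans[OF det[OF y, unfolded eq] det[OF y', symmetric]])
qed

section \<open>Surfaces of revolution\<close>

definition perp :: "'a::euclidean_space \<Rightarrow> 'a \<Rightarrow> 'a" where
  "perp b x = x - (x \<bullet> b) *\<^sub>R b"

text \<open>Cylindrical coordinates about the line spanned by \<open>b\<close>. The shift puts the
  axis of rotation at \<open>Re = -10\<close>, clear of the folded-out curve, whose points have norm
  below 8.\<close>

definition profile :: "'a::euclidean_space \<Rightarrow> 'a \<Rightarrow> complex" where
  "profile b x = Complex (norm (perp b x) - 10) (x \<bullet> b)"

lemma continuous_profile: "continuous_on T (profile b)"
  unfolding profile_def perp_def by (intro continuous_intros)

lemma perp_orthogonal: "norm b = 1 \<Longrightarrow> perp b x \<bullet> b = 0"
  by (simp add: perp_def inner_diff_left dot_square_norm)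

lemma perp_decomp: "x = perp b x + (x \<bullet> b) *\<^sub>R b"
  by (simp add: perp_def)

lemma perp_combination:
  assumes "norm b = 1" "d \<bullet> b = 0"
  shows "perp b (r *\<^sub>R d + s *\<^sub>R b) = r *\<^sub>R d" "(r *\<^sub>R d + s *\<^sub>R b) \<bullet> b = s"
  using assms by (simp_all add: perp_def inner_add_left dot_square_norm)

lemma dist_sq_perp:
  assumes "norm b = 1"
  shows "(dist x y)\<^sup>2 = (norm (perp b x - perp b y))\<^sup>2 + (x \<bullet> b - y \<bullet> b)\<^sup>2"
proof -
  have "x - y = (perp b x - perp b y) + (x \<bullet> b - y \<bullet> b) *\<^sub>R b"
    by (simp add: perp_def algebra_simps)
  moreover have "(perp b x - perp b y) \<bullet> b = 0" using perp_orthogonal[OF assms] by (simp add: inner_diff_left)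
  then have "orthogonal (perp b x - perp b y) ((x \<bullet> b - y \<bullet> b) *\<^sub>R b)" by (simp add: orthogonal_def)
  from norm_add_Pythagorean[OF this]
  have "(norm ((perp b x - perp b y) + (x \<bullet> b - y \<bullet> b) *\<^sub>R b))\<^sup>2 = (norm (perp b x - perp b y))\<^sup>2 + (x \<bullet> b - y \<bullet> b)\<^sup>2"
    using assms by simp
  ultimately show ?thesis by (simp only: dist_norm)
qed

lemma dist_sq_profile: "(dist (profile b x) (profile b y))\<^sup>2 = (norm (perp b x) - norm (perp b y))\<^sup>2 + (x \<bullet> b - y \<bullet> b)\<^sup>2"
  by (simp add: dist_complex_sq profile_def)

lemma profile_lipschitz:
  assumes "norm b = 1"
  shows "dist (profile b x) (profile b y) \<le> dist x y"
proof -
  have "(norm (perp b x) - norm (perp b y))\<^sup>2 \<le> (norm (perp b x - perp b y))\<^sup>2"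
    using norm_triangle_ineq3[of "perp b x" "perp b y"] by (simp add: abs_le_square_iff[symmetric])
  then have "(dist (profile b x) (profile b y))\<^sup>2 \<le> (dist x y)\<^sup>2"
    unfolding dist_sq_profile dist_sq_perp[OF assms] by simp
  then show ?thesis by (rule power2_le_imp_le) simp
qed

lemma unit_perp_direction:
  fixes b x :: "'a::euclidean_space"
  assumes "DIM('a) \<ge> 2" "norm b = 1"
  obtains d where "norm d = 1" "d \<bullet> b = 0" "perp b x = norm (perp b x) *\<^sub>R d"
proof (cases "perp b x = 0")
  case True
  obtain d where "d \<noteq> 0" "orthogonal b d" using vector_choose_size[of 1] orthogonal_to_vector_exists[OF assms(1), of b] by blast
  then show thesis using that[of "d /\<^sub>R norm d"] True by (simp add: orthogonal_def inner_commute)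
next
  case False
  then show thesis using that[of "perp b x /\<^sub>R norm (perp b x)"] perp_orthogonal[OF assms(2), of x] by simp
qed

text \<open>The lift stays in a meridian half-plane through \<open>x\<close>, on which the profile
  is an isometry. If \<open>x\<close> lies on the axis, any unit direction orthogonal to
  \<open>b\<close> will do.\<close>

lemma profile_lift:
  fixes b x :: "'a::euclidean_space"
  assumes "DIM('a) \<ge> 2" "norm b = 1" "- 10 \<le> Re w"
  obtains y where "profile b y = w" "dist x y = dist (profile b x) w"
proof -
  obtain d where d: "norm d = 1" "d \<bullet> b = 0" "perp b x = norm (perp b x) *\<^sub>R d"
    using unit_perp_direction[OF assms(1,2)] by blast
  define y where "y = (Re w + 10) *\<^sub>R d + Im w *\<^sub>R b"
  have y: "perp b y = (Re w + 10) *\<^sub>R d" "y \<bullet> b = Im w"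
    unfolding y_def using perp_combination[OF assms(2) d(2)] by simp_all
  have n: "norm (perp b y) = Re w + 10" using d assms(3) by (simp add: y)
  then have p: "profile b y = w" by (simp add: profile_def y complex_eq_iff)
  have "perp b x - perp b y = (norm (perp b x) - norm (perp b y)) *\<^sub>R d"
    using d(3) unfolding n by (metis y(1) scaleR_diff_left)
  then have "norm (perp b x - perp b y) = \<bar>norm (perp b x) - norm (perp b y)\<bar>" using d(1) by simp
  then have "(dist x y)\<^sup>2 = (dist (profile b x) (profile b y))\<^sup>2"
    unfolding dist_sq_profile dist_sq_perp[OF assms(2)] by simp
  then have "dist x y = dist (profile b x) w" unfolding p by simp
  with p show thesis by (rule that)
qed

text \<open>Preserving the distance forces equality in the Cauchy-Schwarz inequality, so the lift
  lies in the meridian half-plane of \<open>m\<close>, which is unique off the axis.\<close>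

lemma profile_lift_unique:
  assumes b: "norm b = 1" and m: "perp b m \<noteq> 0"
    and y: "profile b y = w" "dist m y = dist (profile b m) w"
    and y': "profile b y' = w" "dist m y' = dist (profile b m) w"
  shows "y = y'"
proof -
  have det: "perp b y = (norm (perp b y) / norm (perp b m)) *\<^sub>R perp b m"
    if y: "profile b y = w" "dist m y = dist (profile b m) w" for y
  proof -
    have "(dist m y)\<^sup>2 = (dist (profile b m) (profile b y))\<^sup>2" using y by simp
    then have "(norm (perp b m - perp b y))\<^sup>2 = (norm (perp b m) - norm (perp b y))\<^sup>2"
      unfolding dist_sq_profile dist_sq_perp[OF b] by simp
    then have "perp b m \<bullet> perp b y = norm (perp b m) * norm (perp b y)"
      by (simp add: power2_norm_eq_inner inner_diff_left inner_diff_right inner_commute power2_diff)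
    then have "norm (perp b m) *\<^sub>R perp b y = norm (perp b y) *\<^sub>R perp b m"
      by (simp add: norm_cauchy_schwarz_eq)
    then show ?thesis using m by (metis divide_inverse mult.commute real_vector_affinity_eq scaleR_scaleR norm_eq_zero
        scaleR_one left_inverse)
  qed
  have "norm (perp b y) = norm (perp b y')" "y \<bullet> b = y' \<bullet> b"
    using y(1) y'(1) by (auto simp: profile_def complex_eq_iff)
  then show ?thesis using det[OF y] det[OF y'] perp_decomp[of y b] perp_decomp[of y' b] by simp
qed

section \<open>The hypersurface and its medial axis\<close>

definition surface :: "'a::euclidean_space \<Rightarrow> real \<Rightarrow> 'a set" where
  "surface b e = {x. wedge_fold (profile b x) \<in> curve e}"

lemma surface_lipschitz:
  "norm b = 1 \<Longrightarrow> dist (wedge_fold (profile b x)) (wedge_fold (profile b y)) \<le> dist x y"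
  by (meson order_trans wedge_fold_lipschitz profile_lipschitz)

lemma surface_lift:
  fixes b x :: "'a::euclidean_space"
  assumes "DIM('a) \<ge> 2" "norm b = 1" "e = 1 \<or> e = -1" "w \<in> curve e"
  obtains y where "wedge_fold (profile b y) = w" "dist x y = dist (wedge_fold (profile b x)) w"
proof -
  obtain z where z: "wedge_fold z = w" "dist (profile b x) z = dist (wedge_fold (profile b x)) w"
    using wedge_fold_lift curve_rays[OF assms(3,4)] by blast
  have "norm z < 8" using curve_norm[OF assms(3,4)] z norm_wedge_fold by metis
  then have "- 10 \<le> Re z" using abs_Re_le_cmod[of z] by linarith
  then obtain y where "profile b y = z" "dist x y = dist (profile b x) z"
    using profile_lift[OF assms(1,2)] by blast
  then show thesis using that[of y] z by simp
qed

lemma surface_axis_dist: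
  assumes "norm b = 1" "e = 1 \<or> e = -1" "p \<in> surface b e"
  shows "2 < norm (perp b p)"
proof -
  have "norm (profile b p) < 8" using curve_norm[OF assms(2)] assms(3) norm_wedge_fold unfolding surface_def by (metis mem_Collect_eq)
  then show ?thesis using abs_Re_le_cmod[of "profile b p"] by (auto simp: profile_def)
qed

lemma compact_surface:
  assumes "norm b = 1" "e = 1 \<or> e = -1"
  shows "compact (surface b e)"
proof -
  have "surface b e = (\<lambda>x. wedge_fold (profile b x)) -` curve e" by (auto simp: surface_def)
  moreover have "continuous_on UNIV (\<lambda>x. wedge_fold (profile b x))"
    using continuous_on_compose[OF continuous_profile continuous_wedge_fold] by (simp add: o_def)
  ultimately have "closed (surface b e)"
    using compact_curve[of e] by (metis closed_vimage compact_imp_closed)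
  moreover have "bounded (surface b e)"
  proof (rule boundedI)
    fix x assume "x \<in> surface b e"
    then have "norm (profile b x) < 8" using curve_norm[OF assms(2)] norm_wedge_fold unfolding surface_def by (metis mem_Collect_eq)
    then have "norm (perp b x) - 10 < 8" "\<bar>x \<bullet> b\<bar> < 8"
      using abs_Re_le_cmod[of "profile b x"] abs_Im_le_cmod[of "profile b x"] by (auto simp: profile_def)
    moreover have "norm x \<le> norm (perp b x) + \<bar>x \<bullet> b\<bar>"
      using norm_triangle_ineq[of "perp b x" "(x \<bullet> b) *\<^sub>R b"] assms(1) perp_decomp[of x b] by simp
    ultimately show "norm x \<le> 26" by simp
  qed
  ultimately show ?thesis by (simp add: compact_eq_bounded_closed)
qed

text \<open>Lifts show that nearest points map to nearest points at the same distance, so every step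
  of the Lipschitz chain is an equality for them. Two nearest points of \<open>m\<close> with the
  same image would be two distance-preserving lifts of one point, which is impossible unless
  \<open>m\<close> is on the axis of rotation or folds to a ray that does not contain that
  image.\<close>

lemma medial_axis_critical:
  fixes b :: "'a::euclidean_space"
  assumes d: "DIM('a) \<ge> 2" and b: "norm b = 1" and e: "e = 1 \<or> e = -1"
    and m: "m \<in> medial_axis (surface b e)" and p: "p \<in> surface b e"
  shows "critical e (wedge_fold (profile b m)) \<or> 2 \<le> dist p m"
proof (cases "perp b m = 0")
  case True
  have "(norm (perp b p))\<^sup>2 \<le> (dist p m)\<^sup>2" unfolding dist_sq_perp[OF b] True by simp
  then have "norm (perp b p) \<le> dist p m" by (rule power2_le_imp_le) simp
  then show ?thesis using surface_axis_dist[OF b e p] by simp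
next
  case False
  let ?F = "\<lambda>x. wedge_fold (profile b x)"
  obtain y where y: "nearest (surface b e) m y"
    using distance_attains_inf[of "surface b e" m] compact_surface[OF b e] p unfolding nearest_def
    by (metis compact_imp_closed empty_iff)
  then obtain y' where y': "nearest (surface b e) m y'" "y' \<noteq> y"
    using m unfolding medial_axis_def nearest_def by blast
  have N: "nearest (curve e) (?F m) (?F y)" "dist m y = dist (?F m) (?F y)" if y: "nearest (surface b e) m y" for y
  proof -
    have le: "dist m y \<le> dist (?F m) w" if w: "w \<in> curve e" for w
    proof -
      obtain x where x: "?F x = w" "dist m x = dist (?F m) w" by (rule surface_lift[OF d b e w])
      then have "x \<in> surface b e" using w by (simp add: surface_def)
      then show ?thesis using y x unfolding nearest_def by auto
    qed
    have F: "?F y \<in> curve e" using y unfolding nearest_def surface_def by simp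
    have "dist (?F m) (?F y) \<le> dist m y" by (rule surface_lipschitz[OF b])
    then show "dist m y = dist (?F m) (?F y)" using le[OF F] by simp
    then show "nearest (curve e) (?F m) (?F y)" using le F unfolding nearest_def by simp
  qed
  have P: "dist m y = dist (profile b m) (profile b y) \<and> dist (profile b m) (profile b y) = dist (?F m) (?F y)"
    if y: "nearest (surface b e) m y" for y
    using N(2)[OF y] profile_lipschitz[OF b, of m y] wedge_fold_lipschitz[of "profile b m" "profile b y"] by simp
  show ?thesis
  proof (rule ccontr)
    assume "\<not> ?thesis"
    then have nc: "\<not> critical e (?F m)" by simp
    have eq: "?F y' = ?F y" using nc N(1)[OF y] N(1)[OF y'(1)] ray_wedge_fold_nonneg unfolding critical_def by blast
    have r: "ray 1 (?F m) = 0 \<Longrightarrow> ray 1 (?F y) = 0" "ray (-1) (?F m) = 0 \<Longrightarrow> ray (-1) (?F y) = 0"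
      using nc N(1)[OF y] ray_wedge_fold_nonneg unfolding critical_def by blast+
    have D: "dist (profile b m) (profile b y) = dist (?F m) (?F y)"
      "dist (profile b m) (profile b y') = dist (?F m) (?F y)"
      using P[OF y] P[OF y'(1)] eq by metis+
    have pe: "profile b y = profile b y'"
      by (rule wedge_fold_lift_unique[OF refl D(1) eq D(2) r])
    have "y = y'"
      by (rule profile_lift_unique[OF b False refl _ pe[symmetric]]) (use P[OF y] P[OF y'(1)] pe in metis)+
    then show False using y' by simp
  qed
qed

lemma surface_sampled:
  fixes b :: "'a::euclidean_space"
  assumes d: "DIM('a) \<ge> 2" and b: "norm b = 1" and e: "e = 1 \<or> e = -1" and p: "p \<in> surface b e"
  shows "\<exists>s \<in> surface b 1 \<inter> surface b (-1). medial_axis (surface b e) = {} \<or> dist p s < 18/25 * lfs (surface b e) p"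
proof -
  let ?F = "\<lambda>x. wedge_fold (profile b x)"
  obtain w l where w: "w \<in> curve 1" "w \<in> curve (-1)" "l \<le> 2" "dist (?F p) w < 18/25 * l"
    and l: "\<And>z. critical e z \<Longrightarrow> l \<le> dist (?F p) z"
    using curve_sampled[OF e, of "?F p"] p unfolding surface_def by blast
  obtain s where s: "?F s = w" "dist p s = dist (?F p) w"
    using surface_lift[OF d b _ w(1)] by blast
  have "s \<in> surface b 1 \<inter> surface b (-1)" using s w by (simp add: surface_def)
  \<comment> \<open>The distance to the empty set is 0 by the convention of \<open>infdist\<close>,
    so an empty medial axis is kept apart.\<close>
  moreover have "l \<le> lfs (surface b e) p" if "medial_axis (surface b e) \<noteq> {}"
    unfolding lfs_def infdist_def using that
  proof (simp, intro cINF_greatest)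
    fix m assume m: "m \<in> medial_axis (surface b e)"
    show "l \<le> dist p m"
      using medial_axis_critical[OF d b e m p] l[of "?F m"] surface_lipschitz[OF b, of p m] w(3) by linarith
  qed simp
  moreover have "medial_axis (surface b e) = {} \<or> dist p s < 18/25 * lfs (surface b e) p"
    using calculation(2) s(2) w(4) by fastforce
  ultimately show ?thesis by blast
qed

lemma finite_sample:
  fixes b :: "'a::euclidean_space"
  assumes d: "DIM('a) \<ge> 2" and b: "norm b = 1" and e: "e = 1 \<or> e = -1"
  obtains S where "finite S" "S \<subseteq> surface b 1 \<inter> surface b (-1)"
    "\<And>p. p \<in> surface b e \<Longrightarrow> \<exists>s\<in>S. medial_axis (surface b e) = {} \<or> dist p s < 18/25 * lfs (surface b e) p"
proof -
  define U where "U s = {p. medial_axis (surface b e) = {} \<or> dist p s < 18/25 * lfs (surface b e) p}" for s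
  have "open (U s)" for s
  proof (cases "medial_axis (surface b e) = {}")
    case False
    then have "U s = {p. dist p s < 18/25 * lfs (surface b e) p}" by (simp add: U_def)
    moreover have "open \<dots>" unfolding lfs_def by (intro open_Collect_less continuous_intros)
    ultimately show ?thesis by simp
  qed (simp add: U_def)
  moreover have "surface b e \<subseteq> (\<Union>s \<in> surface b 1 \<inter> surface b (-1). U s)"
    using surface_sampled[OF d b e] unfolding U_def by blast
  ultimately obtain S where "S \<subseteq> surface b 1 \<inter> surface b (-1)" "finite S" "surface b e \<subseteq> (\<Union>s\<in>S. U s)"
    by (rule compactE_image[OF compact_surface[OF b e]])
  then show thesis using that[of S] unfolding U_def by blast
qed

section \<open>The unfolded curve as a one-dimensional manifold\<close>

text \<open>By finiteness the union of the other pieces is closed, so each piece is relatively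
  clopen and no larger connected subset contains it.\<close>

lemma components_eq_finite_compact_partition:
  fixes C :: "'a::t2_space set"
  assumes fin: "finite \<K>" and K: "\<And>K. K \<in> \<K> \<Longrightarrow> compact K \<and> connected K \<and> K \<noteq> {}"
    and dis: "\<And>K L. K \<in> \<K> \<Longrightarrow> L \<in> \<K> \<Longrightarrow> K \<noteq> L \<Longrightarrow> K \<inter> L = {}" and C: "C = \<Union>\<K>"
  shows "components C = \<K>"
proof -
  have in_comp: "K \<in> components C" if "K \<in> \<K>" for K
    unfolding in_components_maximal
  proof (intro conjI allI impI)
    show "K \<noteq> {}" "connected K" "K \<subseteq> C" using K[OF that] that C by auto
    fix D assume D: "D \<noteq> {} \<and> K \<subseteq> D \<and> D \<subseteq> C \<and> connected D"
    let ?R = "\<Union>(\<K> - {K})"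
    have "closed K" "closed ?R" using K that fin by (auto intro!: compact_imp_closed closed_Union)
    moreover have "D \<subseteq> K \<union> ?R" "K \<inter> ?R \<inter> D = {}" "K \<inter> D \<noteq> {}"
      using D C dis[OF that] K[OF that] by auto
    moreover have "connected D" using D by simp
    ultimately have "?R \<inter> D = {}" unfolding connected_closed by blast
    then show "D = K" using D C by blast
  qed
  moreover have "D \<in> \<K>" if D: "D \<in> components C" for D
  proof -
    obtain x where x: "x \<in> D" "x \<in> C" using D in_components_nonempty in_components_subset by blast
    then obtain K where "K \<in> \<K>" "x \<in> K" using C by blast
    then have "D = K" using components_eq[OF D in_comp] x by blast
    then show ?thesis using \<open>K \<in> \<K>\<close> by simp
  qed
  ultimately show ?thesis by blast
qed

text \<open>The fold without the final rotation. In this frame the mirrors are coordinate axes and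
  diagonals, and the symmetries are simply \<open>cnj\<close>, \<open>swap\<close> and
  multiplication by the imaginary unit.\<close>

definition octant :: "complex \<Rightarrow> complex" where
  "octant z = Complex (max (abs (Re z)) (abs (Im z))) (min (abs (Re z)) (abs (Im z)))"

lemma continuous_octant: "continuous_on T octant"
  unfolding octant_def by (intro continuous_intros)

lemma octant_id: "0 \<le> Im z \<Longrightarrow> Im z \<le> Re z \<Longrightarrow> octant z = z"
  by (simp add: octant_def complex_eq_iff max_def min_def)

definition swap :: "complex \<Rightarrow> complex" where "swap z = Complex (Im z) (Re z)"

lemma swap_sel [simp]: "Re (swap z) = Im z" "Im (swap z) = Re z"
  by (simp_all add: swap_def)

lemma continuous_swap: "continuous_on T swap"
  unfolding swap_def by (intro continuous_intros)

lemma octant_swap: "octant (swap z) = octant z" and octant_cnj: "octant (cnj z) = octant z"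
  and octant_i: "octant (\<i> * z) = octant z"
  by (simp_all add: octant_def max.commute min.commute)

definition plane_set :: "real \<Rightarrow> complex set" where
  "plane_set e = {z. wedge_fold z \<in> curve e}"

text \<open>The arcs of \<open>curve\<close> moved from the axis frame back to the octant \<open>0 \<le> Im z \<le> Re z\<close>.\<close>

lemma octant_arc:
  assumes e: "e = 1 \<or> e = -1"
  obtains g where "arc g" "plane_set e = {z. octant z \<in> path_image g}"
    "\<And>w. w \<in> path_image g \<Longrightarrow> 0 \<le> Im w \<and> Im w \<le> Re w \<and> 0 < Re w"
    "\<And>t. 0 < t \<Longrightarrow> t < 1 \<Longrightarrow> 0 < Im (g t) \<and> Im (g t) < Re (g t)"
    "Im (g 1) = 0" "e = 1 \<Longrightarrow> Re (g 0) = Im (g 0)" "e = -1 \<Longrightarrow> Im (g 0) = 0"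
proof -
  obtain g where g: "arc g" "path_image g = curve e"
    "\<And>q. q \<in> curve e \<Longrightarrow> ray e q = 0 \<Longrightarrow> q = pathstart g \<or> q = pathfinish g"
    "\<And>q. q \<in> curve e \<Longrightarrow> ray (- e) q = 0 \<Longrightarrow> q = pathfinish g"
    "ray e (pathstart g) = 0" "ray (-1) (pathfinish g) = 0"
    using curve_arc[OF e] by blast
  define h where "h t = cis (pi / 8) * g t" for t
  have gh: "g t = cis (- (pi / 8)) * h t" for t by (simp add: h_def cis_mult mult.assoc[symmetric])
  have rays: "ray (-1) (g t) = Im (h t)" "ray 1 (g t) = sqrt 2 / 2 * (Re (h t) - Im (h t))" for t
    unfolding gh ray_rotated by simp_all
  have mem: "g t \<in> curve e" if "0 \<le> t" "t \<le> 1" for t using that g(2) by (auto simp: path_image_def)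
  have arc: "arc h"
    using g(1) unfolding arc_def path_def h_def by (auto intro!: continuous_intros simp: inj_on_def)
  have im: "path_image h = (\<lambda>w. cis (pi / 8) * w) ` curve e"
    unfolding g(2)[symmetric] path_image_def h_def by auto
  have pos: "0 \<le> Im (h t) \<and> Im (h t) \<le> Re (h t) \<and> 0 < Re (h t)" if "0 \<le> t" "t \<le> 1" for t
    using curve_rays[OF e mem[OF that]] unfolding rays by (auto simp: zero_le_mult_iff zero_less_mult_iff)
  have inj: "g t = g s \<Longrightarrow> t = s" if "0 \<le> t" "t \<le> 1" "0 \<le> s" "s \<le> 1" for s t
    using g(1) that unfolding arc_def inj_on_def by auto
  show thesis
  proof
    show "arc h" by (rule arc)
    show "plane_set e = {z. octant z \<in> path_image h}"
    proof -
      have "wedge_fold z \<in> curve e \<longleftrightarrow> octant z \<in> path_image h" for z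
      proof
        have *: "octant z = cis (pi / 8) * wedge_fold z"
          by (simp add: octant_def wedge_fold_def cis_mult mult.assoc[symmetric])
        show "wedge_fold z \<in> curve e \<Longrightarrow> octant z \<in> path_image h" unfolding im * by blast
        assume "octant z \<in> path_image h"
        then obtain w where "w \<in> curve e" "cis (pi / 8) * w = cis (pi / 8) * wedge_fold z" unfolding im * by auto
        then show "wedge_fold z \<in> curve e" by simp
      qed
      then show ?thesis by (simp add: plane_set_def)
    qed
    show "0 \<le> Im w \<and> Im w \<le> Re w \<and> 0 < Re w" if "w \<in> path_image h" for w
      using that pos unfolding path_image_def by auto
    show "Im (h 1) = 0" using g(6) rays(1)[of 1] by (simp add: pathfinish_def)
    show "e = 1 \<Longrightarrow> Re (h 0) = Im (h 0)" using g(5) rays(2)[of 0] by (simp add: pathstart_def)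
    show "e = -1 \<Longrightarrow> Im (h 0) = 0" using g(5) rays(1)[of 0] by (simp add: pathstart_def)
    show "0 < Im (h t) \<and> Im (h t) < Re (h t)" if t: "0 < t" "t < 1" for t
    proof -
      have "g t \<noteq> pathstart g" "g t \<noteq> pathfinish g"
        using inj[of t 0] inj[of t 1] t by (auto simp: pathstart_def pathfinish_def)
      then have "ray e (g t) \<noteq> 0" "ray (- e) (g t) \<noteq> 0" using g(3,4) mem[of t] t by auto
      then have "ray 1 (g t) \<noteq> 0" "ray (-1) (g t) \<noteq> 0" using e by auto
      then show ?thesis using pos[of t] t unfolding rays by auto
    qed
  qed
qed

lemma homeomorphic_compact_image:
  fixes f :: "real \<Rightarrow> complex"
  assumes "continuous_on {l..u} f" "inj_on f {l..u}"
  shows "f ` {l<..<u} homeomorphic {l<..<u}"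
proof -
  obtain g where "homeomorphism {l..u} (f ` {l..u}) f g"
    using homeomorphism_compact[OF compact_Icc assms(1) refl assms(2)] by blast
  then have "homeomorphism {l<..<u} (f ` {l<..<u}) f g"
    by (rule homeomorphism_of_subsets) auto
  then show ?thesis unfolding homeomorphic_def using homeomorphism_sym by blast
qed

text \<open>Doubling an arc by the reflection \<open>R\<close> that fixes its starting point gives a chart there.\<close>

lemma reflected_arc_chart:
  fixes g :: "real \<Rightarrow> complex"
  assumes arc: "arc g" and F: "continuous_on UNIV F" and R: "continuous_on UNIV R" and V: "open V"
    and VF: "\<And>z. z \<in> V \<Longrightarrow> z = F z \<or> z = R (F z)"
    and gV: "\<And>t. 0 \<le> t \<Longrightarrow> t \<le> 1/2 \<Longrightarrow> g t \<in> V \<and> R (g t) \<in> V \<and> F (g t) = g t \<and> F (R (g t)) = g t"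
    and R0: "R (g 0) = g 0" and Rt: "\<And>t. 0 < t \<Longrightarrow> t \<le> 1/2 \<Longrightarrow> R (g t) \<noteq> g t"
  shows "\<exists>U I. openin (top_of_set {z. F z \<in> path_image g}) U \<and> g 0 \<in> U \<and> open (I::real set) \<and> U homeomorphic I"
proof -
  define h where "h t = (if 0 \<le> t then g t else R (g (- t)))" for t
  have cg: "continuous_on {0..1} g" and ig: "inj_on g {0..1}" using arc by (auto simp: arc_def path_def)
  have FR: "F (h t) = g \<bar>t\<bar>" if "\<bar>t\<bar> \<le> 1/2" for t
    using gV[of "\<bar>t\<bar>"] that by (auto simp: h_def abs_if)
  have cont: "continuous_on {-1/2..1/2} h"
  proof -
    have "{-1/2..1/2::real} = {0..1/2} \<union> {-1/2..0}" by auto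
    moreover have "continuous_on ({0..1/2} \<union> {-1/2..0::real}) (\<lambda>t. if 0 \<le> t then g t else R (g (- t)))"
    proof (rule continuous_on_cases)
      show "continuous_on {0..1/2} g" by (rule continuous_on_subset[OF cg]) auto
      have "continuous_on {-1/2..0::real} (\<lambda>t. g (- t))"
        by (rule continuous_on_compose2[OF cg]) (auto intro!: continuous_intros)
      then show "continuous_on {-1/2..0} (\<lambda>t. R (g (- t)))"
        by (rule continuous_on_compose2[OF R]) auto
      show "\<forall>t. t \<in> {0..1/2} \<and> \<not> 0 \<le> t \<or> t \<in> {-1/2..0} \<and> 0 \<le> t \<longrightarrow> g t = R (g (- t))"
        using R0 by auto
    qed auto
    ultimately show ?thesis unfolding h_def by simp
  qed
  have inj: "inj_on h {-1/2..1/2}"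
  proof (rule inj_onI)
    fix s t assume st: "s \<in> {-1/2..1/2}" "t \<in> {-1/2..1/2}" "h s = h t"
    then have "g \<bar>s\<bar> = g \<bar>t\<bar>" using FR[of s] FR[of t] by auto
    then have a: "\<bar>s\<bar> = \<bar>t\<bar>" using ig st unfolding inj_on_def by auto
    show "s = t"
    proof (rule ccontr)
      assume "s \<noteq> t"
      then have "(0 < s \<and> t = - s) \<or> (0 < t \<and> s = - t)" using a by auto
      then show False using st Rt[of s] Rt[of t] by (auto simp: h_def)
    qed
  qed
  \<comment> \<open>\<open>V\<close> discards the other copies of the arc. Removing what folds to
    the far half keeps the other end of the arc out, where it may meet another mirror; what is left
    is the doubled near half.\<close>
  define U where "U = {z. F z \<in> path_image g} \<inter> (V \<inter> F -` (- g ` {1/2..1}))"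
  have "compact (g ` {1/2..1})"
    by (intro compact_continuous_image continuous_on_subset[OF cg]) auto
  then have "open (F -` (- g ` {1/2..1}))"
    using F by (intro open_vimage) (auto simp: compact_imp_closed)
  then have "openin (top_of_set {z. F z \<in> path_image g}) U"
    unfolding U_def using V by (intro openin_open_Int) auto
  moreover have U: "U = h ` {-1/2<..<1/2}"
  proof
    show "U \<subseteq> h ` {-1/2<..<1/2}"
    proof
      fix z assume z: "z \<in> U"
      then obtain t where t: "0 \<le> t" "t \<le> 1" "F z = g t" unfolding U_def path_image_def by auto
      then have "t < 1/2" using z unfolding U_def by force
      have "z = g t \<or> z = R (g t)" using VF[of z] z t unfolding U_def by auto
      then have "z = h t \<or> z = h (- t)" using t R0 by (cases "t = 0") (auto simp: h_def)
      then show "z \<in> h ` {-1/2<..<1/2}" using t \<open>t < 1/2\<close> by auto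
    qed
    show "h ` {-1/2<..<1/2} \<subseteq> U"
    proof
      fix z assume "z \<in> h ` {-1/2<..<1/2}"
      then obtain t where t: "- 1/2 < t" "t < 1/2" and z: "z = h t" by auto
      have F: "F z = g \<bar>t\<bar>" unfolding z using t by (intro FR) auto
      then have "F z \<notin> g ` {1/2..1}" using t ig unfolding inj_on_def by force
      moreover have "F z \<in> path_image g" unfolding F path_image_def using t by auto
      moreover have "z \<in> V" using gV[of "\<bar>t\<bar>"] t unfolding z h_def by (auto simp: abs_if split: if_splits)
      ultimately show "z \<in> U" unfolding U_def by auto
    qed
  qed
  moreover have "g 0 \<in> U" unfolding U by (rule image_eqI[of _ _ 0]) (auto simp: h_def)
  moreover have "U homeomorphic {-1/2<..<1/2::real}" unfolding U by (rule homeomorphic_compact_image[OF cont inj])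
  ultimately show ?thesis by (intro exI[of _ U] exI[of _ "{-1/2<..<1/2::real}"]) auto
qed

text \<open>A chart is built only at the folded point: the open arc itself when the point is
  interior, the arc doubled by \<open>swap\<close> when it starts on the diagonal, and doubled by
  \<open>cnj\<close> at an end on the real axis. The end point is reduced to a starting point by
  reversing the path.\<close>

lemma plane_chart_octant:
  assumes e: "e = 1 \<or> e = -1" and z: "z \<in> plane_set e"
  shows "\<exists>U I. openin (top_of_set (plane_set e)) U \<and> octant z \<in> U \<and> open (I::real set) \<and> U homeomorphic I"
proof -
  obtain g where g: "arc g" "plane_set e = {z. octant z \<in> path_image g}"
    and pos: "\<And>w. w \<in> path_image g \<Longrightarrow> 0 \<le> Im w \<and> Im w \<le> Re w \<and> 0 < Re w"
    and int: "\<And>t. 0 < t \<Longrightarrow> t < 1 \<Longrightarrow> 0 < Im (g t) \<and> Im (g t) < Re (g t)"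
    and ends: "Im (g 1) = 0" "e = 1 \<Longrightarrow> Re (g 0) = Im (g 0)" "e = -1 \<Longrightarrow> Im (g 0) = 0"
    using octant_arc[OF e] by blast
  have gpos: "0 \<le> Im (g t) \<and> Im (g t) \<le> Re (g t) \<and> 0 < Re (g t)" if "0 \<le> t" "t \<le> 1" for t
    using pos that by (auto simp: path_image_def)
  obtain t where t: "0 \<le> t" "t \<le> 1" "octant z = g t" using z g(2) by (auto simp: path_image_def)
  define V where "V = {z. Im z < Re z \<and> - Re z < Im z}"
  have "V = {z. Im z < Re z} \<inter> {z. - Re z < Im z}" by (auto simp: V_def)
  moreover have "open {z. Im z < Re z}" "open {z. - Re z < Im z}" by (intro open_Collect_less continuous_intros)+
  ultimately have V: "open V" by auto
  have VF: "z = octant z \<or> z = cnj (octant z)" if "z \<in> V" for z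
  proof (cases "0 \<le> Im z")
    case True
    then show ?thesis using that octant_id[of z] by (simp add: V_def)
  next
    case False
    then have "octant (cnj z) = cnj z" using that by (intro octant_id) (auto simp: V_def)
    then show ?thesis by (metis octant_cnj complex_cnj_cnj)
  qed
  consider "0 < t" "t < 1" | "t = 0" "e = 1" | "t = 0" "e = -1" | "t = 1" using t e by fastforce
  then show ?thesis
  proof cases
    case 1
    define O' where "O' = {z. 0 < Im z} \<inter> {z. Im z < Re z}"
    have "open O'" unfolding O'_def by (intro open_Int open_Collect_less continuous_intros)
    then have "openin (top_of_set (plane_set e)) (plane_set e \<inter> O')" by (rule openin_open_Int)
    moreover have eq: "plane_set e \<inter> O' = g ` {0<..<1}"
    proof
      show "g ` {0<..<1} \<subseteq> plane_set e \<inter> O'"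
        using int octant_id unfolding g(2) O'_def path_image_def by fastforce
      show "plane_set e \<inter> O' \<subseteq> g ` {0<..<1}"
      proof
        fix z assume "z \<in> plane_set e \<inter> O'"
        then have z: "octant z \<in> path_image g" "0 < Im z" "Im z < Re z" by (auto simp: g(2) O'_def)
        then obtain s where s: "0 \<le> s" "s \<le> 1" "z = g s" using octant_id[of z] by (auto simp: path_image_def)
        moreover have "s \<noteq> 0" "s \<noteq> 1" using z s ends e by auto
        ultimately show "z \<in> g ` {0<..<1}" by auto
      qed
    qed
    moreover have "g ` {0<..<1} homeomorphic {0<..<1::real}"
      using g(1) unfolding arc_def path_def by (intro homeomorphic_compact_image) auto
    ultimately show ?thesis using 1 t by (intro exI[of _ "g ` {0<..<1}"] exI[of _ "{0<..<1::real}"]) auto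
  next
    case 2
    define Q where "Q = {z. 0 < Re z} \<inter> {z. 0 < Im z}"
    have Q: "open Q" unfolding Q_def by (intro open_Int open_Collect_less continuous_intros)
    have "\<exists>U I. openin (top_of_set {z. octant z \<in> path_image g}) U \<and> g 0 \<in> U \<and> open (I::real set) \<and> U homeomorphic I"
    proof (rule reflected_arc_chart[OF g(1) continuous_octant continuous_swap Q])
      show "z = octant z \<or> z = swap (octant z)" if "z \<in> Q" for z
      proof (cases "Im z \<le> Re z")
        case True
        then show ?thesis using that octant_id[of z] by (simp add: Q_def)
      next
        case False
        then have "octant (swap z) = swap z" using that by (intro octant_id) (auto simp: Q_def)
        then show ?thesis by (simp add: octant_swap) (simp add: swap_def)
      qed
      show "g t \<in> Q \<and> swap (g t) \<in> Q \<and> octant (g t) = g t \<and> octant (swap (g t)) = g t" if "0 \<le> t" "t \<le> 1/2" for t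
        using that gpos[of t] int[of t] ends(2) \<open>e = 1\<close> octant_id[of "g t"]
        by (cases "t = 0") (auto simp: Q_def octant_swap)
      show "swap (g 0) = g 0" using ends(2) \<open>e = 1\<close> by (simp add: complex_eq_iff)
      show "swap (g t) \<noteq> g t" if "0 < t" "t \<le> 1/2" for t using int[of t] that by (auto simp: complex_eq_iff)
    qed
    then show ?thesis using 2 t unfolding g(2) by simp
  next
    case 3
    have "\<exists>U I. openin (top_of_set {z. octant z \<in> path_image g}) U \<and> g 0 \<in> U \<and> open (I::real set) \<and> U homeomorphic I"
    proof (rule reflected_arc_chart[OF g(1) continuous_octant _ V VF])
      show "continuous_on UNIV cnj" by (intro continuous_intros)
      show "g t \<in> V \<and> cnj (g t) \<in> V \<and> octant (g t) = g t \<and> octant (cnj (g t)) = g t" if "0 \<le> t" "t \<le> 1/2" for t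
        using that gpos[of t] int[of t] ends(3) \<open>e = -1\<close> octant_id[of "g t"]
        by (cases "t = 0") (auto simp: V_def octant_cnj)
      show "cnj (g 0) = g 0" using ends(3) \<open>e = -1\<close> by (simp add: complex_eq_iff)
      show "cnj (g t) \<noteq> g t" if "0 < t" "t \<le> 1/2" for t using int[of t] that by (auto simp: complex_eq_iff)
    qed
    then show ?thesis using 3 t unfolding g(2) by simp
  next
    case 4
    let ?g = "reversepath g"
    have "\<exists>U I. openin (top_of_set {z. octant z \<in> path_image ?g}) U \<and> ?g 0 \<in> U \<and> open (I::real set) \<and> U homeomorphic I"
    proof (rule reflected_arc_chart[OF _ continuous_octant _ V VF])
      show "arc ?g" using g(1) by (rule arc_reversepath)
      show "continuous_on UNIV cnj" by (intro continuous_intros)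
      show "?g t \<in> V \<and> cnj (?g t) \<in> V \<and> octant (?g t) = ?g t \<and> octant (cnj (?g t)) = ?g t" if "0 \<le> t" "t \<le> 1/2" for t
        using that gpos[of "1 - t"] int[of "1 - t"] ends(1) octant_id[of "g (1 - t)"]
        by (cases "t = 0") (auto simp: V_def octant_cnj reversepath_def)
      show "cnj (?g 0) = ?g 0" using ends(1) by (simp add: complex_eq_iff reversepath_def)
      show "cnj (?g t) \<noteq> ?g t" if "0 < t" "t \<le> 1/2" for t
        using int[of "1 - t"] that by (auto simp: complex_eq_iff reversepath_def)
    qed
    moreover have "?g 0 = octant z" using 4 t by (simp add: reversepath_def)
    ultimately show ?thesis unfolding g(2) by (simp only: path_image_reversepath)
  qed
qed

text \<open>The eight elements of the dihedral group, written as a rotation by a multiple of a right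
  angle, possibly preceded by conjugation.\<close>

lemma octant_cases: "\<exists>k<4. z = \<i> ^ k * octant z \<or> z = \<i> ^ k * cnj (octant z)"
proof -
  define a where "a = Re z"
  define b where "b = Im z"
  have z: "z = Complex a b" by (simp add: a_def b_def)
  have p: "\<i> ^ 0 = 1" "\<i> ^ 1 = \<i>" "\<i> ^ 2 = -1" "\<i> ^ 3 = - \<i>" by (simp_all add: power3_eq_cube)
  have o: "octant z = (if abs b \<le> abs a then Complex (abs a) (abs b) else Complex (abs b) (abs a))"
    by (simp add: z octant_def max_def min_def)
  have "(\<exists>k\<in>{0,1,2,3::nat}. z = \<i> ^ k * octant z \<or> z = \<i> ^ k * cnj (octant z))"
    unfolding o unfolding z
    by (cases "0 \<le> a"; cases "0 \<le> b"; cases "abs b \<le> abs a") (simp_all add: complex_eq_iff p)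
  then obtain k where "k \<in> {0,1,2,3::nat}" "z = \<i> ^ k * octant z \<or> z = \<i> ^ k * cnj (octant z)" by blast
  moreover have "k < 4" using calculation(1) by auto
  ultimately show ?thesis by blast
qed

lemma octant_i_power: "octant (\<i> ^ k * z) = octant z"
  by (induction k) (simp_all add: octant_i mult.assoc)

text \<open>A symmetry of the plane set carries the folded point to \<open>z\<close>, and the chart
  with it.\<close>

lemma plane_chart:
  assumes e: "e = 1 \<or> e = -1" and z: "z \<in> plane_set e"
  shows "\<exists>U I. openin (top_of_set (plane_set e)) U \<and> z \<in> U \<and> open (I::real set) \<and> U homeomorphic I"
proof -
  obtain g where g: "plane_set e = {z. octant z \<in> path_image g}" using octant_arc[OF e] by metis
  obtain U and I :: "real set" where U: "openin (top_of_set (plane_set e)) U" "octant z \<in> U" "open I" "U homeomorphic I"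
    using plane_chart_octant[OF e z] by blast
  obtain k where k: "z = \<i> ^ k * octant z \<or> z = \<i> ^ k * cnj (octant z)" using octant_cases by blast
  obtain h h' where h: "continuous_on UNIV h" "continuous_on UNIV h'" "\<And>x. h' (h x) = x" "\<And>x. h (h' x) = x"
    "\<And>x. octant (h x) = octant x" "h (octant z) = z"
  proof -
    define m where "m = \<i> ^ k"
    have m: "m \<noteq> 0" by (simp add: m_def)
    show thesis
    proof (cases "z = m * octant z")
      case True
      show thesis
        by (rule that[of "\<lambda>x. m * x" "\<lambda>x. x / m"])
          (use True m in \<open>auto intro!: continuous_intros simp: m_def octant_i_power\<close>)
    next
      case False
      then have *: "z = m * cnj (octant z)" using k by (simp add: m_def)
      show thesis
        by (rule that[of "\<lambda>x. m * cnj x" "\<lambda>x. cnj (x / m)"])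
          (use *[symmetric] m in \<open>auto intro!: continuous_intros simp: m_def octant_i_power octant_cnj\<close>)
    qed
  qed
  have hp: "h ` plane_set e = plane_set e"
  proof
    show "h ` plane_set e \<subseteq> plane_set e" using h(5) by (auto simp: g)
    show "plane_set e \<subseteq> h ` plane_set e"
    proof
      fix x assume "x \<in> plane_set e"
      then have "h' x \<in> plane_set e" using h(5)[of "h' x"] h(4)[of x] by (simp add: g)
      then show "x \<in> h ` plane_set e" using h(4)[of x] by (metis imageI)
    qed
  qed
  have "range h = UNIV" "range h' = UNIV" using surjI[of h h', OF h(4)] surjI[of h' h, OF h(3)] .
  then have hom': "homeomorphism UNIV UNIV h h'"
    unfolding homeomorphism_def using h(1-4) by blast
  have hom: "homeomorphism (plane_set e) (plane_set e) h h'"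
    by (rule homeomorphism_of_subsets[OF hom' subset_UNIV subset_UNIV hp])
  have "openin (top_of_set (plane_set e)) (h ` U)" by (rule homeomorphism_imp_open_map[OF hom U(1)])
  moreover have "z \<in> h ` U" using U(2) h(6) by force
  moreover have "h ` U homeomorphic I"
  proof -
    have "homeomorphism U (h ` U) h h'"
      by (rule homeomorphism_of_subsets[OF hom' subset_UNIV subset_UNIV refl])
    then have "U homeomorphic h ` U" unfolding homeomorphic_def by blast
    then show ?thesis using U(4) homeomorphic_sym homeomorphic_trans by blast
  qed
  ultimately show ?thesis using U(3) by blast
qed

text \<open>\<open>P\<close> is the arc together with its mirror image in the real axis; its four
  rotated copies make up the set. For \<open>e = 1\<close> the arc starts on the diagonal, where
  \<open>g 0 = \<i> * cnj (g 0)\<close>, so consecutive copies touch. For \<open>e = -1\<close> it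
  stays strictly inside a quarter sector.\<close>

lemma plane_pieces:
  assumes e: "e = 1 \<or> e = -1"
  obtains P where "compact P" "connected P" "P \<noteq> {}" "plane_set e = (\<Union>k<4. (\<lambda>z. \<i> ^ k * z) ` P)"
    "e = 1 \<Longrightarrow> \<exists>p\<in>P. p \<in> (\<lambda>z. \<i> * z) ` P" "e = -1 \<Longrightarrow> P \<subseteq> {z. abs (Im z) < Re z}"
proof -
  obtain g where g: "arc g" "plane_set e = {z. octant z \<in> path_image g}"
    and pos: "\<And>w. w \<in> path_image g \<Longrightarrow> 0 \<le> Im w \<and> Im w \<le> Re w \<and> 0 < Re w"
    and int: "\<And>t. 0 < t \<Longrightarrow> t < 1 \<Longrightarrow> 0 < Im (g t) \<and> Im (g t) < Re (g t)"
    and ends: "Im (g 1) = 0" "e = 1 \<Longrightarrow> Re (g 0) = Im (g 0)" "e = -1 \<Longrightarrow> Im (g 0) = 0"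
    using octant_arc[OF e] by blast
  have path: "path g" using g(1) by (simp add: arc_def)
  have ccnj: "continuous_on T cnj" for T by (intro continuous_intros)
  define P where "P = path_image g \<union> cnj ` path_image g"
  show thesis
  proof
    show "compact P" unfolding P_def
      using compact_path_image[OF path] by (intro compact_Un compact_continuous_image ccnj)
    have "g 1 \<in> path_image g" by (auto simp: path_image_def)
    moreover have "g 1 \<in> cnj ` path_image g"
      using ends(1) calculation by (intro image_eqI[of _ _ "g 1"]) (auto simp: complex_eq_iff)
    ultimately show "connected P" unfolding P_def
      using connected_path_image[OF path] by (intro connected_Un connected_continuous_image ccnj) auto
    show "P \<noteq> {}" unfolding P_def by (auto simp: path_image_def)
    show "plane_set e = (\<Union>k<4. (\<lambda>z. \<i> ^ k * z) ` P)"
    proof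
      show "plane_set e \<subseteq> (\<Union>k<4. (\<lambda>z. \<i> ^ k * z) ` P)"
      proof
        fix z assume z: "z \<in> plane_set e"
        obtain k where "k < 4" "z = \<i> ^ k * octant z \<or> z = \<i> ^ k * cnj (octant z)" using octant_cases by blast
        moreover have "octant z \<in> P" "cnj (octant z) \<in> P" using z by (auto simp: g(2) P_def)
        ultimately show "z \<in> (\<Union>k<4. (\<lambda>z. \<i> ^ k * z) ` P)" by auto
      qed
      have "octant w = w" "octant (cnj w) = w" if "w \<in> path_image g" for w
        using pos[OF that] octant_id[of w] by (auto simp: octant_cnj)
      then show "(\<Union>k<4. (\<lambda>z. \<i> ^ k * z) ` P) \<subseteq> plane_set e"
        by (auto simp: g(2) P_def octant_i_power)
    qed
    show "\<exists>p\<in>P. p \<in> (\<lambda>z. \<i> * z) ` P" if "e = 1"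
    proof -
      have "g 0 \<in> path_image g" by (auto simp: path_image_def)
      then have "g 0 \<in> P" "cnj (g 0) \<in> P" unfolding P_def by auto
      moreover have "g 0 = \<i> * cnj (g 0)" using ends(2)[OF that] by (simp add: complex_eq_iff)
      ultimately show ?thesis by blast
    qed
    show "P \<subseteq> {z. abs (Im z) < Re z}" if "e = -1"
    proof -
      have "abs (Im (g t)) < Re (g t)" if "0 \<le> t" "t \<le> 1" for t
      proof -
        have "g t \<in> path_image g" using that by (auto simp: path_image_def)
        then show ?thesis using that pos[of "g t"] int[of t] ends(1) ends(3)[OF \<open>e = -1\<close>]
          by (cases "t = 0 \<or> t = 1") auto
      qed
      then show ?thesis unfolding P_def path_image_def by auto
    qed
  qed
qed

lemma plane_partition:
  assumes e: "e = 1 \<or> e = -1"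
  obtains \<K> where "finite \<K>" "card \<K> = (if e = 1 then 1 else 4)" "plane_set e = \<Union>\<K>"
    "\<And>K. K \<in> \<K> \<Longrightarrow> compact K \<and> connected K \<and> K \<noteq> {}"
    "\<And>K L. K \<in> \<K> \<Longrightarrow> L \<in> \<K> \<Longrightarrow> K \<noteq> L \<Longrightarrow> K \<inter> L = {}"
proof -
  obtain P where P: "compact P" "connected P" "P \<noteq> {}" "plane_set e = (\<Union>k<4. (\<lambda>z. \<i> ^ k * z) ` P)"
    "e = 1 \<Longrightarrow> \<exists>p\<in>P. p \<in> (\<lambda>z. \<i> * z) ` P" "e = -1 \<Longrightarrow> P \<subseteq> {z. abs (Im z) < Re z}"
    using plane_pieces[OF e] by blast
  define Q where "Q k = (\<lambda>z. \<i> ^ k * z) ` P" for k :: nat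
  have Q: "compact (Q k)" "connected (Q k)" "Q k \<noteq> {}" for k
    unfolding Q_def using P by (auto intro!: compact_continuous_image connected_continuous_image continuous_intros)
  have four: "{..<4::nat} = {0,1,2,3}" by auto
  have plane: "plane_set e = Q 0 \<union> Q 1 \<union> Q 2 \<union> Q 3" unfolding P(4) Q_def four by auto
  show thesis
  proof (cases "e = 1")
    case True
    then obtain p where p: "p \<in> P" "p \<in> (\<lambda>z. \<i> * z) ` P" using P(5) by blast
    have step: "Q k \<inter> Q (Suc k) \<noteq> {}" for k
    proof -
      obtain p' where "p' \<in> P" "p = \<i> * p'" using p by auto
      then have "\<i> ^ k * p \<in> Q k" "\<i> ^ k * p \<in> Q (Suc k)" using p unfolding Q_def by (auto simp: mult.assoc mult.left_commute)
      then show ?thesis by blast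
    qed
    have "connected (plane_set e)" unfolding plane
      using Q step[of 0] step[of 1] step[of 2] by (intro connected_Un) (auto simp: numeral_eq_Suc)
    moreover have "compact (plane_set e)" unfolding plane using Q by (intro compact_Un)
    ultimately show thesis using that[of "{plane_set e}"] True Q(3)[of 0] plane by auto
  next
    case False
    then have e1: "e = -1" using e by simp
    \<comment> \<open>The four open quarter sectors around the half-axes, pairwise disjoint; each
      contains one rotated copy of \<open>P\<close>.\<close>
    define H where "H k = (\<lambda>z. \<i> ^ k * z) ` {z. abs (Im z) < Re z}" for k :: nat
    have QH: "Q k \<subseteq> H k" for k unfolding Q_def H_def using P(6)[OF e1] by blast
    have HH: "H 0 = {z. abs (Im z) < Re z}" "H 1 \<subseteq> {z. abs (Re z) < Im z}"
      "H 2 \<subseteq> {z. abs (Im z) < - Re z}" "H 3 \<subseteq> {z. abs (Re z) < - Im z}"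
      unfolding H_def by (auto simp: power3_eq_cube)
    have sep: "z \<notin> Q k" if zQ: "z \<in> Q j" and jk: "(j, k) \<in> {(0,1),(0,2),(0,3),(1,2),(1,3),(2,3)}" for z j k
    proof
      assume "z \<in> Q k"
      then have zz: "z \<in> H j" "z \<in> H k" using QH zQ by auto
      have H: "z \<in> H 0 \<Longrightarrow> abs (Im z) < Re z" "z \<in> H 1 \<Longrightarrow> abs (Re z) < Im z"
        "z \<in> H 2 \<Longrightarrow> abs (Im z) < - Re z" "z \<in> H 3 \<Longrightarrow> abs (Re z) < - Im z" using HH by blast+
      consider "z \<in> H 0" "z \<in> H 1" | "z \<in> H 0" "z \<in> H 2" | "z \<in> H 0" "z \<in> H 3" | "z \<in> H 1" "z \<in> H 2"
        | "z \<in> H 1" "z \<in> H 3" | "z \<in> H 2" "z \<in> H 3"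
        using zz jk by auto
      then show False using H by cases linarith+
    qed
    have disj: "Q j \<inter> Q k = {}" if jk: "j \<in> {0,1,2,3}" "k \<in> {0,1,2,3}" "j \<noteq> k" for j k
    proof -
      have "(j, k) \<in> {(0,1),(0,2),(0,3),(1,2),(1,3),(2,3)} \<or> (k, j) \<in> {(0,1),(0,2),(0,3),(1,2),(1,3),(2,3)}"
        using jk by auto
      then show ?thesis using sep by blast
    qed
    have inj: "inj_on Q {0,1,2,3}"
      using disj Q(3) unfolding inj_on_def by (metis Int_absorb)
    show thesis
    proof (rule that[of "Q ` {0,1,2,3}"])
      show "card (Q ` {0,1,2,3}) = (if e = 1 then 1 else 4)" using card_image[OF inj] False by simp
      show "plane_set e = \<Union>(Q ` {0,1,2,3})" unfolding plane by auto
      show "K \<inter> L = {}" if KL: "K \<in> Q ` {0,1,2,3}" "L \<in> Q ` {0,1,2,3}" "K \<noteq> L" for K L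
      proof -
        obtain j where j: "j \<in> {0,1,2,3}" "K = Q j" using KL(1) by (rule imageE)
        obtain k where k: "k \<in> {0,1,2,3}" "L = Q k" using KL(2) by (rule imageE)
        have "j \<noteq> k" using j k KL(3) by metis
        then show ?thesis unfolding j(2) k(2) by (rule disj[OF j(1) k(1)])
      qed
    qed (use Q in auto)
  qed
qed

section \<open>Manifold structure and components of the surfaces\<close>

text \<open>The sphere of dimension d - 2 of directions orthogonal to the axis. In the plane it is a
  pair of opposite points, so components are counted relative to it instead of assuming it
  connected.\<close>

definition unit_perp :: "'a::euclidean_space \<Rightarrow> 'a set" where
  "unit_perp b = sphere 0 1 \<inter> {x. b \<bullet> x = 0}"

definition revolve :: "'a::euclidean_space \<Rightarrow> complex \<times> 'a \<Rightarrow> 'a" where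
  "revolve b p = (Re (fst p) + 10) *\<^sub>R snd p + Im (fst p) *\<^sub>R b"

text \<open>Polar coordinates around the axis are invertible here because the radius
  \<open>Re z + 10\<close> is positive on the whole plane set.\<close>

lemma revolve_homeomorphism:
  fixes b :: "'a::euclidean_space"
  assumes b: "norm b = 1" and e: "e = 1 \<or> e = -1"
  shows "homeomorphism (plane_set e \<times> unit_perp b) (surface b e) (revolve b)
           (\<lambda>x. (profile b x, perp b x /\<^sub>R norm (perp b x)))"
proof -
  have n: "norm z < 8" if "z \<in> plane_set e" for z
    using that curve_norm[OF e, of "wedge_fold z"] by (simp add: plane_set_def norm_wedge_fold)
  have R: "profile b (revolve b (z, w)) = z" "perp b (revolve b (z, w)) = (Re z + 10) *\<^sub>R w" "0 < Re z + 10"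
    if "z \<in> plane_set e" "w \<in> unit_perp b" for z w
  proof -
    have w: "norm w = 1" "w \<bullet> b = 0" using that by (auto simp: unit_perp_def inner_commute)
    show pos: "0 < Re z + 10" using n[OF that(1)] abs_Re_le_cmod[of z] by linarith
    show p: "perp b (revolve b (z, w)) = (Re z + 10) *\<^sub>R w"
      unfolding revolve_def by (simp add: perp_combination[OF b w(2)])
    have i: "revolve b (z, w) \<bullet> b = Im z"
      unfolding revolve_def by (simp add: perp_combination[OF b w(2)])
    show "profile b (revolve b (z, w)) = z" using pos w(1) by (simp add: profile_def p i complex_eq_iff)
  qed
  have pos: "perp b x \<noteq> 0" if "x \<in> surface b e" for x using surface_axis_dist[OF b e that] by auto
  have surf: "x \<in> surface b e \<longleftrightarrow> profile b x \<in> plane_set e" for x by (simp add: surface_def plane_set_def)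
  have inv: "revolve b (profile b x, perp b x /\<^sub>R norm (perp b x)) = x" if "x \<in> surface b e" for x
    using pos[OF that] perp_decomp[of x b] by (simp add: revolve_def profile_def)
  have dir: "perp b x /\<^sub>R norm (perp b x) \<in> unit_perp b" if "x \<in> surface b e" for x
    using pos[OF that] perp_orthogonal[OF b, of x] by (simp add: unit_perp_def inner_commute)
  show ?thesis
  proof (rule homeomorphismI)
    show "continuous_on (plane_set e \<times> unit_perp b) (revolve b)"
      unfolding revolve_def by (intro continuous_intros)
    show "continuous_on (surface b e) (\<lambda>x. (profile b x, perp b x /\<^sub>R norm (perp b x)))"
      using pos by (intro continuous_on_Pair continuous_profile) (auto simp: perp_def intro!: continuous_intros)
    show "revolve b ` (plane_set e \<times> unit_perp b) \<subseteq> surface b e" using R(1) by (auto simp: surf)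
    show "(\<lambda>x. (profile b x, perp b x /\<^sub>R norm (perp b x))) ` surface b e \<subseteq> plane_set e \<times> unit_perp b"
      using dir surf by blast
    show "(profile b (revolve b p), perp b (revolve b p) /\<^sub>R norm (perp b (revolve b p))) = p"
      if p': "p \<in> plane_set e \<times> unit_perp b" for p
    proof -
      obtain z w where p: "p = (z, w)" "z \<in> plane_set e" "w \<in> unit_perp b" using p' by auto
      have "norm w = 1" using p(3) by (simp add: unit_perp_def)
      then show ?thesis using R[OF p(2,3)] unfolding p(1) by simp
    qed
    show "revolve b (profile b y, perp b y /\<^sub>R norm (perp b y)) = y" if "y \<in> surface b e" for y
      by (rule inv[OF that])
  qed
qed

text \<open>Stereographic projection. In dimension 2 the remaining point corresponds to the zero
  subspace, so the same argument covers that case.\<close>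

lemma punctured_unit_perp:
  fixes b w :: "'a::euclidean_space"
  assumes d: "DIM('a) \<ge> 2" and b: "norm b = 1" and w: "w \<in> unit_perp b"
  obtains P where "subspace P" "P \<subseteq> {x. b \<bullet> x = 0}" "dim P = DIM('a) - 2" "unit_perp b - {w} homeomorphic P"
proof -
  have b0: "b \<noteq> 0" using b by auto
  have dimT: "dim {x. b \<bullet> x = 0} = DIM('a) - 1" by (rule dim_hyperplane[OF b0])
  have "DIM('a) - 2 \<le> dim {x. b \<bullet> x = 0}" unfolding dimT by simp
  then obtain P where P: "subspace P" "P \<subseteq> span {x. b \<bullet> x = 0}" "dim P = DIM('a) - 2"
    by (rule choose_subspace_of_subspace)
  have T: "subspace {x. b \<bullet> x = 0}" by (rule subspace_hyperplane)
  have "aff_dim {x. b \<bullet> x = 0} = aff_dim P + 1"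
    using aff_dim_subspace[OF T] aff_dim_subspace[OF P(1)] dimT P(3) d by simp
  then have "unit_perp b - {w} homeomorphic P"
    unfolding unit_perp_def using w P(1) T
    by (intro homeomorphic_punctured_affine_sphere_affine) (auto simp: unit_perp_def subspace_imp_affine)
  moreover have "P \<subseteq> {x. b \<bullet> x = 0}" using P(2) T by (simp add: span_eq_iff[THEN iffD2])
  ultimately show thesis using that P by blast
qed

lemma unit_perp_nonempty:
  fixes b :: "'a::euclidean_space"
  assumes "DIM('a) \<ge> 2" "norm b = 1"
  shows "unit_perp b \<noteq> {}"
proof -
  obtain d where "norm d = 1" "d \<bullet> b = 0" using unit_perp_direction[OF assms, of b] by blast
  then show ?thesis by (auto simp: unit_perp_def inner_commute)
qed

lemma compact_unit_perp: "compact (unit_perp b)"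
  unfolding unit_perp_def by (intro compact_Int_closed compact_sphere closed_hyperplane)

text \<open>Without one point the sphere is homeomorphic to a linear subspace and hence connected,
  so it has at most two components in every dimension.\<close>

lemma finite_components_unit_perp:
  fixes b :: "'a::euclidean_space"
  assumes "DIM('a) \<ge> 2" "norm b = 1"
  shows "finite (components (unit_perp b))"
proof -
  obtain w where w: "w \<in> unit_perp b" using unit_perp_nonempty[OF assms] by blast
  obtain P :: "'a set" where P: "subspace P" "unit_perp b - {w} homeomorphic P" using punctured_unit_perp[OF assms w] by blast
  have con: "connected (unit_perp b - {w})"
    using homeomorphic_connectedness[OF P(2)] subspace_imp_convex[OF P(1)] convex_connected by blast
  have "finite (connected_component_set (unit_perp b) ` (unit_perp b - {w}))"
  proof (cases "unit_perp b - {w} = {}")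
    case False
    then obtain v where v: "v \<in> unit_perp b - {w}" by blast
    have "connected_component_set (unit_perp b) x = connected_component_set (unit_perp b) v" if "x \<in> unit_perp b - {w}" for x
      using that v con by (intro connected_component_eq) (auto simp: connected_component_def intro!: exI[of _ "unit_perp b - {w}"])
    then have "connected_component_set (unit_perp b) ` (unit_perp b - {w}) \<subseteq> {connected_component_set (unit_perp b) v}" by blast
    then show ?thesis by (rule finite_subset) simp
  qed (simp only: image_empty finite.emptyI)
  moreover have "components (unit_perp b) \<subseteq> insert (connected_component_set (unit_perp b) w)
      (connected_component_set (unit_perp b) ` (unit_perp b - {w}))"
    unfolding components_def by blast
  ultimately show ?thesis by (meson finite_insert finite_subset)
qed

lemma homeomorphic_Times:
  assumes "A homeomorphic B" "C homeomorphic D"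
  shows "A \<times> C homeomorphic B \<times> D"
proof -
  obtain f f' g g' where f: "homeomorphism A B f f'" and g: "homeomorphism C D g g'"
    using assms unfolding homeomorphic_def by blast
  have c: "continuous_on (X \<times> Y) (\<lambda>p. (h (fst p), k (snd p)))" if "continuous_on X h" "continuous_on Y k"
    for h k X Y
    using that by (intro continuous_on_Pair; elim continuous_on_compose2) (auto intro!: continuous_intros)
  have "homeomorphism (A \<times> C) (B \<times> D) (\<lambda>p. (f (fst p), g (snd p))) (\<lambda>p. (f' (fst p), g' (snd p)))"
  proof (rule homeomorphismI)
    show "continuous_on (A \<times> C) (\<lambda>p. (f (fst p), g (snd p)))" "continuous_on (B \<times> D) (\<lambda>p. (f' (fst p), g' (snd p)))"
      using f g by (auto intro!: c simp: homeomorphism_def)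
  qed (use f g in \<open>auto simp: homeomorphism_def\<close>)
  then show ?thesis unfolding homeomorphic_def by blast
qed

text \<open>A chart is the product of a chart of the plane set with a stereographic chart of the
  sphere. To realize the product of an interval and \<open>P\<close> inside the ambient space, the
  interval is laid along \<open>b\<close>, which is orthogonal to \<open>P\<close>.\<close>

lemma surface_manifold:
  fixes b :: "'a::euclidean_space"
  assumes d: "DIM('a) \<ge> 2" and b: "norm b = 1" and e: "e = 1 \<or> e = -1"
  shows "top_manifold_no_boundary (DIM('a) - 1) (surface b e)"
  unfolding top_manifold_no_boundary_def
proof
  fix p assume p: "p \<in> surface b e"
  let ?i = "\<lambda>x. (profile b x, perp b x /\<^sub>R norm (perp b x))"
  have hom: "homeomorphism (plane_set e \<times> unit_perp b) (surface b e) (revolve b) ?i"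
    by (rule revolve_homeomorphism[OF b e])
  obtain z w where zw: "z \<in> plane_set e" "w \<in> unit_perp b" "p = revolve b (z, w)"
    using p homeomorphism_image1[OF hom] by blast
  obtain U and I :: "real set" where U: "openin (top_of_set (plane_set e)) U" "z \<in> U" "open I" "U homeomorphic I"
    using plane_chart[OF e zw(1)] by blast
  have "w \<noteq> 0" using zw(2) by (auto simp: unit_perp_def)
  \<comment> \<open>The antipode is a puncture different from \<open>w\<close> that exists even when
    the sphere has only two points.\<close>
  have mw: "- w \<in> unit_perp b" "- w \<noteq> w"
  proof -
    show "- w \<in> unit_perp b" using zw(2) by (simp add: unit_perp_def)
    show "- w \<noteq> w"
    proof
      assume "- w = w"
      then have "2 *\<^sub>R w = 0" unfolding scaleR_2 by (metis add.right_inverse)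
      then show False using \<open>w \<noteq> 0\<close> by simp
    qed
  qed
  obtain P where P: "subspace P" "P \<subseteq> {x. b \<bullet> x = 0}" "dim P = DIM('a) - 2" "unit_perp b - {- w} homeomorphic P"
    using punctured_unit_perp[OF d b mw(1)] by blast
  let ?S = "unit_perp b - {- w}"
  let ?T = "span (insert b P)"
  have spanP: "span P = P" using P(1) by (simp add: span_eq_iff)
  have bP: "b \<notin> P" using P(2) b by auto
  have inT: "x \<in> ?T \<longleftrightarrow> x - (x \<bullet> b) *\<^sub>R b \<in> P" for x
  proof
    assume "x \<in> ?T"
    then obtain k where k: "x - k *\<^sub>R b \<in> P" unfolding span_insert spanP by auto
    then have "b \<bullet> (x - k *\<^sub>R b) = 0" using P(2) by blast
    then have "k = x \<bullet> b" using b by (simp add: inner_diff_right dot_square_norm inner_commute)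
    then show "x - (x \<bullet> b) *\<^sub>R b \<in> P" using k by simp
  qed (auto simp: span_insert spanP)
  have dimT: "dim ?T = DIM('a) - 1" unfolding dim_span dim_insert spanP using P(3) d bP by simp
  define V where "V = ?T \<inter> {x. x \<bullet> b \<in> I}"
  have "open {x. x \<bullet> b \<in> I}"
    using open_vimage[OF U(3), of "\<lambda>x. x \<bullet> b"] by (simp add: vimage_def continuous_intros)
  then have V: "openin (top_of_set ?T) V" unfolding V_def by (rule openin_open_Int)
  have "I \<times> P homeomorphic V"
    unfolding homeomorphic_def
  proof (intro exI)
    show "homeomorphism (I \<times> P) V (\<lambda>q. fst q *\<^sub>R b + snd q) (\<lambda>x. (x \<bullet> b, x - (x \<bullet> b) *\<^sub>R b))"
    proof (rule homeomorphismI)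
      have *: "(r *\<^sub>R b + y) \<bullet> b = r" if "y \<in> P" for r y
      proof -
        have "y \<bullet> b = 0" using that P(2) by (auto simp: inner_commute)
        then show ?thesis using b by (simp add: inner_add_left dot_square_norm)
      qed
      show "(\<lambda>q. fst q *\<^sub>R b + snd q) ` (I \<times> P) \<subseteq> V" unfolding V_def by (auto simp: inT *)
      show "(\<lambda>x. (x \<bullet> b, x - (x \<bullet> b) *\<^sub>R b)) ` V \<subseteq> I \<times> P" unfolding V_def by (auto simp: inT)
      show "((fst q *\<^sub>R b + snd q) \<bullet> b, fst q *\<^sub>R b + snd q - ((fst q *\<^sub>R b + snd q) \<bullet> b) *\<^sub>R b) = q" if "q \<in> I \<times> P" for q
        using that by (auto simp: *)
    qed (auto intro!: continuous_intros)
  qed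
  moreover have "U \<times> ?S homeomorphic I \<times> P" using U(4) P(4) by (rule homeomorphic_Times)
  moreover have "U \<times> ?S homeomorphic revolve b ` (U \<times> ?S)"
  proof -
    have "U \<subseteq> plane_set e" using U(1) by (simp add: openin_imp_subset)
    then have "homeomorphism (U \<times> ?S) (revolve b ` (U \<times> ?S)) (revolve b) ?i"
      by (intro homeomorphism_of_subsets[OF hom, where T'' = "{}"]) auto
    then show ?thesis unfolding homeomorphic_def by blast
  qed
  ultimately have "revolve b ` (U \<times> ?S) homeomorphic V" by (meson homeomorphic_sym homeomorphic_trans)
  moreover have "openin (top_of_set (surface b e)) (revolve b ` (U \<times> ?S))"
  proof (rule homeomorphism_imp_open_map[OF hom])
    have "openin (top_of_set (unit_perp b)) ?S" by (simp add: openin_delete)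
    then show "openin (top_of_set (plane_set e \<times> unit_perp b)) (U \<times> ?S)" using U(1) by (simp add: openin_Times)
  qed
  moreover have "p \<in> revolve b ` (U \<times> ?S)" using zw U(2) mw(2) by auto
  ultimately show "\<exists>U T V. openin (top_of_set (surface b e)) U \<and> p \<in> U \<and> subspace (T::'a set) \<and> dim T = DIM('a) - 1 \<and>
      openin (top_of_set T) V \<and> U homeomorphic V"
    using dimT V subspace_span by blast
qed

text \<open>The components are the revolved products of a piece of the plane set with a component of
  the sphere; these are finitely many disjoint compact connected sets.\<close>

lemma surface_components:
  fixes b :: "'a::euclidean_space"
  assumes d: "DIM('a) \<ge> 2" and b: "norm b = 1" and e: "e = 1 \<or> e = -1"
  shows "finite (components (surface b e))"
    "card (components (surface b e)) = (if e = 1 then 1 else 4) * card (components (unit_perp b))"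
proof -
  let ?i = "\<lambda>x. (profile b x, perp b x /\<^sub>R norm (perp b x))"
  have hom: "homeomorphism (plane_set e \<times> unit_perp b) (surface b e) (revolve b) ?i"
    by (rule revolve_homeomorphism[OF b e])
  obtain \<K> where K: "finite \<K>" "card \<K> = (if e = 1 then 1 else 4)" "plane_set e = \<Union>\<K>"
    "\<And>K. K \<in> \<K> \<Longrightarrow> compact K \<and> connected K \<and> K \<noteq> {}"
    "\<And>K L. K \<in> \<K> \<Longrightarrow> L \<in> \<K> \<Longrightarrow> K \<noteq> L \<Longrightarrow> K \<inter> L = {}"
    using plane_partition[OF e] by blast
  let ?S = "components (unit_perp b)"
  have S: "compact D \<and> connected D \<and> D \<noteq> {} \<and> D \<subseteq> unit_perp b" if "D \<in> ?S" for D
    using that compact_components[OF compact_unit_perp] in_components_connected in_components_nonempty in_components_subset by blast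
  define f where "f p = revolve b ` (fst p \<times> snd p)" for p
  have inj: "inj_on (revolve b) (plane_set e \<times> unit_perp b)"
    using hom unfolding homeomorphism_def inj_on_def by metis
  have sub: "K \<times> D \<subseteq> plane_set e \<times> unit_perp b" if "K \<in> \<K>" "D \<in> ?S" for K D
    using that K(3) S by blast
  have dis: "f p \<inter> f q = {}" if pq: "p \<in> \<K> \<times> ?S" "q \<in> \<K> \<times> ?S" "p \<noteq> q" for p q
  proof -
    obtain K D L E where p: "p = (K, D)" "K \<in> \<K>" "D \<in> ?S" and q: "q = (L, E)" "L \<in> \<K>" "E \<in> ?S" using pq by auto
    have "(K \<times> D) \<inter> (L \<times> E) = {}"
      using pq(3) K(5)[OF p(2) q(2)] components_eq[OF p(3) q(3)] unfolding p(1) q(1) by auto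
    then show ?thesis
      using inj_on_image_Int[OF inj sub[OF p(2,3)] sub[OF q(2,3)]] unfolding f_def p(1) q(1) by simp
  qed
  have ne: "f p \<noteq> {}" if "p \<in> \<K> \<times> ?S" for p using that K(4) S unfolding f_def by fastforce
  have finj: "inj_on f (\<K> \<times> ?S)" using dis ne unfolding inj_on_def by (metis Int_absorb)
  have fin: "finite (\<K> \<times> ?S)" using K(1) finite_components_unit_perp[OF d b] by simp
  have "components (surface b e) = f ` (\<K> \<times> ?S)"
  proof (rule components_eq_finite_compact_partition)
    show "finite (f ` (\<K> \<times> ?S))" using fin by simp
    have "plane_set e \<times> unit_perp b = (\<Union>p \<in> \<K> \<times> ?S. fst p \<times> snd p)"
    proof (intro set_eqI iffI)
      fix x assume "x \<in> plane_set e \<times> unit_perp b"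
      then obtain z w where x: "z \<in> plane_set e" "w \<in> unit_perp b" "x = (z, w)" by (rule SigmaE)
      have "z \<in> \<Union>\<K>" using x(1) unfolding K(3) .
      then obtain L where "L \<in> \<K>" "z \<in> L" by (rule UnionE)
      moreover have "w \<in> \<Union>?S" using x(2) Union_components[of "unit_perp b"] by simp
      then obtain D where "D \<in> ?S" "w \<in> D" by (rule UnionE)
      ultimately show "x \<in> (\<Union>p \<in> \<K> \<times> ?S. fst p \<times> snd p)"
        unfolding x(3) by (intro UN_I[of "(L, D)"]) simp_all
    next
      fix x assume "x \<in> (\<Union>p \<in> \<K> \<times> ?S. fst p \<times> snd p)"
      then obtain q where q: "q \<in> \<K> \<times> ?S" "x \<in> fst q \<times> snd q" by (rule UN_E)
      then show "x \<in> plane_set e \<times> unit_perp b" using sub[of "fst q" "snd q"] by (auto simp: mem_Times_iff)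
    qed
    then show "surface b e = \<Union>(f ` (\<K> \<times> ?S))"
      unfolding homeomorphism_image1[OF hom, symmetric] f_def by (simp only: image_UN)
    show "A \<inter> B = {}" if "A \<in> f ` (\<K> \<times> ?S)" "B \<in> f ` (\<K> \<times> ?S)" "A \<noteq> B" for A B
      using that dis by blast
    show "compact A \<and> connected A \<and> A \<noteq> {}" if A: "A \<in> f ` (\<K> \<times> ?S)" for A
    proof -
      obtain L D where "L \<in> \<K>" "D \<in> ?S" "A = revolve b ` (L \<times> D)" using A unfolding f_def by auto
      moreover have "continuous_on (L \<times> D) (revolve b)" unfolding revolve_def by (intro continuous_intros)
      ultimately show ?thesis using K(4)[of L] S[of D]
        by (auto intro!: compact_continuous_image connected_continuous_image compact_Times connected_Times)
    qed
  qed
  then show "finite (components (surface b e))"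
    "card (components (surface b e)) = (if e = 1 then 1 else 4) * card ?S"
    using fin card_image[OF finj] K(2) by (simp_all add: card_cartesian_product)
qed

theorem theorem5p1:
  assumes "DIM('a::euclidean_space) \<ge> 2"
  shows "\<exists>(S::'a set) C C'. finite S \<and>
           compact C \<and> top_manifold_no_boundary (DIM('a) - 1) C \<and>
           compact C' \<and> top_manifold_no_boundary (DIM('a) - 1) C' \<and>
           finite (components C) \<and> finite (components C') \<and>
           card (components C) \<noteq> card (components C') \<and>
           S \<subseteq> C \<inter> C' \<and> eps_sample 0.72 S C \<and> eps_sample 0.72 S C'"
proof -
  obtain b :: 'a where b: "norm b = 1" using vector_choose_size[of 1] by auto
  have e: "(1::real) = 1 \<or> (1::real) = -1" "(-1::real) = 1 \<or> (-1::real) = -1" by auto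
  obtain S where S: "finite S" "S \<subseteq> surface b 1 \<inter> surface b (-1)"
    "\<And>p. p \<in> surface b 1 \<Longrightarrow> \<exists>s\<in>S. medial_axis (surface b 1) = {} \<or> dist p s < 18/25 * lfs (surface b 1) p"
    by (rule finite_sample[OF assms b e(1)]) blast
  obtain S' where S': "finite S'" "S' \<subseteq> surface b 1 \<inter> surface b (-1)"
    "\<And>p. p \<in> surface b (-1) \<Longrightarrow> \<exists>s\<in>S'. medial_axis (surface b (-1)) = {} \<or> dist p s < 18/25 * lfs (surface b (-1)) p"
    by (rule finite_sample[OF assms b e(2)]) blast
  have eps: "(0.72::real) = 18/25" by simp
  \<comment> \<open>Each of the two samples lies in both surfaces, and adding points of a surface to
    one of its samples preserves the condition.\<close>
  have "eps_sample 0.72 (S \<union> S') (surface b 1)" "eps_sample 0.72 (S \<union> S') (surface b (-1))"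
    using S S' unfolding eps_sample_def eps by blast+
  \<comment> \<open>The counts differ by a factor of 4, so the common factor has to be
    nonzero.\<close>
  moreover have "card (components (unit_perp b)) > 0"
    using finite_components_unit_perp[OF assms b] unit_perp_nonempty[OF assms b] by (simp add: card_gt_0_iff components_eq_empty)
  then have "card (components (surface b 1)) \<noteq> card (components (surface b (-1)))"
    unfolding surface_components(2)[OF assms b e(1)] surface_components(2)[OF assms b e(2)] by simp
  ultimately show ?thesis
    using S(1,2) S'(1,2) compact_surface[OF b] surface_manifold[OF assms b] surface_components(1)[OF assms b] e
    by (intro exI[of _ "S \<union> S'"] exI[of _ "surface b 1"] exI[of _ "surface b (-1)"]) simp
qed

end
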